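(* Let $s\ge 0$, $\alpha>0$ and $T>0$ be given. Then for each $u_0,u_1\in H^s_p(\mathbb{T})$ with $[u_0]=[u_1]$ there exists a function $h\in L^2([0,T];H^s_p(\mathbb{T}))$ such that the unique solution $u\in C([0,T];H^s_p(\mathbb{T}))$ of $$\partial_t u-\alpha\mathcal{H}\partial_x^2u-\partial_x^3u=G(h)(x,t),\quad t\in(0,T),\ x\in\mathbb{T},\qquad u(x,0)=u_0(x),\ x\in\mathbb{T},$$ satisfies $u(x,T)=u_1(x)$, $x\in\mathbb{T}$. Moreover, there exists a positive constant $\nu\equiv\nu(s,g,T)>0$ such that $$\|h\|_{L^2([0,T];H^s_p(\mathbb{T}))}\le \nu\,\bigl(\|u_0\|_{H^s_p(\mathbb{T})}+\|u_1\|_{H^s_p(\mathbb{T})}\bigr).$$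
   Context: $\mathbb{T}=\mathbb{R}/(2\pi\mathbb{Z})$. For a periodic distribution $f$ on $\mathbb{T}$, $\widehat f(k)=\frac1{2\pi}\int_0^{2\pi}f(x)e^{-ikx}dx$ ($k\in\mathbb{Z}$) are its Fourier coefficients, and $H^s_p(\mathbb{T})$ is the Hilbert space of periodic distributions with $\|f\|^2_{H^s_p(\mathbb{T})}=2\pi\sum_{k\in\mathbb{Z}}(1+|k|^2)^s|\widehat f(k)|^2<\infty$. $[f]=\frac1{2\pi}\int_0^{2\pi}f(x)\,dx$ is the mean value of $f$. $\mathcal{H}$ is the periodic Hilbert transform: $\widehat{\mathcal{H}f}(k)=-i\,\mathrm{sgn}(k)\widehat f(k)$, with $\mathrm{sgn}(0)=0$. Throughout, $g$ is a fixed real non-negative smooth function on $\mathbb{T}$ with $2\pi[g]=\int_0^{2\pi}g(x)\,dx=1$, supported in $\omega$, where $\omega=\{x\in\mathbb{T}:g(x)>0\}$ is an open interval. The operator $G$ is $$G(h)(x,t)=g(x)\Bigl[h(x,t)-\int_0^{2\pi}g(y)h(y,t)\,dy\Bigr].$$ Solutions are mild solutions: $u(t)=U(t)u_0+\int_0^tU(t-t')G(h)(\cdot,t')\,dt'$, where $\widehat{U(t)\varphi}(k)=e^{ik^2[\alpha\,\mathrm{sgn}(k)-k]t}\,\widehat\varphi(k)$. The notation $\nu(s,g,T)$ displays the quantities on which the constant depends; in particular $\nu$ does not depend on $u_0,u_1$. *)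

theory Defs
  imports "HOL-Analysis.Analysis"
begin

text \<open>
  A function on the torus is a \<open>2\<pi>\<close>-periodic function on the line. All function spaces are
  complex-valued, as the definition of the spaces \<open>H\<^sup>s\<^sub>p\<close> through arbitrary complex Fourier
  coefficients suggests.
\<close>

definition vderiv :: "(real \<Rightarrow> 'a::real_normed_vector) \<Rightarrow> real \<Rightarrow> 'a" where
  "vderiv f = (\<lambda>x. vector_derivative f (at x))"

definition smooth_periodic :: "(real \<Rightarrow> 'a::real_normed_vector) set" where
  "smooth_periodic =
     {f. (\<forall>x. f (x + 2 * pi) = f x) \<and> (\<forall>n x. (vderiv ^^ n) f differentiable (at x))}"

text \<open>The increasing family of norms defining the Frechet topology of \<open>C\<^sup>\<infinity>\<close> of the torus.\<close>

definition test_norm :: "nat \<Rightarrow> (real \<Rightarrow> complex) \<Rightarrow> real" where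
  "test_norm N \<phi> = (\<Sum>j\<le>N. SUP x. norm ((vderiv ^^ j) \<phi> x))"


lemma vderiv_periodic:
  fixes f :: "real \<Rightarrow> 'a::real_normed_vector"
  assumes p: "\<And>x. f (x + 2 * pi) = f x"
  shows "vderiv f (x + 2 * pi) = vderiv f x"
proof -
  have "(f has_vector_derivative d) (at (x + 2 * pi)) \<longleftrightarrow> (f has_vector_derivative d) (at x)" for d
  proof
    assume "(f has_vector_derivative d) (at (x + 2 * pi))"
    hence "((f \<circ> (\<lambda>y. y + 2 * pi)) has_vector_derivative (1 *\<^sub>R d)) (at x)"
      by (intro vector_diff_chain_at) (auto intro!: derivative_eq_intros)
    thus "(f has_vector_derivative d) (at x)" by (simp add: o_def p)
  next
    assume "(f has_vector_derivative d) (at x)"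
    hence "((f \<circ> (\<lambda>y. y - 2 * pi)) has_vector_derivative (1 *\<^sub>R d)) (at (x + 2 * pi))"
      by (intro vector_diff_chain_at) (auto intro!: derivative_eq_intros)
    moreover have "f (y - 2 * pi) = f y" for y using p[of "y - 2 * pi"] by simp
    ultimately show "(f has_vector_derivative d) (at (x + 2 * pi))" by (simp add: o_def)
  qed
  thus ?thesis unfolding vderiv_def vector_derivative_def by simp
qed

lemma smooth_periodic_vderiv:
  assumes "f \<in> smooth_periodic"
  shows "vderiv f \<in> smooth_periodic"
proof -
  have "(vderiv ^^ n) (vderiv f) differentiable (at x)" for n x
    using assms by (simp add: smooth_periodic_def flip: funpow_Suc_right[THEN fun_cong, unfolded o_apply] del: funpow.simps)
  thus ?thesis using assms vderiv_periodic[of f] by (auto simp: smooth_periodic_def)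
qed

lemma smooth_periodic_differentiable:
  assumes "f \<in> smooth_periodic" shows "f differentiable (at x)"
proof -
  have "(vderiv ^^ 0) f differentiable (at x)"
    using assms unfolding smooth_periodic_def by blast
  thus ?thesis by simp
qed

lemma smooth_periodic_has_vderiv:
  assumes "f \<in> smooth_periodic" shows "(f has_vector_derivative vderiv f x) (at x)"
  using smooth_periodic_differentiable[OF assms] by (simp add: vderiv_def vector_derivative_works)

lemma smooth_periodic_funpow:
  assumes "f \<in> smooth_periodic" shows "(vderiv ^^ n) f \<in> smooth_periodic"
  by (induction n) (use assms in \<open>auto intro: smooth_periodic_vderiv\<close>)

lemma vderiv_add:
  assumes "f \<in> smooth_periodic" "g \<in> smooth_periodic"
  shows "vderiv (\<lambda>x. f x + g x) = (\<lambda>x. vderiv f x + vderiv g x)"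
  unfolding vderiv_def[of "\<lambda>x. f x + g x"]
  using smooth_periodic_has_vderiv[OF assms(1)] smooth_periodic_has_vderiv[OF assms(2)]
  by (intro ext vector_derivative_at has_vector_derivative_add)

lemma funpow_vderiv_add:
  assumes "f \<in> smooth_periodic" "g \<in> smooth_periodic"
  shows "(vderiv ^^ n) (\<lambda>x. f x + g x) = (\<lambda>x. (vderiv ^^ n) f x + (vderiv ^^ n) g x)"
proof (induction n)
  case (Suc n)
  thus ?case
    using vderiv_add[OF smooth_periodic_funpow[OF assms(1)] smooth_periodic_funpow[OF assms(2)]]
    by simp
qed simp

lemma smooth_periodic_add:
  assumes "f \<in> smooth_periodic" "g \<in> smooth_periodic"
  shows "(\<lambda>x. f x + g x) \<in> smooth_periodic"
proof -
  have "(\<lambda>x. (vderiv ^^ n) f x + (vderiv ^^ n) g x) differentiable (at y)" for n y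
    by (intro differentiable_add smooth_periodic_differentiable smooth_periodic_funpow assms)
  thus ?thesis using assms
    by (simp add: smooth_periodic_def funpow_vderiv_add[OF assms])
qed

lemma vderiv_bounded_linear:
  assumes L: "bounded_linear L" and f: "f \<in> smooth_periodic"
  shows "vderiv (\<lambda>x. L (f x)) = (\<lambda>x. L (vderiv f x))"
  unfolding vderiv_def[of "\<lambda>x. L (f x)"]
  by (intro ext vector_derivative_at bounded_linear.has_vector_derivative[OF L]
        smooth_periodic_has_vderiv f)

lemma funpow_vderiv_bounded_linear:
  assumes L: "bounded_linear L" and f: "f \<in> smooth_periodic"
  shows "(vderiv ^^ n) (\<lambda>x. L (f x)) = (\<lambda>x. L ((vderiv ^^ n) f x))"
proof (induction n)
  case (Suc n)
  thus ?case using vderiv_bounded_linear[OF L smooth_periodic_funpow[OF f]] by simp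
qed simp

lemma smooth_periodic_bounded_linear:
  assumes L: "bounded_linear L" and f: "f \<in> smooth_periodic"
  shows "(\<lambda>x. L (f x)) \<in> smooth_periodic"
proof -
  have "(\<lambda>x. L ((vderiv ^^ n) f x)) differentiable (at y)" for n y
    using bounded_linear.has_vector_derivative[OF L
        smooth_periodic_has_vderiv[OF smooth_periodic_funpow[OF f, of n], of y]]
    by (rule differentiableI_vector)
  thus ?thesis using f
    by (simp add: smooth_periodic_def funpow_vderiv_bounded_linear[OF L f])
qed

lemma smooth_periodic_of_real:
  fixes g :: "real \<Rightarrow> real"
  shows "g \<in> smooth_periodic \<Longrightarrow> (\<lambda>x. complex_of_real (g x)) \<in> smooth_periodic"
  by (rule smooth_periodic_bounded_linear[OF bounded_linear_of_real])

lemma smooth_periodic_scale: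
  fixes f :: "real \<Rightarrow> complex"
  shows "f \<in> smooth_periodic \<Longrightarrow> (\<lambda>x. c * f x) \<in> smooth_periodic"
  by (rule smooth_periodic_bounded_linear[OF bounded_linear_mult_right])

lemma vderiv_mult:
  fixes f g :: "real \<Rightarrow> complex"
  assumes "f \<in> smooth_periodic" "g \<in> smooth_periodic"
  shows "vderiv (\<lambda>x. f x * g x) = (\<lambda>x. f x * vderiv g x + vderiv f x * g x)"
  unfolding vderiv_def[of "\<lambda>x. f x * g x"]
  using smooth_periodic_has_vderiv[OF assms(1)] smooth_periodic_has_vderiv[OF assms(2)]
  by (intro ext vector_derivative_at has_vector_derivative_mult)

lemma smooth_periodic_mult:
  fixes f g :: "real \<Rightarrow> complex"
  assumes "f \<in> smooth_periodic" "g \<in> smooth_periodic"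
  shows "(\<lambda>x. f x * g x) \<in> smooth_periodic"
proof -
  have d: "\<forall>f g :: real \<Rightarrow> complex. f \<in> smooth_periodic \<longrightarrow> g \<in> smooth_periodic \<longrightarrow>
     (\<exists>D. D 0 = (\<lambda>x. f x * g x) \<and> (\<forall>k<n. \<forall>x. (D k has_vector_derivative D (Suc k) x) (at x)))" for n
  proof (induction n)
    case (Suc n)
    show ?case
    proof (intro allI impI)
      fix f g :: "real \<Rightarrow> complex" assume fg: "f \<in> smooth_periodic" "g \<in> smooth_periodic"
      obtain A where A: "A 0 = (\<lambda>x. f x * vderiv g x)"
        "\<forall>k<n. \<forall>x. (A k has_vector_derivative A (Suc k) x) (at x)"
        using Suc fg smooth_periodic_vderiv by blast
      obtain B where B: "B 0 = (\<lambda>x. vderiv f x * g x)"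
        "\<forall>k<n. \<forall>x. (B k has_vector_derivative B (Suc k) x) (at x)"
        using Suc fg smooth_periodic_vderiv by blast
      define D where "D = (\<lambda>k. case k of 0 \<Rightarrow> (\<lambda>x. f x * g x) | Suc k \<Rightarrow> (\<lambda>x. A k x + B k x))"
      have "(D k has_vector_derivative D (Suc k) x) (at x)" if "k < Suc n" for k x
      proof (cases k)
        case 0
        thus ?thesis
          using has_vector_derivative_mult[OF smooth_periodic_has_vderiv[OF fg(1), of x]
              smooth_periodic_has_vderiv[OF fg(2), of x]]
          by (simp add: D_def A B)
      next
        case (Suc j)
        thus ?thesis using that A B by (auto simp: D_def intro!: has_vector_derivative_add)
      qed
      thus "\<exists>D. D 0 = (\<lambda>x. f x * g x) \<and>
          (\<forall>k<Suc n. \<forall>x. (D k has_vector_derivative D (Suc k) x) (at x))"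
        by (intro exI[of _ D]) (auto simp: D_def)
    qed
  qed auto
  have "(vderiv ^^ n) (\<lambda>x. f x * g x) differentiable (at x)" for n x
  proof -
    obtain D where D: "D 0 = (\<lambda>x. f x * g x)"
      "\<And>k x. k < Suc n \<Longrightarrow> (D k has_vector_derivative D (Suc k) x) (at x)"
      using d[of "Suc n"] assms by blast
    have "k \<le> n \<Longrightarrow> (vderiv ^^ k) (\<lambda>x. f x * g x) = D k" for k
    proof (induction k)
      case (Suc k)
      thus ?case using D(2)[of k] by (auto simp: vderiv_def intro!: ext vector_derivative_at)
    qed (simp add: D)
    thus ?thesis using D(2)[of n x] by (auto intro: differentiableI_vector)
  qed
  thus ?thesis using assms by (simp add: smooth_periodic_def)
qed

lemma smooth_periodic_bounded:
  fixes f :: "real \<Rightarrow> 'a::real_normed_vector"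
  assumes f: "f \<in> smooth_periodic"
  shows "bdd_above (range (\<lambda>x. norm (f x)))"
proof -
  have c: "continuous_on UNIV f"
    by (intro continuous_at_imp_continuous_on ballI differentiable_imp_continuous_within
        smooth_periodic_differentiable f)
  hence "compact ((\<lambda>x. norm (f x)) ` {0..2*pi})"
    by (intro compact_continuous_image continuous_on_norm) (auto intro: continuous_on_subset)
  then obtain B where B: "\<And>x. x \<in> {0..2*pi} \<Longrightarrow> norm (f x) \<le> B"
    by (metis bounded_imp_bdd_above compact_imp_bounded bdd_above.unfold imageI)
  have per: "f (x + 2 * pi) = f x" for x using f by (simp add: smooth_periodic_def)
  have n: "f (x + 2 * pi * real n) = f x" for x n
  proof (induction n)
    case (Suc n)
    have "f (x + 2 * pi * real (Suc n)) = f ((x + 2 * pi * real n) + 2 * pi)"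
      by (simp add: algebra_simps)
    thus ?case using Suc per by simp
  qed simp
  have z: "f (x + 2 * pi * of_int k) = f x" for x k
  proof (cases "k \<ge> 0")
    case True
    thus ?thesis using n[of x "nat k"] by simp
  next
    case False
    thus ?thesis using n[of "x + 2 * pi * of_int k" "nat (-k)"] by (simp add: algebra_simps)
  qed
  have "norm (f x) \<le> B" for x
  proof -
    define k where "k = \<lfloor>x / (2 * pi)\<rfloor>"
    have "of_int k \<le> x / (2 * pi)" "x / (2 * pi) < of_int k + 1" by (auto simp: k_def)
    hence "x - 2 * pi * of_int k \<in> {0..2*pi}" by (auto simp: field_simps)
    from B[OF this] show ?thesis using z[of x "-k"] by simp
  qed
  thus ?thesis by (auto intro!: bdd_aboveI)
qed

lemma norm_le_test_norm:
  assumes "\<phi> \<in> smooth_periodic" "j \<le> N"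
  shows "norm ((vderiv ^^ j) \<phi> x) \<le> test_norm N \<phi>"
proof -
  have b: "bdd_above (range (\<lambda>x. norm ((vderiv ^^ i) \<phi> x)))" for i
    by (intro smooth_periodic_bounded smooth_periodic_funpow assms)
  have "norm ((vderiv ^^ j) \<phi> x) \<le> (SUP x. norm ((vderiv ^^ j) \<phi> x))"
    by (intro cSUP_upper b) auto
  also have "\<dots> \<le> test_norm N \<phi>" unfolding test_norm_def
    by (rule member_le_sum[of j _ "\<lambda>j. SUP x. norm ((vderiv ^^ j) \<phi> x)"])
       (use assms b in \<open>auto intro!: cSUP_upper2[where x = 0]\<close>)
  finally show ?thesis .
qed

lemma test_norm_nonneg:
  assumes "\<phi> \<in> smooth_periodic" shows "0 \<le> test_norm N \<phi>"
  using norm_le_test_norm[OF assms, of 0 N 0] norm_ge_zero order_trans by blast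

lemma test_norm_le:
  assumes "\<And>j x. j \<le> N \<Longrightarrow> norm ((vderiv ^^ j) \<phi> x) \<le> B"
  shows "test_norm N \<phi> \<le> real (Suc N) * B"
proof -
  have "test_norm N \<phi> \<le> (\<Sum>j\<le>N. B)" unfolding test_norm_def
    by (intro sum_mono cSUP_least) (use assms in auto)
  thus ?thesis by simp
qed

lemma test_norm_mono:
  assumes "\<phi> \<in> smooth_periodic" "M \<le> N" shows "test_norm M \<phi> \<le> test_norm N \<phi>"
  unfolding test_norm_def
  by (rule sum_mono2)
     (use assms in \<open>auto intro!: cSUP_upper2[where x = 0] smooth_periodic_bounded smooth_periodic_funpow\<close>)

lemma norm_vderiv_mult_le:
  fixes g :: "real \<Rightarrow> complex"
  assumes "g \<in> smooth_periodic"
  shows "\<exists>C\<ge>0. \<forall>\<phi>\<in>smooth_periodic. \<forall>x.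
           norm ((vderiv ^^ n) (\<lambda>x. g x * \<phi> x) x) \<le> C * test_norm n \<phi>"
  using assms
proof (induction n arbitrary: g)
  case 0
  obtain C where C: "\<And>x. norm (g x) \<le> C"
    using smooth_periodic_bounded[OF 0] by (auto simp: bdd_above_def)
  have "0 \<le> C" using C[of 0] norm_ge_zero order_trans by blast
  moreover have "norm (g x * \<phi> x) \<le> C * test_norm 0 \<phi>" if "\<phi> \<in> smooth_periodic" for \<phi> x
    using C norm_le_test_norm[OF that, of 0 0 x] \<open>0 \<le> C\<close>
    by (auto simp: norm_mult intro!: mult_mono)
  ultimately show ?case by auto
next
  case (Suc n)
  obtain C where C: "C \<ge> 0" "\<And>\<phi> x. \<phi> \<in> smooth_periodic \<Longrightarrow>
      norm ((vderiv ^^ n) (\<lambda>x. g x * \<phi> x) x) \<le> C * test_norm n \<phi>"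
    using Suc.IH[OF Suc.prems] by blast
  obtain C' where C': "C' \<ge> 0" "\<And>\<phi> x. \<phi> \<in> smooth_periodic \<Longrightarrow>
      norm ((vderiv ^^ n) (\<lambda>x. vderiv g x * \<phi> x) x) \<le> C' * test_norm n \<phi>"
    using Suc.IH[OF smooth_periodic_vderiv[OF Suc.prems]] by blast
  show ?case
  proof (intro exI[of _ "C * real (Suc n) + C'"] conjI ballI allI)
    fix \<phi> :: "real \<Rightarrow> complex" and x assume \<phi>: "\<phi> \<in> smooth_periodic"
    note \<phi>' = smooth_periodic_vderiv[OF \<phi>]
    have "(vderiv ^^ Suc n) (\<lambda>x. g x * \<phi> x) x
        = (vderiv ^^ n) (\<lambda>x. g x * vderiv \<phi> x + vderiv g x * \<phi> x) x"
      by (simp add: funpow_swap1 vderiv_mult[OF Suc.prems \<phi>])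
    also have "\<dots> = (vderiv ^^ n) (\<lambda>x. g x * vderiv \<phi> x) x + (vderiv ^^ n) (\<lambda>x. vderiv g x * \<phi> x) x"
      by (subst funpow_vderiv_add)
         (auto intro!: smooth_periodic_mult Suc.prems \<phi> smooth_periodic_vderiv)
    also have "norm \<dots> \<le> C * test_norm n (vderiv \<phi>) + C' * test_norm n \<phi>"
      using C(2)[OF \<phi>', of x] C'(2)[OF \<phi>, of x] norm_triangle_ineq add_mono order_trans by blast
    also have "\<dots> \<le> C * (real (Suc n) * test_norm (Suc n) \<phi>) + C' * test_norm (Suc n) \<phi>"
    proof (intro add_mono mult_left_mono test_norm_le test_norm_mono)
      fix j y assume "j \<le> n"
      thus "norm ((vderiv ^^ j) (vderiv \<phi>) y) \<le> test_norm (Suc n) \<phi>"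
        using norm_le_test_norm[OF \<phi>, of "Suc j" "Suc n" y] by (simp add: funpow_swap1)
    qed (use C C' \<phi> in auto)
    finally show "norm ((vderiv ^^ Suc n) (\<lambda>x. g x * \<phi> x) x)
        \<le> (C * real (Suc n) + C') * test_norm (Suc n) \<phi>"
      by (simp add: algebra_simps)
  qed (use C C' in auto)
qed

lemma test_norm_mult_le:
  fixes g :: "real \<Rightarrow> complex"
  assumes g: "g \<in> smooth_periodic"
  shows "\<exists>C\<ge>0. \<forall>\<phi>\<in>smooth_periodic. test_norm N (\<lambda>x. g x * \<phi> x) \<le> C * test_norm N \<phi>"
proof -
  obtain C where C: "\<And>n. C n \<ge> 0" "\<And>n \<phi> x. \<phi> \<in> smooth_periodic \<Longrightarrow>
      norm ((vderiv ^^ n) (\<lambda>x. g x * \<phi> x) x) \<le> C n * test_norm n \<phi>"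
    using norm_vderiv_mult_le[OF g] by metis
  have "test_norm N (\<lambda>x. g x * \<phi> x) \<le> real (Suc N) * ((\<Sum>j\<le>N. C j) * test_norm N \<phi>)"
    if \<phi>: "\<phi> \<in> smooth_periodic" for \<phi>
  proof (rule test_norm_le)
    fix j x assume j: "j \<le> N"
    have "norm ((vderiv ^^ j) (\<lambda>x. g x * \<phi> x) x) \<le> C j * test_norm j \<phi>" by (rule C(2)[OF \<phi>])
    also have "\<dots> \<le> (\<Sum>j\<le>N. C j) * test_norm N \<phi>"
      by (intro mult_mono member_le_sum test_norm_mono test_norm_nonneg sum_nonneg)
         (use C \<phi> j in auto)
    finally show "norm ((vderiv ^^ j) (\<lambda>x. g x * \<phi> x) x) \<le> \<dots>" .
  qed
  thus ?thesis
    by (intro exI[of _ "real (Suc N) * (\<Sum>j\<le>N. C j)"])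
       (auto intro!: mult_nonneg_nonneg sum_nonneg C(1) simp: mult.assoc)
qed


text \<open>
  Periodic distributions: continuous linear functionals on the smooth periodic functions.
  The requirement that they vanish outside the test functions only makes the functional
  unique as a total HOL function.
\<close>

definition is_pdist :: "((real \<Rightarrow> complex) \<Rightarrow> complex) \<Rightarrow> bool" where
  "is_pdist f \<longleftrightarrow>
     (\<forall>\<phi>\<in>smooth_periodic. \<forall>\<psi>\<in>smooth_periodic. f (\<lambda>x. \<phi> x + \<psi> x) = f \<phi> + f \<psi>) \<and>
     (\<forall>\<phi>\<in>smooth_periodic. \<forall>c. f (\<lambda>x. c * \<phi> x) = c * f \<phi>) \<and>
     (\<exists>C N. \<forall>\<phi>\<in>smooth_periodic. norm (f \<phi>) \<le> C * test_norm N \<phi>) \<and>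
     (\<forall>\<phi>. \<phi> \<notin> smooth_periodic \<longrightarrow> f \<phi> = 0)"

lemma is_pdistI:
  assumes "\<And>\<phi> \<psi>. \<phi> \<in> smooth_periodic \<Longrightarrow> \<psi> \<in> smooth_periodic \<Longrightarrow> f (\<lambda>x. \<phi> x + \<psi> x) = f \<phi> + f \<psi>"
    and "\<And>\<phi> c. \<phi> \<in> smooth_periodic \<Longrightarrow> f (\<lambda>x. c * \<phi> x) = c * f \<phi>"
    and "\<And>\<phi>. \<phi> \<in> smooth_periodic \<Longrightarrow> norm (f \<phi>) \<le> C * test_norm N \<phi>"
    and "\<And>\<phi>. \<phi> \<notin> smooth_periodic \<Longrightarrow> f \<phi> = 0"
  shows "is_pdist f"
  unfolding is_pdist_def using assms by blast

lemma is_pdistD: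
  assumes "is_pdist f"
  shows "\<phi> \<in> smooth_periodic \<Longrightarrow> \<psi> \<in> smooth_periodic \<Longrightarrow> f (\<lambda>x. \<phi> x + \<psi> x) = f \<phi> + f \<psi>"
    and "\<phi> \<in> smooth_periodic \<Longrightarrow> f (\<lambda>x. c * \<phi> x) = c * f \<phi>"
    and "\<phi> \<notin> smooth_periodic \<Longrightarrow> f \<phi> = 0"
  using assms unfolding is_pdist_def by simp_all

typedef pdist = "{f. is_pdist f}"
  morphisms pairing Abs_pdist
  by (rule exI[of _ "\<lambda>_. 0"]) (auto simp: is_pdist_def intro!: exI[of _ 0])

setup_lifting type_definition_pdist

lemma is_pdist_bound:
  assumes "is_pdist f"
  obtains C N where "C \<ge> 0" "\<And>M \<phi>. M \<ge> N \<Longrightarrow> \<phi> \<in> smooth_periodic \<Longrightarrow> norm (f \<phi>) \<le> C * test_norm M \<phi>"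
proof -
  obtain C N where C: "\<And>\<phi>. \<phi> \<in> smooth_periodic \<Longrightarrow> norm (f \<phi>) \<le> C * test_norm N \<phi>"
    using assms unfolding is_pdist_def by blast
  show thesis
  proof (rule that[of "\<bar>C\<bar>" N])
    fix M and \<phi> :: "real \<Rightarrow> complex" assume "M \<ge> N" and \<phi>: "\<phi> \<in> smooth_periodic"
    have "norm (f \<phi>) \<le> C * test_norm N \<phi>" by (rule C[OF \<phi>])
    also have "\<dots> \<le> \<bar>C\<bar> * test_norm M \<phi>"
      by (intro mult_mono test_norm_mono test_norm_nonneg \<phi> \<open>M \<ge> N\<close>) auto
    finally show "norm (f \<phi>) \<le> \<bar>C\<bar> * test_norm M \<phi>" .
  qed simp
qed

lemma is_pdist_add:
  assumes f: "is_pdist f" and g: "is_pdist g" shows "is_pdist (\<lambda>\<phi>. f \<phi> + g \<phi>)"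
proof -
  obtain C N where C: "C \<ge> 0" "\<And>M \<phi>. M \<ge> N \<Longrightarrow> \<phi> \<in> smooth_periodic \<Longrightarrow> norm (f \<phi>) \<le> C * test_norm M \<phi>"
    using is_pdist_bound[OF f] by blast
  obtain C' N' where C': "C' \<ge> 0" "\<And>M \<phi>. M \<ge> N' \<Longrightarrow> \<phi> \<in> smooth_periodic \<Longrightarrow> norm (g \<phi>) \<le> C' * test_norm M \<phi>"
    using is_pdist_bound[OF g] by blast
  have "norm (f \<phi> + g \<phi>) \<le> (C + C') * test_norm (max N N') \<phi>" if "\<phi> \<in> smooth_periodic" for \<phi>
    using C(2)[OF _ that, of "max N N'"] C'(2)[OF _ that, of "max N N'"]
      norm_triangle_ineq[of "f \<phi>" "g \<phi>"] by (simp add: algebra_simps)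
  thus ?thesis
    by (intro is_pdistI[where C = "C + C'" and N = "max N N'"])
       (simp_all add: is_pdistD[OF f] is_pdistD[OF g] algebra_simps)
qed

lemma is_pdist_scaleR:
  assumes f: "is_pdist f" shows "is_pdist (\<lambda>\<phi>. r *\<^sub>R f \<phi>)"
proof -
  obtain C N where C: "C \<ge> 0" "\<And>M \<phi>. M \<ge> N \<Longrightarrow> \<phi> \<in> smooth_periodic \<Longrightarrow> norm (f \<phi>) \<le> C * test_norm M \<phi>"
    using is_pdist_bound[OF f] by blast
  have "norm (r *\<^sub>R f \<phi>) \<le> (\<bar>r\<bar> * C) * test_norm N \<phi>" if "\<phi> \<in> smooth_periodic" for \<phi>
    using mult_left_mono[OF C(2)[OF order_refl that], of "\<bar>r\<bar>"] by (simp add: mult.assoc)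
  thus ?thesis
    by (intro is_pdistI[where C = "\<bar>r\<bar> * C" and N = N])
       (simp_all add: is_pdistD[OF f] scaleR_add_right)
qed

instantiation pdist :: real_vector
begin

lift_definition zero_pdist :: pdist is "\<lambda>_. 0"
  by (auto simp: is_pdist_def intro!: exI[of _ 0])

lift_definition plus_pdist :: "pdist \<Rightarrow> pdist \<Rightarrow> pdist" is "\<lambda>f g \<phi>. f \<phi> + g \<phi>"
  by (rule is_pdist_add)

lift_definition uminus_pdist :: "pdist \<Rightarrow> pdist" is "\<lambda>f \<phi>. - f \<phi>"
  using is_pdist_scaleR[of _ "-1"] by simp

lift_definition minus_pdist :: "pdist \<Rightarrow> pdist \<Rightarrow> pdist" is "\<lambda>f g \<phi>. f \<phi> - g \<phi>"
  using is_pdist_add[OF _ is_pdist_scaleR[of _ "-1"]] by simp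

lift_definition scaleR_pdist :: "real \<Rightarrow> pdist \<Rightarrow> pdist" is "\<lambda>r f \<phi>. r *\<^sub>R f \<phi>"
  by (rule is_pdist_scaleR)

instance
  by standard (transfer; simp add: fun_eq_iff algebra_simps)+

end

text \<open>The product of a smooth function with a distribution, and the constant functions.\<close>

lift_definition smult_pdist :: "(real \<Rightarrow> real) \<Rightarrow> pdist \<Rightarrow> pdist" is
  "\<lambda>g f \<phi>. if g \<in> smooth_periodic \<and> \<phi> \<in> smooth_periodic
            then f (\<lambda>x. complex_of_real (g x) * \<phi> x) else 0"
proof -
  fix g :: "real \<Rightarrow> real" and f :: "(real \<Rightarrow> complex) \<Rightarrow> complex"
  let ?F = "\<lambda>\<phi>. if g \<in> smooth_periodic \<and> \<phi> \<in> smooth_periodic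
            then f (\<lambda>x. complex_of_real (g x) * \<phi> x) else 0"
  assume f: "is_pdist f"
  show "is_pdist ?F"
  proof (cases "g \<in> smooth_periodic")
    case False
    thus ?thesis by (auto simp: is_pdist_def intro!: exI[of _ 0])
  next
    case True
    note g = smooth_periodic_of_real[OF True]
    note gm = smooth_periodic_mult[OF g]
    obtain C N where C: "C \<ge> 0" "\<And>M \<phi>. M \<ge> N \<Longrightarrow> \<phi> \<in> smooth_periodic \<Longrightarrow> norm (f \<phi>) \<le> C * test_norm M \<phi>"
      using is_pdist_bound[OF f] by blast
    obtain D where D: "\<And>\<phi>. \<phi> \<in> smooth_periodic \<Longrightarrow>
        test_norm N (\<lambda>x. complex_of_real (g x) * \<phi> x) \<le> D * test_norm N \<phi>"
      using test_norm_mult_le[OF g] by blast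
    have "norm (?F \<phi>) \<le> (C * D) * test_norm N \<phi>" if \<phi>: "\<phi> \<in> smooth_periodic" for \<phi>
      using order_trans[OF C(2)[OF order_refl gm[OF \<phi>]] mult_left_mono[OF D[OF \<phi>] C(1)]] True \<phi>
      by (simp add: mult.assoc)
    moreover have "?F (\<lambda>x. \<phi> x + \<psi> x) = ?F \<phi> + ?F \<psi>"
      if "\<phi> \<in> smooth_periodic" "\<psi> \<in> smooth_periodic" for \<phi> \<psi>
    proof -
      have "f (\<lambda>x. complex_of_real (g x) * \<phi> x + complex_of_real (g x) * \<psi> x)
          = f (\<lambda>x. complex_of_real (g x) * \<phi> x) + f (\<lambda>x. complex_of_real (g x) * \<psi> x)"
        by (rule is_pdistD(1)[OF f gm[OF that(1)] gm[OF that(2)]])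
      thus ?thesis using True that smooth_periodic_add[OF that] by (simp add: distrib_left)
    qed
    moreover have "?F (\<lambda>x. c * \<phi> x) = c * ?F \<phi>" if "\<phi> \<in> smooth_periodic" for \<phi> c
    proof -
      have "f (\<lambda>x. c * (complex_of_real (g x) * \<phi> x)) = c * f (\<lambda>x. complex_of_real (g x) * \<phi> x)"
        by (rule is_pdistD(2)[OF f gm[OF that]])
      thus ?thesis using True that smooth_periodic_scale[OF that, of c]
        by (simp add: mult.left_commute)
    qed
    ultimately show ?thesis by (intro is_pdistI[where C = "C * D" and N = N]) auto
  qed
qed

lift_definition const_pdist :: "complex \<Rightarrow> pdist" is
  "\<lambda>c \<phi>. if \<phi> \<in> smooth_periodic then c * integral {0..2 * pi} \<phi> else 0"
proof -
  fix c :: complex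
  let ?F = "\<lambda>\<phi>. if \<phi> \<in> smooth_periodic then c * integral {0..2 * pi} \<phi> else 0"
  have i: "\<phi> integrable_on {0..2 * pi}" if "\<phi> \<in> smooth_periodic" for \<phi> :: "real \<Rightarrow> complex"
    by (intro integrable_continuous_real continuous_at_imp_continuous_on ballI
        differentiable_imp_continuous_within smooth_periodic_differentiable that)
  have "norm (?F \<phi>) \<le> (norm c * (2 * pi)) * test_norm 0 \<phi>" if \<phi>: "\<phi> \<in> smooth_periodic" for \<phi>
  proof -
    have "norm (integral {0..2 * pi} \<phi>) \<le> test_norm 0 \<phi> * (2 * pi)"
      using has_integral_bound_real[OF test_norm_nonneg[OF \<phi>, of 0] finite.emptyI
          integrable_integral[OF i[OF \<phi>]]] norm_le_test_norm[OF \<phi>, of 0 0] by simp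
    hence "norm c * norm (integral {0..2 * pi} \<phi>) \<le> norm c * (test_norm 0 \<phi> * (2 * pi))"
      by (rule mult_left_mono) simp
    thus ?thesis using \<phi> by (simp add: norm_mult mult_ac)
  qed
  moreover have "?F (\<lambda>x. \<phi> x + \<psi> x) = ?F \<phi> + ?F \<psi>"
    if "\<phi> \<in> smooth_periodic" "\<psi> \<in> smooth_periodic" for \<phi> \<psi>
    using that smooth_periodic_add[OF that]
    by (simp add: Henstock_Kurzweil_Integration.integral_add i distrib_left)
  moreover have "?F (\<lambda>x. d * \<phi> x) = d * ?F \<phi>" if "\<phi> \<in> smooth_periodic" for \<phi> d
    using that smooth_periodic_scale[OF that, of d] by simp
  ultimately show "is_pdist ?F"
    by (intro is_pdistI[where C = "norm c * (2 * pi)" and N = 0]) auto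
qed

text \<open>
  Integrals of a distribution against a smooth function are duality pairings. In particular
  \<open>fourier f k\<close> is \<open>1/(2\<pi>) \<integral> f(x) e\<^sup>-\<^sup>i\<^sup>k\<^sup>x dx\<close> over a period.
\<close>

definition fourier :: "pdist \<Rightarrow> int \<Rightarrow> complex" where
  "fourier f k = pairing f (\<lambda>x. exp (- \<i> * of_int k * complex_of_real x)) / (2 * pi)"

definition mean_value :: "pdist \<Rightarrow> complex" where
  "mean_value f = pairing f (\<lambda>x. 1) / (2 * pi)"

definition Hs :: "real \<Rightarrow> pdist set" where
  "Hs s = {f. (\<lambda>k::int. (1 + (real_of_int \<bar>k\<bar>)\<^sup>2) powr s * (norm (fourier f k))\<^sup>2) summable_on UNIV}"

definition Hs_norm :: "real \<Rightarrow> pdist \<Rightarrow> real" where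
  "Hs_norm s f =
     sqrt (2 * pi * (\<Sum>\<^sub>\<infinity>k::int. (1 + (real_of_int \<bar>k\<bar>)\<^sup>2) powr s * (norm (fourier f k))\<^sup>2))"

text \<open>
  Since \<open>H\<^sup>s\<^sub>p\<close> is a subset of the type of distributions with a norm depending on \<open>s\<close>, the
  library's Bochner theory (which is tied to type classes) does not apply directly. Strong
  measurability and the Bochner integral are therefore spelled out for the norm \<open>Hs_norm s\<close>,
  following \<^const>\<open>has_bochner_integral\<close>.
\<close>

definition Hs_simple :: "real \<Rightarrow> 'a measure \<Rightarrow> ('a \<Rightarrow> pdist) \<Rightarrow> bool" where
  "Hs_simple s M F \<longleftrightarrow> Bochner_Integration.simple_bochner_integrable M F \<and> (\<forall>t\<in>space M. F t \<in> Hs s)"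

definition Hs_measurable :: "real \<Rightarrow> 'a measure \<Rightarrow> ('a \<Rightarrow> pdist) \<Rightarrow> bool" where
  "Hs_measurable s M F \<longleftrightarrow> (\<forall>t\<in>space M. F t \<in> Hs s) \<and>
     (\<exists>S. (\<forall>n. Hs_simple s M (S n)) \<and>
          (AE t in M. (\<lambda>n. Hs_norm s (F t - S n t)) \<longlonglongrightarrow> 0))"

definition has_Hs_integral :: "real \<Rightarrow> 'a measure \<Rightarrow> ('a \<Rightarrow> pdist) \<Rightarrow> pdist \<Rightarrow> bool" where
  "has_Hs_integral s M F I \<longleftrightarrow> Hs_measurable s M F \<and> I \<in> Hs s \<and>
     (\<exists>S. (\<forall>n. Hs_simple s M (S n)) \<and>
          (\<lambda>n. \<integral>\<^sup>+t. ennreal (Hs_norm s (F t - S n t)) \<partial>M) \<longlonglongrightarrow> 0 \<and>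
          (\<lambda>n. Hs_norm s (Bochner_Integration.simple_bochner_integral M (S n) - I)) \<longlonglongrightarrow> 0)"

definition L2_Hs :: "real \<Rightarrow> real \<Rightarrow> (real \<Rightarrow> pdist) set" where
  "L2_Hs s T = {h. Hs_measurable s (lebesgue_on {0..T}) h \<and>
                   integrable (lebesgue_on {0..T}) (\<lambda>t. (Hs_norm s (h t))\<^sup>2)}"

definition L2_Hs_norm :: "real \<Rightarrow> real \<Rightarrow> (real \<Rightarrow> pdist) \<Rightarrow> real" where
  "L2_Hs_norm s T h = sqrt (\<integral>t. (Hs_norm s (h t))\<^sup>2 \<partial>lebesgue_on {0..T})"

definition C_Hs :: "real \<Rightarrow> real \<Rightarrow> (real \<Rightarrow> pdist) set" where
  "C_Hs s T = {u. (\<forall>t\<in>{0..T}. u t \<in> Hs s) \<and>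
                  (\<forall>t\<in>{0..T}. ((\<lambda>r. Hs_norm s (u r - u t)) \<longlongrightarrow> 0) (at t within {0..T}))}"

text \<open>
  The group generated by \<open>\<alpha> H \<partial>\<^sub>x\<^sup>2 + \<partial>\<^sub>x\<^sup>3\<close>, \<open>H\<close> the periodic Hilbert transform. A periodic
  distribution is determined by its Fourier coefficients, and a Fourier multiplier of modulus
  one preserves their polynomial growth, so the description is proper.
\<close>

definition benjamin_group :: "real \<Rightarrow> real \<Rightarrow> pdist \<Rightarrow> pdist" where
  "benjamin_group \<alpha> t \<phi> = (THE v. \<forall>k. fourier v k =
     exp (\<i> * complex_of_real ((of_int k)\<^sup>2 * (\<alpha> * of_int (sgn k) - of_int k) * t)) * fourier \<phi> k)"

definition control_op :: "(real \<Rightarrow> real) \<Rightarrow> pdist \<Rightarrow> pdist" where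
  "control_op g h = smult_pdist g (h - const_pdist (pairing h (\<lambda>y. complex_of_real (g y))))"

definition mild_solution ::
    "real \<Rightarrow> real \<Rightarrow> real \<Rightarrow> (real \<Rightarrow> real) \<Rightarrow> pdist \<Rightarrow> (real \<Rightarrow> pdist) \<Rightarrow> (real \<Rightarrow> pdist) \<Rightarrow> bool" where
  "mild_solution s \<alpha> T g u\<^sub>0 h u \<longleftrightarrow> (\<forall>t\<in>{0..T}. \<exists>I.
     has_Hs_integral s (lebesgue_on {0..t}) (\<lambda>t'. benjamin_group \<alpha> (t - t') (control_op g (h t'))) I \<and>
     u t = benjamin_group \<alpha> t u\<^sub>0 + I)"

text \<open>
  Subsets of the torus are \<open>2\<pi>\<close>-periodic subsets of the line; an open interval of the torus is
  a proper open arc.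
\<close>

definition open_arc :: "real set \<Rightarrow> bool" where
  "open_arc W \<longleftrightarrow> (\<exists>a b. a < b \<and> b \<le> a + 2 * pi \<and>
     W = {x. \<exists>k::int. x + 2 * pi * of_int k \<in> {a<..<b}})"

end

theory Submission
  imports Defs
begin

text \<open>
  In Fourier coefficients the mode \<open>k\<close> rotates with the frequency \<open>\<lambda>\<^sub>k = \<alpha> k|k| - k\<^sup>3\<close>, and the control
  enters through the matrix of \<open>G\<close>, whose entries are \<open>\<gamma>(k - l) - \<gamma>(k) \<gamma>(-l)\<close> up to a factor
  \<open>2\<pi>\<close>, where \<open>\<gamma>(k) = \<integral> g e\<^sup>-\<^sup>i\<^sup>k\<^sup>x\<close>. The control is sought as \<open>h(t) = \<rho>(t) U(t) b\<close> with the profile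
  \<open>\<rho>(t) = sin\<^sup>2\<^sup>n(\<pi>t/T)\<close>. Reaching \<open>u\<^sub>1\<close> at time \<open>T\<close> is then a linear system for \<open>b\<close> whose matrix, the
  Gramian, has as entries those of \<open>G\<close> times the Fourier transform of \<open>\<rho>\<close> at \<open>\<lambda>\<^sub>l - \<lambda>\<^sub>k\<close>. The right-hand
  side has mean zero because \<open>u\<^sub>0\<close> and \<open>u\<^sub>1\<close> have the same mean, so it is enough that the Gramian is
  coercive on sequences of mean zero, with a constant independent of \<open>\<alpha>\<close> (\<open>gramian_coercive\<close>).

  The form of \<open>G\<close> is the variance \<open>\<integral> g |\<phi> - \<integral> g\<phi>|\<^sup>2\<close>. The diagonal of the Gramian is bounded below since
  \<open>|\<gamma>(k)|\<close> stays away from \<open>1\<close> for \<open>k \<noteq> 0\<close>. An entry off the diagonal is small if \<open>|k - l|\<close> is large,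
  because \<open>g\<close> is smooth, or if \<open>|\<lambda>\<^sub>k - \<lambda>\<^sub>l|\<close> is large, because the transform of the profile is of relative size
  \<open>3\<^sup>-\<^sup>n\<close> beyond frequencies of order \<open>n/T\<close>. The remaining entries are treated in two regimes.

  \<^item> For bounded \<open>\<alpha>\<close>, the modes above a cut-off \<open>N\<close> have frequencies at distance at least \<open>N\<^sup>2/2\<close> from all
    others, so that \<open>n\<close> can be taken almost of order \<open>N\<^sup>2\<close> and all coupling to them is of size \<open>3\<^sup>-\<^sup>n\<close>. On the modes
    below \<open>N\<close> the form of \<open>G\<close> is bounded below by \<open>N\<^sup>-\<^sup>C\<^sup>N\<close> (\<open>control_form_ge\<close>): a trigonometric
    polynomial of degree \<open>N\<close> cannot be smaller than that on an interval where \<open>g > 0\<close>. For large \<open>N\<close> this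
    beats the coupling.

  \<^item> For large \<open>\<alpha>\<close>, frequencies of nearby modes almost coincide only near the critical points
    \<open>k = \<plusminus>2\<alpha>/3\<close> of the dispersion relation, and there in pairs (\<open>resonant_unique\<close>). The Gramian is
    diagonally dominant, since a pair of modes of high frequency contributes at most
    about \<open>max |\<gamma>(d)| < 1\<close>, the maximum over \<open>d \<noteq> 0\<close>, to a row with diagonal close to \<open>1\<close>.

  The passage to \<open>H\<^sup>s\<close> conjugates the Gramian with the weight \<open>(1 + \<epsilon>|k|)\<^sup>s\<close>. As the entries decay
  off the diagonal, this is a small perturbation for small \<open>\<epsilon>\<close>, and the Lax-Milgram theorem applies
  (\<open>gramian_solvable\<close>). The isometry \<open>of_ell2\<close> between square-summable sequences and \<open>H\<^sup>s\<close> carries the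
  mild formulation over to integrals of continuous functions with values in a separable Hilbert space.
\<close>

section \<open>Fourier series of smooth periodic functions\<close>

definition wave :: "int \<Rightarrow> real \<Rightarrow> complex" where
  "wave k x = cis (of_int k * x)"

definition fourier_fun :: "(real \<Rightarrow> complex) \<Rightarrow> int \<Rightarrow> complex" where
  "fourier_fun \<phi> k = integral {0..2 * pi} (\<lambda>x. wave (- k) x * \<phi> x) / (2 * pi)"

lemma wave_zero [simp]: "wave 0 x = 1" "wave k 0 = 1"
  by (simp_all add: wave_def)

lemma norm_wave [simp]: "norm (wave k x) = 1"
  by (simp add: wave_def)

lemma wave_mult: "wave k x * wave l x = wave (k + l) x"
  by (simp add: wave_def cis_mult distrib_right)

lemma wave_minus_mult [simp]: "wave (- k) x * wave k x = 1" "wave k x * wave (- k) x = 1"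
  by (simp_all add: wave_mult)

lemma cnj_wave: "cnj (wave k x) = wave (- k) x"
  by (simp add: wave_def cis_cnj)

lemma wave_shift: "wave k (x + y) = wave k x * wave k y"
  by (simp add: wave_def cis_mult distrib_left)

lemma wave_2pi [simp]: "wave k (2 * pi) = 1"
  using cis_multiple_2pi[of "of_int k"] by (simp add: wave_def mult.commute)

lemma wave_periodic: "wave k (x + 2 * pi) = wave k x"
  by (simp add: wave_shift)

lemma has_vector_derivative_wave:
  "(wave k has_vector_derivative (\<i> * of_int k * wave k x)) (at x within S)"
proof -
  have "((\<lambda>z. exp (\<i> * of_int k * z)) has_field_derivative
      \<i> * of_int k * exp (\<i> * of_int k * complex_of_real x)) (at (complex_of_real x))"
    by (auto intro!: derivative_eq_intros)
  from has_vector_derivative_real_field[OF this]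
  have "((\<lambda>x. exp (\<i> * of_int k * complex_of_real x)) has_vector_derivative
      \<i> * of_int k * exp (\<i> * of_int k * complex_of_real x)) (at x within S)" .
  moreover have "(\<lambda>x. exp (\<i> * of_int k * complex_of_real x)) = wave k"
    by (simp add: fun_eq_iff wave_def cis_conv_exp mult_ac)
  ultimately show ?thesis by (metis (no_types))
qed

lemma continuous_on_wave [continuous_intros]: "continuous_on S (wave k)"
  by (meson continuous_on_eq_continuous_within has_vector_derivative_continuous
      has_vector_derivative_wave)

lemma vderiv_wave: "vderiv (\<lambda>x. c * wave k x) = (\<lambda>x. (c * (\<i> * of_int k)) * wave k x)"
  unfolding vderiv_def
  by (intro ext vector_derivative_at)
     (auto intro!: derivative_eq_intros has_vector_derivative_wave simp: mult_ac)

lemma funpow_vderiv_wave: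
  "(vderiv ^^ n) (wave k) = (\<lambda>x. (\<i> * of_int k) ^ n * wave k x)"
proof (induction n)
  case (Suc n)
  thus ?case by (simp add: vderiv_wave) (simp add: mult_ac)
qed simp

lemma smooth_periodic_wave: "wave k \<in> smooth_periodic"
proof -
  have "(\<lambda>x. (\<i> * of_int k) ^ n * wave k x) differentiable (at x)" for n x
    by (rule differentiableI_vector[OF has_vector_derivative_mult_right[OF has_vector_derivative_wave]])
  thus ?thesis by (auto simp: smooth_periodic_def funpow_vderiv_wave wave_periodic)
qed

lemma smooth_periodic_continuous_on:
  "\<phi> \<in> smooth_periodic \<Longrightarrow> continuous_on S \<phi>"
  by (intro continuous_at_imp_continuous_on ballI differentiable_imp_continuous_within
        smooth_periodic_differentiable)

lemma smooth_periodic_sum: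
  fixes f :: "'i \<Rightarrow> real \<Rightarrow> complex"
  assumes "\<And>i. i \<in> I \<Longrightarrow> f i \<in> smooth_periodic"
  shows "(\<lambda>x. \<Sum>i\<in>I. f i x) \<in> smooth_periodic"
  using assms
proof (induction I rule: infinite_finite_induct)
  case (insert i I)
  thus ?case using smooth_periodic_add[of "f i" "\<lambda>x. \<Sum>i\<in>I. f i x"] by simp
qed (use smooth_periodic_scale[OF smooth_periodic_wave[of 0], of 0] in auto)

lemma funpow_vderiv_sum:
  fixes f :: "'i \<Rightarrow> real \<Rightarrow> complex"
  assumes "\<And>i. i \<in> I \<Longrightarrow> f i \<in> smooth_periodic"
  shows "(vderiv ^^ n) (\<lambda>x. \<Sum>i\<in>I. f i x) = (\<lambda>x. \<Sum>i\<in>I. (vderiv ^^ n) (f i) x)"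
  using assms
proof (induction I rule: infinite_finite_induct)
  case (insert i I)
  thus ?case using funpow_vderiv_add[of "f i" "\<lambda>x. \<Sum>i\<in>I. f i x" n]
    by (simp add: smooth_periodic_sum)
next
  case (infinite A)
  have "(vderiv ^^ n) (\<lambda>x::real. 0::complex) = (\<lambda>x. 0)"
    by (induction n) (simp_all add: vderiv_def)
  thus ?case using infinite by simp
next
  case empty
  have "(vderiv ^^ n) (\<lambda>x::real. 0::complex) = (\<lambda>x. 0)"
    by (induction n) (simp_all add: vderiv_def)
  thus ?case by simp
qed

lemma integral_wave: "integral {0..2 * pi} (wave k) = (if k = 0 then 2 * pi else 0)"
proof (cases "k = 0")
  case True
  have "wave 0 = (\<lambda>_. 1)" by (simp add: fun_eq_iff)
  thus ?thesis using True by (simp add: scaleR_conv_of_real)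
next
  case False
  have "((\<lambda>x. \<i> * of_int k * wave k x) has_integral (wave k (2 * pi) - wave k 0)) {0..2 * pi}"
    by (rule fundamental_theorem_of_calculus) (auto intro: has_vector_derivative_wave)
  hence "integral {0..2 * pi} (\<lambda>x. \<i> * of_int k * wave k x) = 0"
    by (simp add: has_integral_iff)
  thus ?thesis using False by simp
qed

lemma fourier_fun_wave: "fourier_fun (wave l) k = (if k = l then 1 else 0)"
  using integral_wave[of "l - k"] by (simp add: fourier_fun_def wave_mult)

lemma integrable_wave_mult:
  "continuous_on {0..2 * pi} \<phi> \<Longrightarrow> (\<lambda>x. wave k x * \<phi> x) integrable_on {0..2 * pi}"
  by (intro integrable_continuous_real continuous_intros)

lemma fourier_fun_add:
  assumes "continuous_on {0..2 * pi} \<phi>" "continuous_on {0..2 * pi} \<psi>"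
  shows "fourier_fun (\<lambda>x. \<phi> x + \<psi> x) k = fourier_fun \<phi> k + fourier_fun \<psi> k"
  using assms
  by (simp add: fourier_fun_def distrib_left add_divide_distrib integrable_wave_mult
      Henstock_Kurzweil_Integration.integral_add)

lemma fourier_fun_scale: "fourier_fun (\<lambda>x. c * \<phi> x) k = c * fourier_fun \<phi> k"
  by (simp add: fourier_fun_def mult.left_commute[of _ c])

lemma fourier_fun_wave_mult: "fourier_fun (\<lambda>x. wave l x * \<phi> x) k = fourier_fun \<phi> (k - l)"
  by (simp add: fourier_fun_def mult.assoc[symmetric] wave_mult)

lemma fourier_fun_vderiv:
  assumes "\<phi> \<in> smooth_periodic"
  shows "fourier_fun (vderiv \<phi>) k = \<i> * of_int k * fourier_fun \<phi> k"
proof -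
  have p: "\<phi> (2 * pi) = \<phi> 0"
    using assms by (auto simp: smooth_periodic_def dest: spec[of _ 0])
  have "((\<lambda>x. wave (- k) x * vderiv \<phi> x + (\<i> * of_int (- k) * wave (- k) x) * \<phi> x) has_integral
      (wave (- k) (2 * pi) * \<phi> (2 * pi) - wave (- k) 0 * \<phi> 0)) {0..2 * pi}"
    by (intro fundamental_theorem_of_calculus has_vector_derivative_mult has_vector_derivative_wave
        has_vector_derivative_at_within[OF smooth_periodic_has_vderiv[OF assms]]) simp
  hence "integral {0..2 * pi} (\<lambda>x. wave (- k) x * vderiv \<phi> x +
      (- (\<i> * of_int k)) * (wave (- k) x * \<phi> x)) = 0"
    by (simp add: has_integral_iff p mult.assoc)
  moreover have "(\<lambda>x. wave (- k) x * vderiv \<phi> x) integrable_on {0..2 * pi}"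
    "(\<lambda>x. wave (- k) x * \<phi> x) integrable_on {0..2 * pi}"
    by (intro integrable_wave_mult smooth_periodic_continuous_on smooth_periodic_vderiv assms)+
  ultimately have "integral {0..2 * pi} (\<lambda>x. wave (- k) x * vderiv \<phi> x) =
      \<i> * of_int k * integral {0..2 * pi} (\<lambda>x. wave (- k) x * \<phi> x)"
    by (subst (asm) Henstock_Kurzweil_Integration.integral_add)
       (auto intro!: integrable_neg integrable_on_mult_right)
  thus ?thesis by (simp add: fourier_fun_def)
qed

lemma fourier_fun_funpow_vderiv:
  assumes "\<phi> \<in> smooth_periodic"
  shows "fourier_fun ((vderiv ^^ n) \<phi>) k = (\<i> * of_int k) ^ n * fourier_fun \<phi> k"
  by (induction n)
     (simp_all add: fourier_fun_vderiv[OF smooth_periodic_funpow[OF assms]])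

lemma norm_fourier_fun_le:
  assumes "continuous_on {0..2 * pi} \<phi>" "\<And>x. x \<in> {0..2 * pi} \<Longrightarrow> norm (\<phi> x) \<le> B"
  shows "norm (fourier_fun \<phi> k) \<le> B"
proof -
  have "norm (integral {0..2 * pi} (\<lambda>x. wave (- k) x * \<phi> x)) \<le> B * (2 * pi - 0)"
    by (rule integral_bound) (use assms in \<open>auto intro!: continuous_intros simp: norm_mult\<close>)
  thus ?thesis by (simp add: fourier_fun_def norm_divide field_simps)
qed

lemma fourier_fun_decay:
  assumes "\<phi> \<in> smooth_periodic"
  shows "\<bar>of_int k\<bar> ^ n * norm (fourier_fun \<phi> k) \<le> test_norm n \<phi>"
proof -
  have "norm (fourier_fun ((vderiv ^^ n) \<phi>) k) \<le> test_norm n \<phi>"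
    by (intro norm_fourier_fun_le smooth_periodic_continuous_on smooth_periodic_funpow
        norm_le_test_norm assms) simp
  thus ?thesis by (simp add: fourier_fun_funpow_vderiv[OF assms] norm_mult norm_power)
qed

lemma bessel_inequality:
  assumes "continuous_on {0..2 * pi} \<psi>" "finite K"
  shows "(\<Sum>k\<in>K. (norm (fourier_fun \<psi> k))\<^sup>2) \<le> integral {0..2 * pi} (\<lambda>x. (norm (\<psi> x))\<^sup>2) / (2 * pi)"
proof -
  define c where "c = fourier_fun \<psi>"
  define S where "S = (\<lambda>x. \<Sum>k\<in>K. c k * wave k x)"
  have cS: "continuous_on {0..2 * pi} S" unfolding S_def by (intro continuous_intros)
  have e: "complex_of_real ((norm (\<psi> x - S x))\<^sup>2) =
      complex_of_real ((norm (\<psi> x))\<^sup>2) - (\<Sum>k\<in>K. cnj (c k) * (wave (- k) x * \<psi> x))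
      - cnj (\<Sum>k\<in>K. cnj (c k) * (wave (- k) x * \<psi> x))
      + (\<Sum>k\<in>K. \<Sum>l\<in>K. c k * cnj (c l) * wave (k - l) x)" for x
    unfolding complex_norm_square S_def
    by (simp add: algebra_simps cnj_wave sum_distrib_left sum_distrib_right sum_product wave_mult)
       (rule sum.swap)
  define I where "I = integral {0..2 * pi} (\<lambda>x. (norm (\<psi> x))\<^sup>2)"
  have i0: "((\<lambda>x. complex_of_real ((norm (\<psi> x))\<^sup>2)) has_integral complex_of_real I) {0..2 * pi}"
    unfolding I_def
    by (intro has_integral_of_real integrable_integral integrable_continuous_real continuous_intros assms)
  have w: "((\<lambda>x. wave (- k) x * \<psi> x) has_integral (2 * pi * c k)) {0..2 * pi}" for k
    using integrable_integral[OF integrable_wave_mult[OF assms(1), of "- k"]]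
    by (simp add: c_def fourier_fun_def)
  have i1: "((\<lambda>x. \<Sum>k\<in>K. cnj (c k) * (wave (- k) x * \<psi> x)) has_integral
      (\<Sum>k\<in>K. cnj (c k) * (2 * pi * c k))) {0..2 * pi}"
    by (intro has_integral_sum assms has_integral_mult_right w)
  have i2: "((\<lambda>x. cnj (\<Sum>k\<in>K. cnj (c k) * (wave (- k) x * \<psi> x))) has_integral
      cnj (\<Sum>k\<in>K. cnj (c k) * (2 * pi * c k))) {0..2 * pi}"
    using has_integral_linear[OF i1 bounded_linear_cnj] by (simp add: o_def)
  have "((\<lambda>x. c k * cnj (c l) * wave (k - l) x) has_integral
      c k * cnj (c l) * (if k = l then 2 * pi else 0)) {0..2 * pi}" for k l
    using integrable_integral[OF integrable_continuous_real[OF continuous_on_wave[of "{0..2*pi}" "k - l"]]]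
    by (intro has_integral_mult_right) (simp only: integral_wave right_minus_eq)
  hence i3: "((\<lambda>x. \<Sum>k\<in>K. \<Sum>l\<in>K. c k * cnj (c l) * wave (k - l) x) has_integral
      (\<Sum>k\<in>K. \<Sum>l\<in>K. c k * cnj (c l) * (if k = l then 2 * pi else 0))) {0..2 * pi}"
    by (intro has_integral_sum assms)
  have A: "((\<lambda>x. complex_of_real ((norm (\<psi> x - S x))\<^sup>2)) has_integral
      (complex_of_real I - (\<Sum>k\<in>K. cnj (c k) * (2 * pi * c k))
      - cnj (\<Sum>k\<in>K. cnj (c k) * (2 * pi * c k)) +
      (\<Sum>k\<in>K. \<Sum>l\<in>K. c k * cnj (c l) * (if k = l then 2 * pi else 0)))) {0..2 * pi}"
    unfolding e by (intro has_integral_add has_integral_diff i0 i1 i2 i3)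
  have B: "(complex_of_real I - (\<Sum>k\<in>K. cnj (c k) * (2 * pi * c k))
      - cnj (\<Sum>k\<in>K. cnj (c k) * (2 * pi * c k)) +
      (\<Sum>k\<in>K. \<Sum>l\<in>K. c k * cnj (c l) * (if k = l then 2 * pi else 0))) =
      complex_of_real (I - 2 * pi * (\<Sum>k\<in>K. (norm (c k))\<^sup>2))"
  proof -
    have nsq: "(complex_of_real (norm z))\<^sup>2 = z * cnj z" for z
      by (simp flip: complex_norm_square)
    have "(\<Sum>l\<in>K. c k * cnj (c l) * (if k = l then 2 * pi else 0)) = 2 * pi * (c k * cnj (c k))"
      if "k \<in> K" for k
      using that assms(2) by (simp add: if_distrib sum.delta cong: if_cong)
    hence "(\<Sum>k\<in>K. \<Sum>l\<in>K. c k * cnj (c l) * (if k = l then 2 * pi else 0)) =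
        2 * pi * (\<Sum>k\<in>K. c k * cnj (c k))"
      by (simp add: sum_distrib_left)
    moreover have "(\<Sum>k\<in>K. cnj (c k) * (2 * pi * c k)) = 2 * pi * (\<Sum>k\<in>K. c k * cnj (c k))"
      "cnj (\<Sum>k\<in>K. cnj (c k) * (2 * pi * c k)) = 2 * pi * (\<Sum>k\<in>K. c k * cnj (c k))"
      by (simp_all add: sum_distrib_left mult_ac)
    ultimately show ?thesis by (simp add: nsq)
  qed
  have C: "((\<lambda>x. complex_of_real ((norm (\<psi> x - S x))\<^sup>2)) has_integral
     complex_of_real (integral {0..2 * pi} (\<lambda>x. (norm (\<psi> x - S x))\<^sup>2))) {0..2 * pi}"
    by (intro has_integral_of_real integrable_integral integrable_continuous_real continuous_intros assms cS)
  have "complex_of_real (I - 2 * pi * (\<Sum>k\<in>K. (norm (c k))\<^sup>2)) =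
      complex_of_real (integral {0..2 * pi} (\<lambda>x. (norm (\<psi> x - S x))\<^sup>2))"
    by (rule has_integral_unique[OF A[unfolded B] C])
  hence "I - 2 * pi * (\<Sum>k\<in>K. (norm (c k))\<^sup>2) = integral {0..2 * pi} (\<lambda>x. (norm (\<psi> x - S x))\<^sup>2)"
    by (simp only: of_real_eq_iff)
  also have "\<dots> \<ge> 0"
    by (intro Henstock_Kurzweil_Integration.integral_nonneg integrable_continuous_real
        continuous_intros assms cS) simp
  finally show ?thesis by (simp add: I_def c_def field_simps)
qed

lemma riemann_lebesgue:
  assumes "continuous_on {0..2 * pi} \<psi>" and h: "inj (h :: nat \<Rightarrow> int)"
  shows "(\<lambda>n. fourier_fun \<psi> (h n)) \<longlonglongrightarrow> 0"
proof -
  have "(\<lambda>k. (norm (fourier_fun \<psi> k))\<^sup>2) summable_on UNIV"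
    by (rule nonneg_bdd_above_summable_on)
       (auto intro!: bdd_aboveI2[where M = "integral {0..2 * pi} (\<lambda>x. (norm (\<psi> x))\<^sup>2) / (2 * pi)"]
         bessel_inequality[OF assms(1)])
  hence "(\<lambda>k. (norm (fourier_fun \<psi> k))\<^sup>2) summable_on range h"
    by (rule summable_on_subset) auto
  hence "(\<lambda>n. (norm (fourier_fun \<psi> (h n)))\<^sup>2) summable_on UNIV"
    by (subst (asm) summable_on_reindex[OF h]) (simp add: o_def)
  hence "(\<lambda>n. (norm (fourier_fun \<psi> (h n)))\<^sup>2) \<longlonglongrightarrow> 0"
    by (intro summable_LIMSEQ_zero summable_on_imp_summable)
  hence "(\<lambda>n. sqrt ((norm (fourier_fun \<psi> (h n)))\<^sup>2)) \<longlonglongrightarrow> sqrt 0"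
    by (rule tendsto_real_sqrt)
  thus ?thesis by (simp add: tendsto_norm_zero_iff)
qed


lemma smooth_periodic_period_int:
  assumes "\<phi> \<in> smooth_periodic"
  shows "\<phi> (x + of_int m * (2 * pi)) = \<phi> x"
proof -
  have p: "\<phi> (y + 2 * pi) = \<phi> y" for y using assms by (auto simp: smooth_periodic_def)
  show ?thesis
  proof (induction m rule: int_induct[of _ 0])
    case (step1 i)
    thus ?case using p[of "x + of_int i * (2 * pi)"] by (simp add: algebra_simps)
  next
    case (step2 i)
    thus ?case using p[of "x + of_int (i - 1) * (2 * pi)"] by (simp add: algebra_simps)
  qed simp
qed

lemma wave_eq_1D:
  assumes "wave 1 x = 1" obtains m where "x = of_int m * (2 * pi)"
proof -
  have "cos x = 1" using assms by (simp add: wave_def complex_eq_iff)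
  thus thesis using that by (auto simp: cos_one_2pi_int mult.assoc)
qed

lemma has_vector_derivative_quotient:
  fixes f :: "real \<Rightarrow> complex"
  assumes "(f has_vector_derivative d) (at x)"
  shows "((\<lambda>y. (f y - f x) / of_real (y - x)) \<longlongrightarrow> d) (at x)"
proof -
  have "((\<lambda>y. norm (f y - f x - (y - x) *\<^sub>R d) / norm (y - x)) \<longlongrightarrow> 0) (at x)"
    using assms by (simp add: has_vector_derivative_def has_derivative_iff_norm)
  moreover have "\<forall>\<^sub>F y in at x. norm (f y - f x - (y - x) *\<^sub>R d) / norm (y - x) =
      norm ((f y - f x) / of_real (y - x) - d)"
    unfolding eventually_at_filter
  proof (intro always_eventually allI impI)
    fix y assume "y \<noteq> x"
    hence "(f y - f x) / of_real (y - x) - d = (f y - f x - (y - x) *\<^sub>R d) / of_real (y - x)"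
      by (simp add: diff_divide_distrib scaleR_conv_of_real)
    thus "norm (f y - f x - (y - x) *\<^sub>R d) / norm (y - x) = norm ((f y - f x) / of_real (y - x) - d)"
      by (simp add: norm_divide del: of_real_diff)
  qed
  ultimately have "((\<lambda>y. norm ((f y - f x) / of_real (y - x) - d)) \<longlongrightarrow> 0) (at x)"
    by (rule Lim_transform_eventually)
  thus ?thesis by (simp only: tendsto_norm_zero_iff LIM_zero_iff)
qed

lemma sum_int_telescope:
  fixes b :: "int \<Rightarrow> 'a::ab_group_add"
  shows "(\<Sum>k\<in>{- int n..int n}. b (k - 1) - b k) = b (- int n - 1) - b (int n)"
proof (induction n)
  case (Suc n)
  have "{- int (Suc n)..int (Suc n)} = insert (- int n - 1) (insert (int n + 1) {- int n..int n})"
    by auto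
  hence "(\<Sum>k\<in>{- int (Suc n)..int (Suc n)}. b (k - 1) - b k) = (b (- int n - 1 - 1) - b (- int n - 1)) +
     ((b (int n + 1 - 1) - b (int n + 1)) + (\<Sum>k\<in>{- int n..int n}. b (k - 1) - b k))"
    by (simp only:) (subst sum.insert, simp, simp, subst sum.insert, simp_all)
  moreover have "- int (Suc n) - 1 = - int n - 1 - 1" "int (Suc n) = int n + 1" by simp_all
  ultimately show ?case unfolding Suc by (simp only:) simp
qed simp

text \<open>
  Chernoff's argument. The quotient \<open>\<psi>(y) = (\<phi>(y) - \<phi>(x)) / (e\<^sup>i\<^sup>(\<^sup>y\<^sup>-\<^sup>x\<^sup>) - 1)\<close> is continuous, because the
  zeros of its denominator are simple. The coefficients of \<open>\<phi> - \<phi>(x)\<close> are then differences of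
  consecutive coefficients of \<open>\<psi>\<close>, so the partial sum telescopes and its error consists of two
  coefficients of \<open>\<psi>\<close>, which vanish in the limit by the Riemann-Lebesgue lemma.
\<close>

lemma fourier_series_pointwise:
  assumes \<phi>: "\<phi> \<in> smooth_periodic"
  shows "(\<lambda>n. \<Sum>k\<in>{- int n..int n}. fourier_fun \<phi> k * wave k x) \<longlonglongrightarrow> \<phi> x"
proof -
  define \<psi> where "\<psi> = (\<lambda>y. if wave 1 (y - x) = 1 then vderiv \<phi> y / \<i>
                         else (\<phi> y - \<phi> x) / (wave 1 (y - x) - 1))"
  have eq: "\<phi> y - \<phi> x = \<psi> y * (wave 1 (y - x) - 1)" for y
  proof (cases "wave 1 (y - x) = 1")
    case True
    then obtain m where "y - x = of_int m * (2 * pi)" by (rule wave_eq_1D)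
    hence "y = x + of_int m * (2 * pi)" by simp
    thus ?thesis using True smooth_periodic_period_int[OF \<phi>] by simp
  qed (simp add: \<psi>_def)
  have dw: "((\<lambda>y. wave 1 (y - x)) has_vector_derivative \<i> * wave 1 (y - x)) (at y)" for y
  proof -
    have "((\<lambda>y. y - x) has_vector_derivative 1) (at y)"
      by (auto intro!: derivative_eq_intros)
    from vector_diff_chain_at[OF this] show ?thesis
      using has_vector_derivative_wave[of 1 "y - x" UNIV] by (simp add: o_def)
  qed
  have cw: "isCont (\<lambda>y. wave 1 (y - x)) y" for y
    using dw has_vector_derivative_continuous by blast
  have c\<phi>: "isCont \<phi> y" for y
    using smooth_periodic_differentiable[OF \<phi>] by (rule differentiable_imp_continuous_within)
  have "isCont \<psi> y" for y
  proof (cases "wave 1 (y - x) = 1")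
    case True
    have y: "\<phi> y = \<phi> x" using eq[of y] True by simp
    have l1: "((\<lambda>z. (wave 1 (z - x) - 1) / of_real (z - y)) \<longlongrightarrow> \<i>) (at y)"
      using has_vector_derivative_quotient[OF dw[of y]] True by simp
    have l2: "((\<lambda>z. (\<phi> z - \<phi> x) / of_real (z - y)) \<longlongrightarrow> vderiv \<phi> y) (at y)"
      using has_vector_derivative_quotient[OF smooth_periodic_has_vderiv[OF \<phi>], of y] y by simp
    have "((\<lambda>z. ((\<phi> z - \<phi> x) / of_real (z - y)) / ((wave 1 (z - x) - 1) / of_real (z - y)))
        \<longlongrightarrow> vderiv \<phi> y / \<i>) (at y)"
      by (intro tendsto_divide l1 l2) simp
    moreover have "\<forall>\<^sub>F z in at y. (wave 1 (z - x) - 1) / of_real (z - y) \<noteq> 0"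
      by (rule tendsto_imp_eventually_ne[OF l1]) simp
    hence "\<forall>\<^sub>F z in at y. ((\<phi> z - \<phi> x) / of_real (z - y)) / ((wave 1 (z - x) - 1) / of_real (z - y)) = \<psi> z"
      by eventually_elim (auto simp: \<psi>_def)
    ultimately have "(\<psi> \<longlongrightarrow> vderiv \<phi> y / \<i>) (at y)"
      by (rule Lim_transform_eventually)
    thus ?thesis using True by (simp add: isCont_def \<psi>_def)
  next
    case False
    have "isCont (\<lambda>z. (\<phi> z - \<phi> x) / (wave 1 (z - x) - 1)) y"
      using False by (intro continuous_intros c\<phi> cw) simp
    moreover have "\<forall>\<^sub>F z in at y. wave 1 (z - x) \<noteq> 1"
      by (rule tendsto_imp_eventually_ne[OF _ False]) (use cw in \<open>simp add: isCont_def\<close>)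
    hence "\<forall>\<^sub>F z in at y. (\<phi> z - \<phi> x) / (wave 1 (z - x) - 1) = \<psi> z"
      by eventually_elim (simp add: \<psi>_def)
    ultimately show ?thesis
      using False unfolding isCont_def by (simp add: \<psi>_def Lim_transform_eventually)
  qed
  hence c\<psi>: "continuous_on {0..2 * pi} \<psi>" by (simp add: continuous_at_imp_continuous_on)
  define b where "b = (\<lambda>k. wave k x * fourier_fun \<psi> k)"
  have b: "fourier_fun \<phi> k * wave k x = (if k = 0 then \<phi> x else 0) + (b (k - 1) - b k)" for k
  proof -
    have "\<phi> = (\<lambda>y. \<phi> x * wave 0 y + (wave (-1) x * (wave 1 y * \<psi> y) + (-1) * \<psi> y))"
    proof
      fix y
      have "wave 1 (y - x) = wave 1 y * wave (-1) x" by (simp add: wave_def cis_mult)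
      hence "\<phi> y = \<phi> x + \<psi> y * (wave 1 y * wave (-1) x - 1)"
        using eq[of y] by (simp only: diff_eq_eq) (simp only: add.commute)
      thus "\<phi> y = \<phi> x * wave 0 y + (wave (-1) x * (wave 1 y * \<psi> y) + (-1) * \<psi> y)"
        by (simp add: algebra_simps)
    qed
    hence "fourier_fun \<phi> k = fourier_fun (\<lambda>y. \<phi> x * wave 0 y + (wave (-1) x * (wave 1 y * \<psi> y) + (-1) * \<psi> y)) k"
      by (rule arg_cong)
    also have "\<dots> = \<phi> x * (if k = 0 then 1 else 0) + (wave (-1) x * fourier_fun \<psi> (k - 1) - fourier_fun \<psi> k)"
      by (subst fourier_fun_add, (intro continuous_intros c\<psi>)+)+
         (simp only: fourier_fun_scale fourier_fun_wave fourier_fun_wave_mult, simp)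
    finally have e: "fourier_fun \<phi> k = \<phi> x * (if k = 0 then 1 else 0) +
        (wave (-1) x * fourier_fun \<psi> (k - 1) - fourier_fun \<psi> k)" .
    have "fourier_fun \<phi> k * wave k x = \<phi> x * (if k = 0 then 1 else 0) * wave k x +
        ((wave k x * wave (-1) x) * fourier_fun \<psi> (k - 1) - wave k x * fourier_fun \<psi> k)"
      unfolding e by (simp add: distrib_left distrib_right right_diff_distrib left_diff_distrib mult_ac)
    also have "wave k x * wave (-1) x = wave (k - 1) x" by (simp add: wave_mult)
    finally show ?thesis by (simp add: b_def)
  qed
  have s: "(\<Sum>k\<in>{- int n..int n}. fourier_fun \<phi> k * wave k x) = \<phi> x + (b (- int n - 1) - b (int n))" for n
    by (simp add: b sum.distrib sum_int_telescope)
  have "(\<lambda>n. b (h n)) \<longlonglongrightarrow> 0" if "inj h" for h :: "nat \<Rightarrow> int"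
    using tendsto_norm_zero[OF riemann_lebesgue[OF c\<psi> that]]
    by (subst tendsto_norm_zero_iff[symmetric]) (simp add: b_def norm_mult)
  from this[of "\<lambda>n. - int n - 1"] this[of int]
  have "(\<lambda>n. \<phi> x + (b (- int n - 1) - b (int n))) \<longlonglongrightarrow> \<phi> x + (0 - 0)"
    by (intro tendsto_intros) (auto simp: inj_on_def)
  thus ?thesis by (simp add: s)
qed

section \<open>Polynomial weights on the integers\<close>

definition weight :: "int \<Rightarrow> real" where
  "weight k = 1 + \<bar>of_int k\<bar>"

lemma weight_ge_1 [simp]: "1 \<le> weight k" and weight_pos [simp]: "0 < weight k"
  and weight_nonneg [simp]: "0 \<le> weight k"
  by (simp_all add: weight_def add_pos_nonneg)

lemma weight_minus [simp]: "weight (- k) = weight k"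
  by (simp add: weight_def)

lemma weight_add_le: "weight (k + l) \<le> weight k * weight l"
proof -
  have "\<bar>real_of_int (k + l)\<bar> \<le> \<bar>of_int k\<bar> + \<bar>of_int l\<bar>" by simp
  moreover have "0 \<le> \<bar>real_of_int k\<bar> * \<bar>of_int l\<bar>" by simp
  ultimately show ?thesis unfolding weight_def distrib_left distrib_right by linarith
qed

lemma summable_inverse_weight:
  assumes "2 \<le> p"
  shows "(\<lambda>k. inverse (weight k ^ p)) summable_on UNIV"
proof -
  have "summable (\<lambda>n. inverse (real (Suc n) ^ p))"
    using inverse_power_summable[OF assms, where 'a = real] by (subst summable_Suc_iff) simp
  hence s: "(\<lambda>n. inverse ((1 + real n) ^ p)) summable_on UNIV"
    by (intro summable_nonneg_imp_summable_on) (auto simp: add.commute)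
  have "(\<lambda>k. inverse (weight k ^ p)) summable_on range h"
    if "inj h" "\<And>n. weight (h n) = 1 + real n" for h :: "nat \<Rightarrow> int"
    using s that by (subst summable_on_reindex) (auto simp: o_def)
  from this[of int] this[of "\<lambda>n. - int n"]
  have "(\<lambda>k. inverse (weight k ^ p)) summable_on (range int \<union> range (\<lambda>n. - int n))"
    by (intro summable_on_union) (auto simp: inj_on_def weight_def)
  moreover have "range int \<union> range (\<lambda>n. - int n) = UNIV"
    by (auto simp: image_iff intro: int_cases2)
  ultimately show ?thesis by simp
qed

lemma has_sum_int_symmetric:
  fixes f :: "int \<Rightarrow> 'a::{topological_comm_monoid_add}"
  assumes "(f has_sum S) UNIV"
  shows "(\<lambda>n. sum f {- int n..int n}) \<longlonglongrightarrow> S"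
proof -
  have "filterlim (\<lambda>n. {- int n..int n}) (finite_subsets_at_top UNIV) sequentially"
    unfolding filterlim_finite_subsets_at_top
  proof (intro allI impI)
    fix X :: "int set" assume "finite X \<and> X \<subseteq> UNIV"
    then obtain m where m: "abs ` X \<subseteq> {..m}" by (auto simp: finite_int_iff_bounded_le)
    show "\<forall>\<^sub>F n in sequentially. finite {- int n..int n} \<and> X \<subseteq> {- int n..int n} \<and> {- int n..int n} \<subseteq> UNIV"
      using eventually_ge_at_top[of "nat m"]
    proof eventually_elim
      case (elim n)
      hence "\<bar>x\<bar> \<le> int n" if "x \<in> X" for x using m that by fastforce
      hence "X \<subseteq> {- int n..int n}" by (auto simp: abs_le_iff minus_le_iff)
      thus ?case by simp
    qed
  qed
  with assms show ?thesis unfolding has_sum_def by (rule filterlim_compose)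
qed


section \<open>Fourier series in the test-function topology\<close>

text \<open>
  The coefficients of a smooth function decay faster than any power, so its Fourier series and
  those of its derivatives converge absolutely and uniformly. Hence the series converges in the
  test-function topology and a distribution can be applied to it term by term.
\<close>

lemma fourier_fun_weight_bound:
  assumes \<phi>: "\<phi> \<in> smooth_periodic"
  shows "norm (fourier_fun \<phi> k) \<le> 2 ^ n * test_norm n \<phi> * inverse (weight k ^ n)"
proof -
  have "weight k ^ n * norm (fourier_fun \<phi> k) \<le> 2 ^ n * test_norm n \<phi>"
  proof (cases "k = 0")
    case True
    have "norm (fourier_fun \<phi> 0) \<le> test_norm 0 \<phi>" using fourier_fun_decay[OF \<phi>, of 0 0] by simp
    also have "\<dots> \<le> test_norm n \<phi>" by (rule test_norm_mono[OF \<phi>]) simp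
    also have "\<dots> \<le> 2 ^ n * test_norm n \<phi>"
      using test_norm_nonneg[OF \<phi>, of n] by (simp add: mult_le_cancel_right1)
    finally show ?thesis using True by (simp add: weight_def)
  next
    case False
    hence "1 \<le> \<bar>real_of_int k\<bar>" by linarith
    hence "weight k ^ n \<le> (2 * \<bar>of_int k\<bar>) ^ n" by (intro power_mono) (auto simp: weight_def)
    hence "weight k ^ n * norm (fourier_fun \<phi> k) \<le> (2 * \<bar>of_int k\<bar>) ^ n * norm (fourier_fun \<phi> k)"
      by (rule mult_right_mono) simp
    also have "\<dots> = 2 ^ n * (\<bar>of_int k\<bar> ^ n * norm (fourier_fun \<phi> k))" by (simp add: power_mult_distrib)
    also have "\<dots> \<le> 2 ^ n * test_norm n \<phi>" by (intro mult_left_mono fourier_fun_decay \<phi>) simp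
    finally show ?thesis .
  qed
  thus ?thesis by (simp add: field_simps)
qed

lemma fourier_fun_abs_summable:
  assumes \<phi>: "\<phi> \<in> smooth_periodic"
  shows "(\<lambda>k. norm (fourier_fun \<phi> k)) summable_on UNIV"
  by (rule summable_on_comparison_test[OF summable_on_cmult_right[OF summable_inverse_weight[of 2]]])
     (use fourier_fun_weight_bound[OF \<phi>, of _ 2] in auto)

lemma fourier_series:
  assumes \<phi>: "\<phi> \<in> smooth_periodic"
  shows "((\<lambda>k. fourier_fun \<phi> k * wave k x) has_sum \<phi> x) UNIV"
proof -
  have "(\<lambda>k. fourier_fun \<phi> k * wave k x) summable_on UNIV"
    by (rule abs_summable_summable) (simp add: norm_mult fourier_fun_abs_summable[OF \<phi>])
  then obtain S where S: "((\<lambda>k. fourier_fun \<phi> k * wave k x) has_sum S) UNIV"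
    by (auto simp: summable_on_def)
  have "S = \<phi> x"
    using has_sum_int_symmetric[OF S] fourier_series_pointwise[OF \<phi>] by (rule LIMSEQ_unique)
  with S show ?thesis by simp
qed

lemma fourier_series_tail_le:
  assumes \<phi>: "\<phi> \<in> smooth_periodic" and "finite K"
  shows "norm (\<phi> x - (\<Sum>k\<in>K. fourier_fun \<phi> k * wave k x)) \<le>
    (\<Sum>\<^sub>\<infinity>k. norm (fourier_fun \<phi> k)) - (\<Sum>k\<in>K. norm (fourier_fun \<phi> k))"
proof -
  have *: "infsum f (- K) = infsum f UNIV - sum f K" if "f summable_on UNIV"
    for f :: "int \<Rightarrow> 'b::banach"
    using infsum_Un_disjoint[of f K "- K"] \<open>finite K\<close> summable_on_subset_banach[OF that]
    by (simp add: Compl_partition)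
  note s = fourier_series[OF \<phi>, of x] and a = fourier_fun_abs_summable[OF \<phi>]
  have "\<phi> x - (\<Sum>k\<in>K. fourier_fun \<phi> k * wave k x) = (\<Sum>\<^sub>\<infinity>k\<in>-K. fourier_fun \<phi> k * wave k x)"
    using *[OF has_sum_imp_summable[OF s]] infsumI[OF s] by simp
  also have "norm \<dots> \<le> (\<Sum>\<^sub>\<infinity>k\<in>-K. norm (fourier_fun \<phi> k * wave k x))"
    by (rule norm_infsum_bound) (simp add: norm_mult summable_on_subset_banach[OF a])
  also have "\<dots> = (\<Sum>\<^sub>\<infinity>k. norm (fourier_fun \<phi> k)) - (\<Sum>k\<in>K. norm (fourier_fun \<phi> k))"
    using *[OF a] by (simp add: norm_mult)
  finally show ?thesis .
qed

lemma pairing_add: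
  "\<phi> \<in> smooth_periodic \<Longrightarrow> \<psi> \<in> smooth_periodic \<Longrightarrow>
    pairing f (\<lambda>x. \<phi> x + \<psi> x) = pairing f \<phi> + pairing f \<psi>"
  and pairing_scale: "\<phi> \<in> smooth_periodic \<Longrightarrow> pairing f (\<lambda>x. c * \<phi> x) = c * pairing f \<phi>"
  using is_pdistD[of "pairing f"] pairing[of f] by auto

lemma pairing_sum:
  assumes "\<And>i. i \<in> I \<Longrightarrow> \<phi> i \<in> smooth_periodic"
  shows "pairing f (\<lambda>x. \<Sum>i\<in>I. \<phi> i x) = (\<Sum>i\<in>I. pairing f (\<phi> i))"
proof -
  have z: "pairing f (\<lambda>x. 0) = 0"
    using pairing_scale[OF smooth_periodic_wave[of 0], of f 0] by simp
  show ?thesis using assms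
  proof (induction I rule: infinite_finite_induct)
    case (insert i I)
    thus ?case using pairing_add[of "\<phi> i" "\<lambda>x. \<Sum>i\<in>I. \<phi> i x" f]
      by (simp add: smooth_periodic_sum)
  qed (auto simp: z)
qed

lemma pairing_bound:
  obtains C N where "C \<ge> 0" "\<And>\<phi>. \<phi> \<in> smooth_periodic \<Longrightarrow> norm (pairing f \<phi>) \<le> C * test_norm N \<phi>"
proof -
  have "is_pdist (pairing f)" using pairing[of f] by simp
  then obtain C N where "C \<ge> 0"
    "\<And>M \<phi>. M \<ge> N \<Longrightarrow> \<phi> \<in> smooth_periodic \<Longrightarrow> norm (pairing f \<phi>) \<le> C * test_norm M \<phi>"
    using is_pdist_bound by blast
  thus thesis using that[of C N] by blast
qed

lemma test_norm_wave_le: "test_norm N (wave k) \<le> real (Suc N) * weight k ^ N"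
proof (rule test_norm_le)
  fix j x assume "j \<le> N"
  have "norm ((vderiv ^^ j) (wave k) x) = \<bar>of_int k\<bar> ^ j"
    by (simp add: funpow_vderiv_wave norm_mult norm_power)
  also have "\<dots> \<le> weight k ^ j" by (intro power_mono) (auto simp: weight_def)
  also have "\<dots> \<le> weight k ^ N" using \<open>j \<le> N\<close> by (intro power_increasing) auto
  finally show "norm ((vderiv ^^ j) (wave k) x) \<le> weight k ^ N" .
qed

text \<open>
  Differentiating the Fourier series gives the Fourier series of the derivative, whose tails are
  uniformly small. Hence the partial sums converge in every norm \<open>test_norm N\<close>, and a distribution
  is continuous for one of them.
\<close>

theorem pairing_fourier_series:
  assumes \<phi>: "\<phi> \<in> smooth_periodic"
  shows "(\<lambda>k. norm (fourier_fun \<phi> k * pairing f (wave k))) summable_on UNIV"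
    and "((\<lambda>k. fourier_fun \<phi> k * pairing f (wave k)) has_sum pairing f \<phi>) UNIV"
proof -
  obtain C N where C: "C \<ge> 0" "\<And>\<phi>. \<phi> \<in> smooth_periodic \<Longrightarrow> norm (pairing f \<phi>) \<le> C * test_norm N \<phi>"
    using pairing_bound[of f] by blast
  show abs: "(\<lambda>k. norm (fourier_fun \<phi> k * pairing f (wave k))) summable_on UNIV"
  proof (rule summable_on_comparison_test[OF summable_on_cmult_right[OF summable_inverse_weight[of 2]]])
    fix k
    have "norm (fourier_fun \<phi> k * pairing f (wave k)) \<le>
        (2 ^ (N + 2) * test_norm (N + 2) \<phi> * inverse (weight k ^ (N + 2))) * (C * (real (Suc N) * weight k ^ N))"
      unfolding norm_mult
      by (intro mult_mono fourier_fun_weight_bound \<phi> order_trans[OF C(2)] smooth_periodic_wave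
          mult_left_mono test_norm_wave_le C mult_nonneg_nonneg test_norm_nonneg) auto
    also have "\<dots> = (2 ^ (N + 2) * test_norm (N + 2) \<phi> * C * real (Suc N)) * inverse (weight k ^ 2)"
    proof -
      have w: "weight k \<noteq> 0" using weight_pos[of k] by linarith
      have "inverse (weight k ^ (N + 2)) * weight k ^ N = inverse (weight k ^ 2)"
        by (simp only: power_add inverse_mult_distrib) (simp add: w)
      thus ?thesis by (simp add: mult_ac)
    qed
    finally show "norm (fourier_fun \<phi> k * pairing f (wave k)) \<le> \<dots>" .
  qed auto
  define S where "S = (\<lambda>n x. \<Sum>k\<in>{- int n..int n}. fourier_fun \<phi> k * wave k x)"
  have sm: "S n \<in> smooth_periodic" for n
    unfolding S_def by (intro smooth_periodic_sum smooth_periodic_scale smooth_periodic_wave)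
  have smD: "(\<lambda>x. \<phi> x - S n x) \<in> smooth_periodic" for n
    using smooth_periodic_add[OF \<phi> smooth_periodic_scale[OF sm[of n], of "-1"]] by simp
  define T where "T = (\<lambda>j n. (\<Sum>\<^sub>\<infinity>k. norm (fourier_fun ((vderiv ^^ j) \<phi>) k)) -
      (\<Sum>k\<in>{- int n..int n}. norm (fourier_fun ((vderiv ^^ j) \<phi>) k)))"
  have bT: "norm ((vderiv ^^ j) (\<lambda>x. \<phi> x - S n x) x) \<le> T j n" for j n x
  proof -
    have "(vderiv ^^ j) (\<lambda>x. \<phi> x + (-1) * S n x) x = (vderiv ^^ j) \<phi> x + (-1) * (vderiv ^^ j) (S n) x"
      by (subst funpow_vderiv_add[OF \<phi> smooth_periodic_scale[OF sm]])
         (subst funpow_vderiv_bounded_linear[OF bounded_linear_mult_right sm], simp)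
    also have "(vderiv ^^ j) (S n) x = (\<Sum>k\<in>{- int n..int n}. fourier_fun ((vderiv ^^ j) \<phi>) k * wave k x)"
      unfolding S_def
      by (subst funpow_vderiv_sum)
         (auto intro!: smooth_periodic_scale smooth_periodic_wave sum.cong
           simp: funpow_vderiv_bounded_linear[OF bounded_linear_mult_right smooth_periodic_wave]
             funpow_vderiv_wave fourier_fun_funpow_vderiv[OF \<phi>])
    finally have "(vderiv ^^ j) (\<lambda>x. \<phi> x - S n x) x = (vderiv ^^ j) \<phi> x -
        (\<Sum>k\<in>{- int n..int n}. fourier_fun ((vderiv ^^ j) \<phi>) k * wave k x)" by simp
    thus ?thesis unfolding T_def
      using fourier_series_tail_le[OF smooth_periodic_funpow[OF \<phi>], of "{- int n..int n}" j x] by simp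
  qed
  have "(\<lambda>n. T j n) \<longlonglongrightarrow> (\<Sum>\<^sub>\<infinity>k. norm (fourier_fun ((vderiv ^^ j) \<phi>) k)) -
      (\<Sum>\<^sub>\<infinity>k. norm (fourier_fun ((vderiv ^^ j) \<phi>) k))" for j
    unfolding T_def
    by (intro tendsto_intros has_sum_int_symmetric has_sum_infsum fourier_fun_abs_summable
        smooth_periodic_funpow \<phi>)
  hence "(\<lambda>n. C * (\<Sum>j\<le>N. T j n)) \<longlonglongrightarrow> C * (\<Sum>j\<le>N. 0)"
    by (intro tendsto_intros) simp
  hence T0: "(\<lambda>n. C * (\<Sum>j\<le>N. T j n)) \<longlonglongrightarrow> 0" by simp
  have "norm ((\<Sum>k\<in>{- int n..int n}. fourier_fun \<phi> k * pairing f (wave k)) - pairing f \<phi>) \<le>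
      C * (\<Sum>j\<le>N. T j n)" for n
  proof -
    have "pairing f (S n) = (\<Sum>k\<in>{- int n..int n}. fourier_fun \<phi> k * pairing f (wave k))"
      unfolding S_def
      by (subst pairing_sum)
         (auto intro!: smooth_periodic_scale smooth_periodic_wave sum.cong pairing_scale)
    moreover have "pairing f (\<lambda>x. \<phi> x - S n x) = pairing f \<phi> - pairing f (S n)"
      using pairing_add[OF \<phi> smooth_periodic_scale[OF sm[of n], of "-1"], of f]
        pairing_scale[OF sm[of n], of f "-1"] by simp
    moreover have "norm (pairing f (\<lambda>x. \<phi> x - S n x)) \<le> C * test_norm N (\<lambda>x. \<phi> x - S n x)"
      by (rule C(2)[OF smD])
    moreover have "test_norm N (\<lambda>x. \<phi> x - S n x) \<le> (\<Sum>j\<le>N. T j n)"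
      unfolding test_norm_def by (intro sum_mono cSUP_least bT) auto
    ultimately have "norm (pairing f \<phi> - (\<Sum>k\<in>{- int n..int n}. fourier_fun \<phi> k * pairing f (wave k)))
        \<le> C * (\<Sum>j\<le>N. T j n)"
      using mult_left_mono[of "test_norm N (\<lambda>x. \<phi> x - S n x)" "\<Sum>j\<le>N. T j n" C] C(1) by simp
    thus ?thesis by (simp only: norm_minus_commute)
  qed
  hence "(\<lambda>n. (\<Sum>k\<in>{- int n..int n}. fourier_fun \<phi> k * pairing f (wave k)) - pairing f \<phi>) \<longlonglongrightarrow> 0"
    by (intro Lim_null_comparison[OF _ T0]) auto
  hence lim: "(\<lambda>n. (\<Sum>k\<in>{- int n..int n}. fourier_fun \<phi> k * pairing f (wave k))) \<longlonglongrightarrow> pairing f \<phi>"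
    by (rule LIM_zero_cancel)
  have s: "((\<lambda>k. fourier_fun \<phi> k * pairing f (wave k)) has_sum
      (\<Sum>\<^sub>\<infinity>k. fourier_fun \<phi> k * pairing f (wave k))) UNIV"
    by (rule has_sum_infsum[OF abs_summable_summable[OF abs]])
  have "(\<Sum>\<^sub>\<infinity>k. fourier_fun \<phi> k * pairing f (wave k)) = pairing f \<phi>"
    by (rule LIMSEQ_unique[OF has_sum_int_symmetric[OF s] lim])
  with s show "((\<lambda>k. fourier_fun \<phi> k * pairing f (wave k)) has_sum pairing f \<phi>) UNIV"
    by simp
qed


section \<open>Distributions and their Fourier coefficients\<close>

lemma fourier_conv_pairing: "fourier f k = pairing f (wave (- k)) / (2 * pi)"
proof -
  have "(\<lambda>x. exp (- \<i> * of_int k * complex_of_real x)) = wave (- k)"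
    by (simp add: fun_eq_iff wave_def cis_conv_exp mult_ac)
  thus ?thesis by (simp add: fourier_def)
qed

lemma pairing_wave: "pairing f (wave k) = 2 * pi * fourier f (- k)"
  by (simp add: fourier_conv_pairing)

lemma mean_value_conv_fourier: "mean_value f = fourier f 0"
proof -
  have "wave 0 = (\<lambda>x. 1)" by (simp add: fun_eq_iff)
  thus ?thesis by (simp add: mean_value_def fourier_conv_pairing)
qed

lemma fourier_add: "fourier (f + h) k = fourier f k + fourier h k"
  and fourier_diff: "fourier (f - h) k = fourier f k - fourier h k"
  and fourier_scaleR: "fourier (r *\<^sub>R f) k = r *\<^sub>R fourier f k"
  by (simp_all add: fourier_conv_pairing plus_pdist.rep_eq minus_pdist.rep_eq scaleR_pdist.rep_eq
      add_divide_distrib diff_divide_distrib scaleR_conv_of_real)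

lemma pdist_eqI:
  assumes "\<And>k. fourier f k = fourier h k"
  shows "f = h"
proof -
  have "pairing f \<phi> = pairing h \<phi>" for \<phi>
  proof (cases "\<phi> \<in> smooth_periodic")
    case True
    have "((\<lambda>k. fourier_fun \<phi> k * pairing f (wave k)) has_sum pairing h \<phi>) UNIV"
      using pairing_fourier_series(2)[OF True, of h] by (simp add: pairing_wave assms)
    with pairing_fourier_series(2)[OF True, of f] show ?thesis by (rule has_sum_unique)
  next
    case False
    thus ?thesis using is_pdistD(3) pairing[of f] pairing[of h] by (metis mem_Collect_eq)
  qed
  thus ?thesis by (simp add: pairing_inject[symmetric] fun_eq_iff)
qed

text \<open>
  Bounded coefficients are general enough for all spaces \<open>H\<^sup>s\<close> with \<open>s \<ge> 0\<close>. The defining series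
  converges because the coefficients of a test function decay quadratically.
\<close>

lemma pdist_of_bounded_coefficients:
  assumes B: "\<And>k. norm (c k) \<le> B"
  obtains f where "\<And>k. fourier f k = c k"
proof -
  define F where "F = (\<lambda>\<phi>. if \<phi> \<in> smooth_periodic
      then \<Sum>\<^sub>\<infinity>k. c k * (2 * pi * fourier_fun \<phi> (- k)) else 0)"
  define W where "W = (\<Sum>\<^sub>\<infinity>k. inverse (weight k ^ 2))"
  have "0 \<le> B" using B[of 0] norm_ge_zero order_trans by blast
  have bd: "norm (c k * (2 * pi * fourier_fun \<phi> (- k))) \<le>
      (B * (2 * pi) * 4 * test_norm 2 \<phi>) * inverse (weight k ^ 2)" if "\<phi> \<in> smooth_periodic" for \<phi> k
  proof -
    have "norm (c k * (2 * pi * fourier_fun \<phi> (- k))) = norm (c k) * (2 * pi * norm (fourier_fun \<phi> (- k)))"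
      by (simp add: norm_mult)
    also have "\<dots> \<le> B * (2 * pi * (2 ^ 2 * test_norm 2 \<phi> * inverse (weight (- k) ^ 2)))"
      using \<open>0 \<le> B\<close> by (intro mult_mono B fourier_fun_weight_bound that) auto
    finally show ?thesis by (simp add: mult_ac)
  qed
  have sumW: "(\<lambda>k. inverse (weight k ^ 2)) summable_on UNIV"
    by (rule summable_inverse_weight) simp
  have abs: "(\<lambda>k. norm (c k * (2 * pi * fourier_fun \<phi> (- k)))) summable_on UNIV"
    if "\<phi> \<in> smooth_periodic" for \<phi>
    by (rule summable_on_comparison_test[OF summable_on_cmult_right[OF sumW]])
       (use bd[OF that] in auto)
  note summ = abs_summable_summable[OF abs]
  have cont: "\<phi> \<in> smooth_periodic \<Longrightarrow> continuous_on {0..2 * pi} \<phi>" for \<phi> :: "real \<Rightarrow> complex"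
    by (rule smooth_periodic_continuous_on)
  have "is_pdist F"
  proof (rule is_pdistI)
    fix \<phi> \<psi> :: "real \<Rightarrow> complex" assume a: "\<phi> \<in> smooth_periodic" "\<psi> \<in> smooth_periodic"
    have "F (\<lambda>x. \<phi> x + \<psi> x) = (\<Sum>\<^sub>\<infinity>k. c k * (2 * pi * fourier_fun \<phi> (- k)) +
        c k * (2 * pi * fourier_fun \<psi> (- k)))"
      using a smooth_periodic_add[OF a] by (simp add: F_def fourier_fun_add cont distrib_left)
    also have "\<dots> = (\<Sum>\<^sub>\<infinity>k. c k * (2 * pi * fourier_fun \<phi> (- k))) +
        (\<Sum>\<^sub>\<infinity>k. c k * (2 * pi * fourier_fun \<psi> (- k)))"
      by (rule infsum_add[OF summ[OF a(1)] summ[OF a(2)]])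
    also have "\<dots> = F \<phi> + F \<psi>" using a by (simp add: F_def)
    finally show "F (\<lambda>x. \<phi> x + \<psi> x) = F \<phi> + F \<psi>" .
  next
    fix \<phi> :: "real \<Rightarrow> complex" and d assume a: "\<phi> \<in> smooth_periodic"
    have "F (\<lambda>x. d * \<phi> x) = (\<Sum>\<^sub>\<infinity>k. d * (c k * (2 * pi * fourier_fun \<phi> (- k))))"
      using smooth_periodic_scale[OF a, of d] by (simp add: F_def fourier_fun_scale mult_ac)
    also have "\<dots> = d * F \<phi>" using a by (simp add: F_def infsum_cmult_right')
    finally show "F (\<lambda>x. d * \<phi> x) = d * F \<phi>" .
  next
    fix \<phi> :: "real \<Rightarrow> complex" assume a: "\<phi> \<in> smooth_periodic"
    have "norm (F \<phi>) = norm (\<Sum>\<^sub>\<infinity>k. c k * (2 * pi * fourier_fun \<phi> (- k)))"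
      using a by (simp add: F_def)
    also have "\<dots> \<le> (\<Sum>\<^sub>\<infinity>k. norm (c k * (2 * pi * fourier_fun \<phi> (- k))))"
      by (rule norm_infsum_bound[OF abs[OF a]])
    also have "\<dots> \<le> (\<Sum>\<^sub>\<infinity>k. (B * (2 * pi) * 4 * test_norm 2 \<phi>) * inverse (weight k ^ 2))"
      by (intro infsum_mono abs bd a summable_on_cmult_right sumW)
    also have "\<dots> = (B * (2 * pi) * 4 * W) * test_norm 2 \<phi>"
      by (simp add: infsum_cmult_right' W_def mult_ac)
    finally show "norm (F \<phi>) \<le> (B * (2 * pi) * 4 * W) * test_norm 2 \<phi>" .
  qed (simp add: F_def)
  hence p: "pairing (Abs_pdist F) = F" by (simp add: Abs_pdist_inverse)
  have "fourier (Abs_pdist F) k = c k" for k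
  proof -
    have "((\<lambda>j. c j * (2 * pi * fourier_fun (wave (- k)) (- j))) has_sum (2 * pi * c k)) UNIV"
      by (rule has_sum_finite_neutralI[of "{k}"]) (auto simp: fourier_fun_wave)
    hence "F (wave (- k)) = 2 * pi * c k"
      by (simp add: F_def smooth_periodic_wave infsumI)
    thus ?thesis by (simp add: fourier_conv_pairing p)
  qed
  thus thesis using that by blast
qed

lemma has_sum_minus:
  fixes f g :: "'i \<Rightarrow> 'a::real_normed_vector"
  assumes "(f has_sum a) A" "(g has_sum b) A"
  shows "((\<lambda>x. f x - g x) has_sum (a - b)) A"
  using has_sum_add[OF assms(1), of "\<lambda>x. - g x" "- b"] assms(2) by (simp add: has_sum_uminus)

text \<open>
  Normalised without the factor \<open>1/(2\<pi>)\<close>, so that the coefficient at \<open>0\<close> is the total mass.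
\<close>

definition density_coeff :: "(real \<Rightarrow> real) \<Rightarrow> int \<Rightarrow> complex" where
  "density_coeff g k = integral {0..2 * pi} (\<lambda>x. wave (- k) x * complex_of_real (g x))"

text \<open>
  The matrix of the control operator in the exponentials, multiplied by \<open>2\<pi>\<close>: a convolution minus
  a rank-one matrix.
\<close>

definition control_matrix :: "(real \<Rightarrow> real) \<Rightarrow> int \<Rightarrow> int \<Rightarrow> complex" where
  "control_matrix g k l = density_coeff g (k - l) - density_coeff g k * density_coeff g (- l)"

lemma density_coeff_conv: "density_coeff g k = 2 * pi * fourier_fun (\<lambda>x. complex_of_real (g x)) k"
  by (simp add: density_coeff_def fourier_fun_def)

theorem fourier_control_op:
  assumes g: "g \<in> smooth_periodic"
  shows "((\<lambda>l. control_matrix g k l * fourier h l) has_sum 2 * pi * fourier (control_op g h) k) UNIV"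
proof -
  define gc where "gc = (\<lambda>x. complex_of_real (g x))"
  have gc: "gc \<in> smooth_periodic" unfolding gc_def by (rule smooth_periodic_of_real[OF g])
  have gw: "(\<lambda>x. gc x * wave (- k) x) \<in> smooth_periodic"
    by (intro smooth_periodic_mult gc smooth_periodic_wave)
  have exp: "((\<lambda>l. fourier_fun \<phi> (- l) * (2 * pi * fourier h l)) has_sum pairing h \<phi>) UNIV"
    if "\<phi> \<in> smooth_periodic" for \<phi>
  proof -
    have "((\<lambda>l. fourier_fun \<phi> (- l) * pairing h (wave (- l))) has_sum pairing h \<phi>) UNIV"
      using pairing_fourier_series(2)[OF that, of h]
      by (subst (asm) has_sum_reindex_bij_betw[where g = uminus and A = UNIV, symmetric])
         (auto intro: bij_uminus)
    thus ?thesis by (simp add: pairing_wave)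
  qed
  have "pairing (control_op g h) (wave (- k)) =
      pairing h (\<lambda>x. gc x * wave (- k) x) - pairing h gc * integral {0..2 * pi} (\<lambda>x. gc x * wave (- k) x)"
    using gw g smooth_periodic_wave[of "- k"] unfolding control_op_def gc_def
    by (simp add: smult_pdist.rep_eq minus_pdist.rep_eq const_pdist.rep_eq)
  moreover have "integral {0..2 * pi} (\<lambda>x. gc x * wave (- k) x) = density_coeff g k"
    by (simp add: density_coeff_def gc_def mult.commute)
  ultimately have e: "2 * pi * fourier (control_op g h) k =
      pairing h (\<lambda>x. gc x * wave (- k) x) - pairing h gc * density_coeff g k"
    by (simp add: fourier_conv_pairing)
  have "((\<lambda>l. fourier_fun (\<lambda>x. gc x * wave (- k) x) (- l) * (2 * pi * fourier h l) -
      (fourier_fun gc (- l) * (2 * pi * fourier h l)) * density_coeff g k) has_sum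
      2 * pi * fourier (control_op g h) k) UNIV"
    unfolding e by (intro has_sum_minus exp gw gc has_sum_cmult_left)
  moreover have "fourier_fun (\<lambda>x. gc x * wave (- k) x) (- l) = fourier_fun gc (k - l)" for l
    using fourier_fun_wave_mult[of "- k" gc "- l"] by (simp add: mult.commute)
  ultimately show ?thesis
    by (simp add: control_matrix_def density_coeff_conv gc_def[symmetric] algebra_simps)
qed

lemma cnj_density_coeff: "continuous_on {0..2 * pi} g \<Longrightarrow> cnj (density_coeff g k) = density_coeff g (- k)"
proof -
  assume g: "continuous_on {0..2 * pi} g"
  have "((\<lambda>x. cnj (wave (- k) x * complex_of_real (g x))) has_integral cnj (density_coeff g k)) {0..2 * pi}"
    using has_integral_linear[OF integrable_integral[OF integrable_wave_mult] bounded_linear_cnj,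
        of "\<lambda>x. complex_of_real (g x)" "- k"] g
    by (simp add: o_def density_coeff_def continuous_on_of_real)
  thus ?thesis by (simp add: density_coeff_def cnj_wave integral_unique)
qed

lemma density_coeff_0:
  assumes "continuous_on {0..2 * pi} g" "integral {0..2 * pi} g = 1"
  shows "density_coeff g 0 = 1"
proof -
  have "(g has_integral 1) {0..2 * pi}"
    using assms integrable_continuous_real has_integral_integrable_integral by blast
  hence "((\<lambda>x. complex_of_real (g x)) has_integral of_real 1) {0..2 * pi}"
    by (rule has_integral_of_real)
  thus ?thesis by (simp add: density_coeff_def integral_unique)
qed

lemma density_coeff_decay:
  assumes g: "g \<in> smooth_periodic"
  obtains C where "C > 0" "\<And>k. norm (density_coeff g k) \<le> C * inverse (weight k ^ p)"
proof -
  define t where "t = test_norm p (\<lambda>x. complex_of_real (g x))"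
  have "0 \<le> t" unfolding t_def by (intro test_norm_nonneg smooth_periodic_of_real g)
  moreover have "norm (density_coeff g k) \<le> (2 * pi * 2 ^ p * (t + 1)) * inverse (weight k ^ p)" for k
  proof -
    have "norm (density_coeff g k) \<le> 2 * pi * (2 ^ p * t * inverse (weight k ^ p))"
      unfolding density_coeff_conv norm_mult t_def
      using fourier_fun_weight_bound[OF smooth_periodic_of_real[OF g], of k p] by simp
    also have "\<dots> \<le> 2 * pi * (2 ^ p * (t + 1) * inverse (weight k ^ p))"
      by (intro mult_left_mono mult_right_mono) auto
    finally show ?thesis by (simp add: mult_ac)
  qed
  ultimately show thesis using that[of "2 * pi * 2 ^ p * (t + 1)"] by simp
qed

section \<open>Trigonometric polynomials on a short interval\<close>

lemma norm_diff_squared_le: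
  fixes u v :: "'a::real_normed_vector"
  shows "(norm (u - v))\<^sup>2 \<le> 2 * (norm u)\<^sup>2 + 2 * (norm v)\<^sup>2"
proof -
  have "(norm (u - v))\<^sup>2 \<le> (norm u + norm v)\<^sup>2"
    by (intro power_mono norm_triangle_ineq4) simp
  also have "\<dots> \<le> 2 * (norm u)\<^sup>2 + 2 * (norm v)\<^sup>2"
    using sum_squares_bound[of "norm u" "norm v"] by (simp add: power2_sum)
  finally show ?thesis .
qed

text \<open>
  Passing from \<open>q\<close> to \<open>q(x + \<delta>) - e\<^sup>i\<^sup>j\<^sup>\<delta> q(x)\<close> removes the frequency \<open>j\<close> from a trigonometric
  polynomial. It costs a piece of length \<open>\<delta>\<close> of the interval and a factor \<open>4\<close> in the square
  integral. The lemma iterates this over the frequencies in \<open>E\<close>.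
\<close>

lemma frequency_elimination:
  fixes q :: "int \<Rightarrow> complex"
  assumes "finite E" and \<delta>: "0 \<le> \<delta>" and "a \<le> b - real (card E) * \<delta>"
  shows "integral {a..b - real (card E) * \<delta>}
      (\<lambda>x. (norm (\<Sum>k\<in>K. (q k * (\<Prod>j\<in>E. wave k \<delta> - wave j \<delta>)) * wave k x))\<^sup>2)
    \<le> 4 ^ card E * integral {a..b} (\<lambda>x. (norm (\<Sum>k\<in>K. q k * wave k x))\<^sup>2)"
  using assms(1,3)
proof (induction E rule: finite_induct)
  case (insert i E)
  define P where "P = (\<lambda>x. \<Sum>k\<in>K. (q k * (\<Prod>j\<in>E. wave k \<delta> - wave j \<delta>)) * wave k x)"
  define e where "e = b - real (card E) * \<delta>"
  have ce: "b - real (card (insert i E)) * \<delta> = e - \<delta>"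
    using insert by (simp add: e_def algebra_simps)
  have ae: "a \<le> e - \<delta>" using insert.prems ce by simp
  have cP: "continuous_on X P" for X unfolding P_def by (intro continuous_intros)
  have cP2: "continuous_on X (\<lambda>x. (norm (P x))\<^sup>2)" for X by (intro continuous_intros cP)
  have i: "(\<lambda>x. (norm (P x))\<^sup>2) integrable_on {u..v}" for u v
    by (intro integrable_continuous_real cP2)
  have is': "(\<lambda>x. (norm (P (x + \<delta>)))\<^sup>2) integrable_on {u..v}" for u v
    by (intro integrable_continuous_real continuous_intros continuous_on_compose2[OF cP[of UNIV]]) auto
  have eq: "(\<Sum>k\<in>K. (q k * (\<Prod>j\<in>insert i E. wave k \<delta> - wave j \<delta>)) * wave k x)
      = P (x + \<delta>) - wave i \<delta> * P x" for x
    using insert.hyps by (simp add: P_def wave_shift sum_distrib_left algebra_simps flip: sum_subtractf)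
  have sub: "integral {u..v} (\<lambda>x. (norm (P x))\<^sup>2) \<le> integral {a..e} (\<lambda>x. (norm (P x))\<^sup>2)"
    if "{u..v} \<subseteq> {a..e}" for u v
    by (rule integral_subset_le[OF that i i]) simp
  have "integral {a..e - \<delta>} (\<lambda>x. (norm (P (x + \<delta>) - wave i \<delta> * P x))\<^sup>2)
      \<le> integral {a..e - \<delta>} (\<lambda>x. 2 * (norm (P (x + \<delta>)))\<^sup>2 + 2 * (norm (P x))\<^sup>2)"
  proof (rule integral_le)
    show "(\<lambda>x. (norm (P (x + \<delta>) - wave i \<delta> * P x))\<^sup>2) integrable_on {a..e - \<delta>}"
      by (intro integrable_continuous_real continuous_intros cP continuous_on_compose2[OF cP[of UNIV]]) auto
    show "(\<lambda>x. 2 * (norm (P (x + \<delta>)))\<^sup>2 + 2 * (norm (P x))\<^sup>2) integrable_on {a..e - \<delta>}"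
      by (intro integrable_add integrable_on_mult_right i is')
    show "(norm (P (x + \<delta>) - wave i \<delta> * P x))\<^sup>2 \<le> 2 * (norm (P (x + \<delta>)))\<^sup>2 + 2 * (norm (P x))\<^sup>2" for x
      using norm_diff_squared_le[of "P (x + \<delta>)" "wave i \<delta> * P x"] by (simp add: norm_mult)
  qed
  also have "\<dots> = 2 * integral {a..e - \<delta>} (\<lambda>x. (norm (P (x + \<delta>)))\<^sup>2) + 2 * integral {a..e - \<delta>} (\<lambda>x. (norm (P x))\<^sup>2)"
    by (subst Henstock_Kurzweil_Integration.integral_add)
       (auto intro!: integrable_on_mult_right i is')
  also have "integral {a..e - \<delta>} (\<lambda>x. (norm (P (x + \<delta>)))\<^sup>2) = integral {a + \<delta>..e} (\<lambda>x. (norm (P x))\<^sup>2)"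
    using integral_shift[of a \<delta> "e - \<delta>" "\<lambda>x. (norm (P x))\<^sup>2"] cP2 by (simp add: o_def)
  also have "\<dots> \<le> integral {a..e} (\<lambda>x. (norm (P x))\<^sup>2)" by (rule sub) (use \<delta> in auto)
  also have "integral {a..e - \<delta>} (\<lambda>x. (norm (P x))\<^sup>2) \<le> integral {a..e} (\<lambda>x. (norm (P x))\<^sup>2)"
    by (rule sub) (use \<delta> in auto)
  finally have "integral {a..e - \<delta>} (\<lambda>x. (norm (P (x + \<delta>) - wave i \<delta> * P x))\<^sup>2)
      \<le> 4 * integral {a..e} (\<lambda>x. (norm (P x))\<^sup>2)" by simp
  also have "integral {a..e} (\<lambda>x. (norm (P x))\<^sup>2)
      \<le> 4 ^ card E * integral {a..b} (\<lambda>x. (norm (\<Sum>k\<in>K. q k * wave k x))\<^sup>2)"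
    using insert.IH ae \<delta> by (simp add: P_def e_def)
  finally show ?case using insert.hyps unfolding ce eq by simp
qed simp

lemma norm_cis_diff_1_ge:
  assumes "\<bar>x\<bar> \<le> 1" shows "\<bar>x\<bar> / 2 \<le> norm (cis x - 1)"
proof -
  have "\<bar>sin x - x\<bar> \<le> inverse (fact 3) * \<bar>x\<bar> ^ 3"
    using Maclaurin_sin_bound[of x 3] by (simp add: numeral_3_eq_3 sin_coeff_def)
  also have "\<dots> \<le> \<bar>x\<bar> / 2"
  proof -
    have "\<bar>x\<bar> ^ 3 \<le> \<bar>x\<bar> ^ 1" by (rule power_decreasing) (use assms in auto)
    thus ?thesis by (simp add: fact_numeral)
  qed
  finally have "\<bar>x\<bar> / 2 \<le> \<bar>sin x\<bar>" by linarith
  hence "\<bar>x\<bar> / 2 \<le> \<bar>Im (cis x - 1)\<bar>" by simp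
  also have "\<dots> \<le> norm (cis x - 1)" by (rule abs_Im_le_cmod)
  finally show ?thesis .
qed

text \<open>
  Eliminating all frequencies except \<open>m\<close> isolates one coefficient. The step \<open>\<delta> = l/(4N)\<close> uses up at
  most half of the interval, and keeps each surviving factor \<open>e\<^sup>i\<^sup>m\<^sup>\<delta> - e\<^sup>i\<^sup>j\<^sup>\<delta>\<close> of modulus at least
  \<open>\<delta>/2\<close>. The loss is of the form \<open>N\<^sup>-\<^sup>C\<^sup>N\<close>, to be compared later with \<open>3\<^sup>-\<^sup>n\<close> where \<open>n\<close> is
  of order \<open>N\<^sup>2\<close> up to a logarithm.
\<close>

lemma coefficient_le_local_integral:
  fixes q :: "int \<Rightarrow> complex"
  assumes K: "K \<subseteq> {- int N..int N}" and m: "m \<in> K" and N: "0 < N" and l: "0 < l" "l \<le> 1"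
  shows "(norm (q m))\<^sup>2 * ((l / 2) * (l / (16 * N)) ^ (4 * N))
    \<le> integral {a..a + l} (\<lambda>x. (norm (\<Sum>k\<in>K. q k * wave k x))\<^sup>2)"
proof -
  define \<delta> where "\<delta> = l / (4 * N)"
  define E where "E = K - {m}"
  have fin: "finite K" "finite E" using finite_subset[OF K] by (auto simp: E_def)
  have "card K \<le> card {- int N..int N}" by (rule card_mono) (use K in auto)
  hence cE: "card E \<le> 2 * N" using m fin by (simp add: E_def)
  have d0: "0 < \<delta>" "\<delta> \<le> 1" using N l by (auto simp: \<delta>_def field_simps)
  have "real (card E) * \<delta> \<le> real (2 * N) * \<delta>" using cE d0 by (intro mult_right_mono) auto
  also have "\<dots> = l / 2" using N by (simp add: \<delta>_def)
  finally have cd: "real (card E) * \<delta> \<le> l / 2" .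
  define Q where "Q = (\<Prod>j\<in>E. wave m \<delta> - wave j \<delta>)"
  have z: "(\<Sum>k\<in>K. (q k * (\<Prod>j\<in>E. wave k \<delta> - wave j \<delta>)) * wave k x) = q m * Q * wave m x" for x
  proof -
    have "(\<Prod>j\<in>E. wave k \<delta> - wave j \<delta>) = 0" if "k \<in> K - {m}" for k
      using that fin by (intro prod_zero) (auto simp: E_def)
    hence "(\<Sum>k\<in>K - {m}. (q k * (\<Prod>j\<in>E. wave k \<delta> - wave j \<delta>)) * wave k x) = 0"
      by (intro sum.neutral ballI) (simp only: mult_zero_left mult_zero_right)
    thus ?thesis using m fin(1) by (subst sum.remove[of K m]) (auto simp: Q_def)
  qed
  have gap: "\<delta> / 2 \<le> norm (wave m \<delta> - wave j \<delta>)" if "j \<in> E" for j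
  proof -
    define d where "d = of_int (m - j) * \<delta>"
    have "m \<noteq> j" "m \<in> {- int N..int N}" "j \<in> {- int N..int N}" using that K m unfolding E_def by auto
    hence "\<bar>m - j\<bar> \<le> 2 * int N" "1 \<le> \<bar>m - j\<bar>" by auto
    hence *: "\<bar>real_of_int (m - j)\<bar> \<le> 2 * real N" "1 \<le> \<bar>real_of_int (m - j)\<bar>" by linarith+
    have ad: "\<bar>d\<bar> = \<bar>real_of_int (m - j)\<bar> * \<delta>" using d0 by (simp add: d_def abs_mult)
    have "\<bar>d\<bar> \<le> 2 * real N * \<delta>" "1 * \<delta> \<le> \<bar>d\<bar>"
      unfolding ad using d0 by (intro mult_right_mono *; simp)+
    moreover have "2 * real N * \<delta> \<le> 1" using N l by (simp add: \<delta>_def)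
    ultimately have "\<delta> / 2 \<le> norm (cis d - 1)" using norm_cis_diff_1_ge[of d] by linarith
    also have "wave m \<delta> - wave j \<delta> = wave j \<delta> * (cis d - 1)"
      by (simp add: wave_def d_def algebra_simps cis_mult)
    hence "norm (cis d - 1) = norm (wave m \<delta> - wave j \<delta>)" by (simp add: norm_mult)
    finally show ?thesis .
  qed
  have "(\<delta> / 2) ^ (2 * N) \<le> (\<delta> / 2) ^ card E"
    by (rule power_decreasing) (use cE d0 in auto)
  also have "\<dots> \<le> norm Q"
    unfolding Q_def prod_norm[symmetric]
    using prod_mono[of E "\<lambda>_. \<delta> / 2" "\<lambda>j. norm (wave m \<delta> - wave j \<delta>)"] gap d0 by simp
  finally have "((\<delta> / 2) ^ (2 * N))\<^sup>2 \<le> (norm Q)\<^sup>2" using d0 by (intro power_mono) auto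
  hence Q: "(\<delta> / 2) ^ (4 * N) \<le> (norm Q)\<^sup>2" by (simp flip: power_mult)
  have "(norm (q m))\<^sup>2 * ((\<delta> / 2) ^ (4 * N) * (l / 2)) \<le> (norm (q m))\<^sup>2 * ((norm Q)\<^sup>2 * (l - real (card E) * \<delta>))"
    using Q cd l by (intro mult_left_mono mult_mono) auto
  also have "\<dots> = integral {a..a + l - real (card E) * \<delta>} (\<lambda>x. (norm (q m * Q * wave m x))\<^sup>2)"
    using cd l by (simp add: norm_mult power_mult_distrib)
  also have "\<dots> \<le> 4 ^ card E * integral {a..a + l} (\<lambda>x. (norm (\<Sum>k\<in>K. q k * wave k x))\<^sup>2)"
    using frequency_elimination[OF fin(2), of \<delta> a "a + l" q K] d0 cd l unfolding z by simp
  also have "\<dots> \<le> 4 ^ (2 * N) * integral {a..a + l} (\<lambda>x. (norm (\<Sum>k\<in>K. q k * wave k x))\<^sup>2)"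
    by (intro mult_right_mono power_increasing Henstock_Kurzweil_Integration.integral_nonneg
        integrable_continuous_real continuous_intros) (use cE in auto)
  finally have *: "(norm (q m))\<^sup>2 * ((\<delta> / 2) ^ (4 * N) * (l / 2)) \<le>
      4 ^ (2 * N) * integral {a..a + l} (\<lambda>x. (norm (\<Sum>k\<in>K. q k * wave k x))\<^sup>2)" .
  have "(4::real) ^ (2 * N) = 2 ^ (4 * N)" using power_mult[of "2::real" 2 "2 * N"] by simp
  moreover have "(\<delta> / 2) ^ (4 * N) = 2 ^ (4 * N) * (l / (16 * N)) ^ (4 * N)"
    using N by (simp add: \<delta>_def flip: power_mult_distrib)
  ultimately have "2 ^ (4 * N) * ((norm (q m))\<^sup>2 * ((l / 2) * (l / (16 * N)) ^ (4 * N))) \<le>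
      2 ^ (4 * N) * integral {a..a + l} (\<lambda>x. (norm (\<Sum>k\<in>K. q k * wave k x))\<^sup>2)"
    using * by (simp add: mult_ac)
  thus ?thesis by simp
qed

section \<open>The control operator on low frequencies\<close>

locale control_density =
  fixes g :: "real \<Rightarrow> real"
  assumes smooth: "g \<in> smooth_periodic"
    and nonneg: "\<And>x. 0 \<le> g x"
    and mass: "integral {0..2 * pi} g = 1"
begin

lemma continuous_g: "continuous_on S g"
  by (intro continuous_at_imp_continuous_on ballI differentiable_imp_continuous_within
      smooth_periodic_differentiable smooth)

lemma positive_on_interval:
  "\<exists>a l g0. 0 < l \<and> l \<le> 1 \<and> 0 < g0 \<and> {a..a + l} \<subseteq> {0..2 * pi} \<and> (\<forall>x\<in>{a..a + l}. g0 \<le> g x)"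
proof -
  have "\<exists>x\<in>{0..2 * pi}. 0 < g x"
  proof (rule ccontr)
    assume "\<not> ?thesis"
    hence "g x = 0" if "x \<in> {0..2 * pi}" for x using that nonneg[of x] by (meson linorder_not_le order_antisym)
    hence "integral {0..2 * pi} g = integral {0..2 * pi} (\<lambda>_. 0)"
      by (intro Henstock_Kurzweil_Integration.integral_cong)
    thus False using mass by simp
  qed
  then obtain x where x: "x \<in> {0..2 * pi}" "0 < g x" by blast
  have "isCont g x" using continuous_g[of UNIV] by (simp add: continuous_on_eq_continuous_at)
  then obtain d where d: "0 < d" "\<And>y. \<bar>y - x\<bar> < d \<Longrightarrow> \<bar>g y - g x\<bar> < g x / 2"
    using x(2) unfolding continuous_at_eps_delta dist_real_def by (meson half_gt_zero)
  define r where "r = min (d / 2) 1"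
  \<comment> \<open>The interval is placed on the side of \<open>x\<close> on which it stays inside the period.\<close>
  define a where "a = (if x < pi then x else x - r)"
  have r: "0 < r" "r \<le> 1" "r < d" using d(1) by (auto simp: r_def)
  have "{a..a + r} \<subseteq> {0..2 * pi}" using x(1) r pi_gt3 by (auto simp: a_def)
  moreover have "g x / 2 \<le> g y" if "y \<in> {a..a + r}" for y
  proof -
    have "\<bar>y - x\<bar> < d" using that r by (auto simp: a_def split: if_splits)
    from d(2)[OF this] show ?thesis by linarith
  qed
  ultimately show ?thesis using r x(2)
    by (intro exI[of _ a] exI[of _ r] exI[of _ "g x / 2"] conjI ballI) auto
qed

text \<open>
  The quadratic form of the control operator is a weighted variance: \<open>c\<close> is the mean of the
  trigonometric polynomial with respect to the probability density \<open>g\<close>.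
\<close>

lemma control_form_eq_integral:
  fixes a :: "int \<Rightarrow> complex"
  assumes fin: "finite F"
  defines "c \<equiv> \<Sum>k\<in>F. a k * density_coeff g (- k)"
  shows "(\<Sum>k\<in>F. \<Sum>l\<in>F. control_matrix g k l * a l * cnj (a k)) =
    of_real (integral {0..2 * pi} (\<lambda>x. g x * (norm ((\<Sum>k\<in>F. a k * wave k x) - c))\<^sup>2))"
proof -
  define P where "P = (\<lambda>x. \<Sum>k\<in>F. a k * wave k x)"
  have dc: "((\<lambda>x. wave k x * complex_of_real (g x)) has_integral density_coeff g (- k)) {0..2 * pi}" for k
    unfolding density_coeff_def minus_minus
    by (intro integrable_integral integrable_wave_mult continuous_intros continuous_g)
  have i1: "((\<lambda>x. complex_of_real (g x) * P x) has_integral c) {0..2 * pi}"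
  proof -
    have "((\<lambda>x. \<Sum>k\<in>F. a k * (wave k x * complex_of_real (g x))) has_integral c) {0..2 * pi}"
      unfolding c_def by (intro has_integral_sum fin has_integral_mult_right dc)
    thus ?thesis by (simp add: P_def sum_distrib_left mult_ac)
  qed
  have i2: "((\<lambda>x. complex_of_real (g x) * cnj (P x)) has_integral cnj c) {0..2 * pi}"
    using has_integral_linear[OF i1 bounded_linear_cnj] by (simp add: o_def)
  have i0: "((\<lambda>x. complex_of_real (g x)) has_integral 1) {0..2 * pi}"
    using dc[of 0] density_coeff_0[OF continuous_g mass] by simp
  have i3: "((\<lambda>x. complex_of_real (g x) * (P x * cnj (P x))) has_integral
      (\<Sum>k\<in>F. \<Sum>l\<in>F. density_coeff g (k - l) * a l * cnj (a k))) {0..2 * pi}"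
  proof -
    have "((\<lambda>x. \<Sum>k\<in>F. \<Sum>l\<in>F. (wave (l - k) x * complex_of_real (g x)) * (a l * cnj (a k))) has_integral
      (\<Sum>k\<in>F. \<Sum>l\<in>F. density_coeff g (- (l - k)) * (a l * cnj (a k)))) {0..2 * pi}"
      by (intro has_integral_sum fin has_integral_mult_left dc)
    moreover have "(\<Sum>k\<in>F. \<Sum>l\<in>F. (wave (l - k) x * complex_of_real (g x)) * (a l * cnj (a k))) =
        complex_of_real (g x) * (P x * cnj (P x))" for x
    proof -
      have "complex_of_real (g x) * (cnj (P x) * P x) =
          (\<Sum>k\<in>F. \<Sum>l\<in>F. complex_of_real (g x) * ((cnj (a k) * wave (- k) x) * (a l * wave l x)))"
      proof -
        have "cnj (P x) * P x = (\<Sum>k\<in>F. \<Sum>l\<in>F. (cnj (a k) * wave (- k) x) * (a l * wave l x))"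
          by (simp add: P_def cnj_wave sum_product)
        thus ?thesis by (simp only: sum_distrib_left)
      qed
      also have "\<dots> = (\<Sum>k\<in>F. \<Sum>l\<in>F. (wave (l - k) x * complex_of_real (g x)) * (a l * cnj (a k)))"
      proof (intro sum.cong refl)
        fix k l
        have "wave (l - k) x = wave (- k) x * wave l x" by (simp add: wave_mult)
        thus "complex_of_real (g x) * ((cnj (a k) * wave (- k) x) * (a l * wave l x)) =
            (wave (l - k) x * complex_of_real (g x)) * (a l * cnj (a k))"
          by (simp only: mult_ac)
      qed
      finally show ?thesis by (simp add: mult_ac)
    qed
    ultimately show ?thesis by (simp add: mult.assoc)
  qed
  have "((\<lambda>x. complex_of_real (g x) * (P x * cnj (P x)) - cnj c * (complex_of_real (g x) * P x)
      - c * (complex_of_real (g x) * cnj (P x)) + (c * cnj c) * complex_of_real (g x)) has_integral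
      ((\<Sum>k\<in>F. \<Sum>l\<in>F. density_coeff g (k - l) * a l * cnj (a k)) - cnj c * c - c * cnj c + (c * cnj c) * 1)) {0..2 * pi}"
    by (intro has_integral_add has_integral_diff has_integral_mult_right i0 i1 i2 i3)
  moreover have "complex_of_real (g x) * (P x * cnj (P x)) - cnj c * (complex_of_real (g x) * P x)
      - c * (complex_of_real (g x) * cnj (P x)) + (c * cnj c) * complex_of_real (g x) =
      complex_of_real (g x * (norm (P x - c))\<^sup>2)" for x
    unfolding of_real_mult complex_norm_square by (simp add: algebra_simps)
  ultimately have A: "((\<lambda>x. complex_of_real (g x * (norm (P x - c))\<^sup>2)) has_integral
      ((\<Sum>k\<in>F. \<Sum>l\<in>F. density_coeff g (k - l) * a l * cnj (a k)) - c * cnj c)) {0..2 * pi}"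
    by (simp add: mult.commute)
  have B: "((\<lambda>x. complex_of_real (g x * (norm (P x - c))\<^sup>2)) has_integral
      complex_of_real (integral {0..2 * pi} (\<lambda>x. g x * (norm (P x - c))\<^sup>2))) {0..2 * pi}"
    unfolding P_def
    by (intro has_integral_of_real integrable_integral integrable_continuous_real continuous_intros continuous_g)
  have "cnj c = (\<Sum>k\<in>F. cnj (a k) * density_coeff g k)"
    by (simp add: c_def cnj_density_coeff[OF continuous_g])
  hence cc: "c * cnj c = (\<Sum>k\<in>F. \<Sum>l\<in>F. density_coeff g k * density_coeff g (- l) * a l * cnj (a k))"
  proof -
    assume *: "cnj c = (\<Sum>k\<in>F. cnj (a k) * density_coeff g k)"
    have "c * cnj c = (\<Sum>k\<in>F. cnj (a k) * density_coeff g k) * (\<Sum>l\<in>F. a l * density_coeff g (- l))"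
      unfolding * by (simp add: c_def mult.commute)
    also have "\<dots> = (\<Sum>k\<in>F. \<Sum>l\<in>F. density_coeff g k * density_coeff g (- l) * a l * cnj (a k))"
      unfolding sum_product by (intro sum.cong refl) (simp only: mult_ac)
    finally show ?thesis .
  qed
  have "(\<Sum>k\<in>F. \<Sum>l\<in>F. control_matrix g k l * a l * cnj (a k)) =
      (\<Sum>k\<in>F. \<Sum>l\<in>F. density_coeff g (k - l) * a l * cnj (a k)) - c * cnj c"
    unfolding cc by (simp add: control_matrix_def left_diff_distrib sum_subtractf)
  also have "\<dots> = complex_of_real (integral {0..2 * pi} (\<lambda>x. g x * (norm (P x - c))\<^sup>2))"
    by (rule has_integral_unique[OF A B])
  finally show ?thesis by (simp add: P_def)
qed


text \<open>
  The mean \<open>c\<close> sits at frequency \<open>0\<close>, which does not belong to \<open>F\<close>. So the polynomial minus \<open>c\<close>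
  still has the coefficients \<open>a k\<close>, and the bound for a coefficient in terms of an integral over
  an interval applies on an interval where \<open>g\<close> is bounded below.
\<close>

lemma control_form_ge:
  "\<exists>l b. 0 < l \<and> l \<le> 1 \<and> 0 < b \<and> (\<forall>N F a. 0 < N \<longrightarrow> F \<subseteq> {- int N..int N} - {0} \<longrightarrow>
      b * inverse (real N) * (l / (16 * N)) ^ (4 * N) * (\<Sum>k\<in>F. (norm (a k))\<^sup>2) \<le>
      Re (\<Sum>k\<in>F. \<Sum>l\<in>F. control_matrix g k l * a l * cnj (a k)))"
proof -
  obtain \<xi> l g0 where gl: "0 < l" "l \<le> 1" "0 < g0" "{\<xi>..\<xi> + l} \<subseteq> {0..2 * pi}"
    "\<forall>x\<in>{\<xi>..\<xi> + l}. g0 \<le> g x"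
    using positive_on_interval by (elim exE conjE)
  have "g0 * l / 4 * inverse (real N) * (l / (16 * N)) ^ (4 * N) * (\<Sum>k\<in>F. (norm (a k))\<^sup>2) \<le>
      Re (\<Sum>k\<in>F. \<Sum>l\<in>F. control_matrix g k l * a l * cnj (a k))"
    if N: "0 < N" and F: "F \<subseteq> {- int N..int N} - {0}" for N F and a :: "int \<Rightarrow> complex"
  proof -
    define c where "c = (\<Sum>k\<in>F. a k * density_coeff g (- k))"
    define q where "q = (\<lambda>k. if k = 0 then - c else a k)"
    have fin: "finite F" using finite_subset[OF F] by simp
    have F0: "0 \<notin> F" using F by auto
    have q: "(\<Sum>k\<in>insert 0 F. q k * wave k x) = (\<Sum>k\<in>F. a k * wave k x) - c" for x
    proof -
      have "(\<Sum>k\<in>F. q k * wave k x) = (\<Sum>k\<in>F. a k * wave k x)"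
        using F0 by (intro sum.cong) (auto simp: q_def)
      thus ?thesis using fin F0 by (simp add: q_def)
    qed
    define J where "J = integral {\<xi>..\<xi> + l} (\<lambda>x. (norm ((\<Sum>k\<in>F. a k * wave k x) - c))\<^sup>2)"
    define \<mu> where "\<mu> = (l / 2) * (l / (16 * N)) ^ (4 * N)"
    have "0 \<le> J" unfolding J_def
      by (intro Henstock_Kurzweil_Integration.integral_nonneg integrable_continuous_real continuous_intros) auto
    have "(norm (a k))\<^sup>2 * \<mu> \<le> J" if "k \<in> F" for k
    proof -
      have "insert 0 F \<subseteq> {- int N..int N}" "k \<in> insert 0 F" using F that by auto
      from coefficient_le_local_integral[OF this N gl(1,2), of q \<xi>]
      moreover have "k \<noteq> 0" using that F0 by auto
      ultimately show ?thesis unfolding q J_def \<mu>_def by (simp add: q_def)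
    qed
    hence "(\<Sum>k\<in>F. (norm (a k))\<^sup>2 * \<mu>) \<le> (\<Sum>k\<in>F. J)" by (rule sum_mono)
    hence "\<mu> * (\<Sum>k\<in>F. (norm (a k))\<^sup>2) \<le> card F * J" by (simp add: sum_distrib_left mult.commute)
    also have "\<dots> \<le> (2 * N) * J"
    proof (rule mult_right_mono[OF _ \<open>0 \<le> J\<close>])
      have "card F \<le> card ({- int N..int N} - {0})" by (rule card_mono[OF _ F]) simp
      also have "\<dots> = 2 * N" by simp
      finally show "real (card F) \<le> real (2 * N)" by simp
    qed
    finally have 1: "\<mu> * (\<Sum>k\<in>F. (norm (a k))\<^sup>2) \<le> (2 * N) * J" .
    have "g0 * J \<le> integral {\<xi>..\<xi> + l} (\<lambda>x. g x * (norm ((\<Sum>k\<in>F. a k * wave k x) - c))\<^sup>2)"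
      unfolding J_def integral_mult_right[symmetric]
      by (rule integral_le)
         (use gl(5) in \<open>auto intro!: integrable_continuous_real continuous_intros continuous_g mult_right_mono\<close>)
    also have "\<dots> \<le> integral {0..2 * pi} (\<lambda>x. g x * (norm ((\<Sum>k\<in>F. a k * wave k x) - c))\<^sup>2)"
      by (rule integral_subset_le[OF gl(4)])
         (auto intro!: integrable_continuous_real continuous_intros continuous_g mult_nonneg_nonneg nonneg)
    also have "\<dots> = Re (\<Sum>k\<in>F. \<Sum>l\<in>F. control_matrix g k l * a l * cnj (a k))"
      unfolding control_form_eq_integral[OF fin] c_def by simp
    finally have 2: "g0 * J \<le> Re (\<Sum>k\<in>F. \<Sum>l\<in>F. control_matrix g k l * a l * cnj (a k))" .
    have "g0 * l / 4 * inverse (real N) * (l / (16 * N)) ^ (4 * N) * (\<Sum>k\<in>F. (norm (a k))\<^sup>2) =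
        g0 / (2 * N) * (\<mu> * (\<Sum>k\<in>F. (norm (a k))\<^sup>2))"
      using N by (simp add: \<mu>_def field_simps)
    also have "\<dots> \<le> g0 / (2 * N) * ((2 * N) * J)"
      using 1 gl(3) by (intro mult_left_mono) auto
    also have "\<dots> = g0 * J" using N by simp
    finally show ?thesis using 2 by linarith
  qed
  thus ?thesis using gl(1-3) by (intro exI[of _ l] exI[of _ "g0 * l / 4"] conjI allI impI) auto
qed

lemma control_matrix_diag: "control_matrix g k k = of_real (1 - (norm (density_coeff g k))\<^sup>2)"
proof -
  have "density_coeff g k * density_coeff g (- k) = of_real ((norm (density_coeff g k))\<^sup>2)"
    unfolding complex_norm_square cnj_density_coeff[OF continuous_g] ..
  thus ?thesis by (simp add: control_matrix_def density_coeff_0[OF continuous_g mass])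
qed

lemma control_matrix_cnj: "cnj (control_matrix g k l) = control_matrix g l k"
  by (simp add: control_matrix_def cnj_density_coeff[OF continuous_g] mult.commute)

lemma control_matrix_0 [simp]: "control_matrix g 0 k = 0" "control_matrix g k 0 = 0"
  by (simp_all add: control_matrix_def density_coeff_0[OF continuous_g mass])

lemma norm_density_coeff_less_1:
  assumes "k \<noteq> 0" shows "norm (density_coeff g k) < 1"
proof -
  obtain l b where lb: "0 < l" "l \<le> 1" "0 < b"
    "\<forall>N F a. 0 < N \<longrightarrow> F \<subseteq> {- int N..int N} - {0} \<longrightarrow>
      b * inverse (real N) * (l / (16 * N)) ^ (4 * N) * (\<Sum>k\<in>F. (norm (a k))\<^sup>2) \<le>
      Re (\<Sum>k\<in>F. \<Sum>l\<in>F. control_matrix g k l * a l * cnj (a k))"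
    using control_form_ge by (elim exE conjE)
  define N where "N = nat \<bar>k\<bar>"
  have N: "0 < N" "{k} \<subseteq> {- int N..int N} - {0}" using assms by (auto simp: N_def)
  have "0 < b * inverse (real N) * (l / (16 * N)) ^ (4 * N)" using lb N by simp
  also have "\<dots> \<le> Re (control_matrix g k k)"
    using lb(4)[rule_format, OF N, of "\<lambda>_. 1"] by simp
  finally have "(norm (density_coeff g k))\<^sup>2 < 1" by (simp add: control_matrix_diag)
  thus ?thesis by (simp add: power_less_one_iff)
qed

text \<open>
  Every single coefficient is smaller than \<open>1\<close> because the diagonal entry \<open>1 - |density_coeff g k|\<^sup>2\<close>
  of the control matrix is positive; uniformity comes from the decay of the coefficients.
\<close>

lemma density_coeff_spectral_gap:
  obtains \<eta> where "0 < \<eta>" "\<eta> \<le> 1" "\<And>k. k \<noteq> 0 \<Longrightarrow> norm (density_coeff g k) \<le> 1 - \<eta>"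
proof -
  obtain C where C: "C > 0" "\<And>k. norm (density_coeff g k) \<le> C * inverse (weight k ^ 1)"
    using density_coeff_decay[OF smooth] by blast
  define M where "M = nat \<lceil>2 * C\<rceil>"
  define X where "X = norm ` density_coeff g ` ({- int M..int M} - {0})"
  define B where "B = Max (insert (1 / 2) X)"
  have fX: "finite X" by (simp add: X_def)
  have "B < 1" unfolding B_def using fX
    by (subst Max_less_iff) (auto simp: X_def norm_density_coeff_less_1)
  moreover have "norm (density_coeff g k) \<le> B" if "k \<noteq> 0" for k
  proof (cases "\<bar>k\<bar> \<le> int M")
    case True
    hence "k \<in> {- int M..int M} - {0}" using that by auto
    hence "norm (density_coeff g k) \<in> X" unfolding X_def by (intro imageI)
    thus ?thesis unfolding B_def using fX by simp
  next
    case False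
    hence "real M \<le> \<bar>of_int k\<bar>" by linarith
    moreover have "2 * C \<le> real M" unfolding M_def by linarith
    ultimately have "2 * C \<le> weight k" by (simp add: weight_def)
    hence "C * inverse (weight k ^ 1) \<le> 1 / 2" by (simp add: field_simps)
    also have "\<dots> \<le> B" unfolding B_def using fX by (intro Max_ge) auto
    finally show ?thesis using C(2)[of k] by linarith
  qed
  moreover have "1 / 2 \<le> B" unfolding B_def using fX by (intro Max_ge) auto
  ultimately show thesis using that[of "1 - B"] by simp
qed

text \<open>
  The rank-one part decays off the diagonal as well, by \<open>weight (k - l) \<le> weight k * weight l\<close>.
\<close>

lemma control_matrix_decay:
  obtains C where "C > 0" "\<And>k l. norm (control_matrix g k l) \<le> C * inverse (weight (k - l) ^ p)"
proof -
  obtain C where C: "C > 0" "\<And>k. norm (density_coeff g k) \<le> C * inverse (weight k ^ p)"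
    using density_coeff_decay[OF smooth] by blast
  have "norm (control_matrix g k l) \<le> (C + C * C) * inverse (weight (k - l) ^ p)" for k l
  proof -
    have "norm (control_matrix g k l) \<le> norm (density_coeff g (k - l)) + norm (density_coeff g k) * norm (density_coeff g (- l))"
      unfolding control_matrix_def norm_mult[symmetric] by (rule norm_triangle_ineq4)
    also have "\<dots> \<le> C * inverse (weight (k - l) ^ p) + (C * inverse (weight k ^ p)) * (C * inverse (weight (- l) ^ p))"
      using C(1) by (intro add_mono mult_mono C(2)) auto
    also have "\<dots> = C * inverse (weight (k - l) ^ p) + C * C * inverse ((weight k * weight (- l)) ^ p)"
      by (simp add: power_mult_distrib mult_ac)
    also have "inverse ((weight k * weight (- l)) ^ p) \<le> inverse (weight (k - l) ^ p)"
      using weight_add_le[of k "- l"] by (intro le_imp_inverse_le power_mono) auto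
    hence "C * inverse (weight (k - l) ^ p) + C * C * inverse ((weight k * weight (- l)) ^ p)
        \<le> C * inverse (weight (k - l) ^ p) + C * C * inverse (weight (k - l) ^ p)"
      using C(1) by (intro add_left_mono mult_left_mono) auto
    finally show ?thesis by (simp add: distrib_right)
  qed
  moreover have "0 < C + C * C" using C(1) by (intro add_pos_pos mult_pos_pos)
  ultimately show thesis using that[of "C + C * C"] by blast
qed

end

section \<open>The time profile\<close>

text \<open>
  A time profile whose Fourier transform is explicit: a recurrence in \<open>n\<close> makes it geometrically
  small in \<open>n\<close> beyond frequencies of order \<open>n/T\<close>.
\<close>

definition profile :: "real \<Rightarrow> nat \<Rightarrow> real \<Rightarrow> real" where
  "profile T n t = sin (pi * t / T) ^ (2 * n)"

definition profile_ft :: "real \<Rightarrow> nat \<Rightarrow> real \<Rightarrow> complex" where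
  "profile_ft T n \<mu> = integral {0..T} (\<lambda>t. profile T n t * cis (\<mu> * t))"

definition profile_mass :: "real \<Rightarrow> nat \<Rightarrow> real" where
  "profile_mass T n = integral {0..T} (profile T n)"

lemma profile_nonneg: "0 \<le> profile T n t" and profile_le_1: "profile T n t \<le> 1"
proof -
  have e: "profile T n t = (sin (pi * t / T) ^ 2) ^ n" by (simp add: profile_def power_mult)
  show "0 \<le> profile T n t" unfolding e by simp
  show "profile T n t \<le> 1" unfolding e
    by (rule power_le_one) (simp_all add: abs_square_le_1)
qed

lemma continuous_on_profile [continuous_intros]: "continuous_on S (profile T n)"
  unfolding profile_def divide_inverse by (intro continuous_intros)

lemma continuous_on_cis_linear [continuous_intros]:
  "continuous_on S (\<lambda>t::real. cis (\<mu> * t))"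
  by (intro continuous_on_cis continuous_intros)

lemma profile_ft_0: "profile_ft T n 0 = of_real (profile_mass T n)"
proof -
  have "((\<lambda>t. complex_of_real (profile T n t)) has_integral of_real (profile_mass T n)) {0..T}"
    unfolding profile_mass_def
    by (intro has_integral_of_real integrable_integral integrable_continuous_real continuous_intros)
  thus ?thesis by (simp add: profile_ft_def integral_unique)
qed

lemma profile_mass_pos:
  assumes "T > 0" shows "0 < profile_mass T n"
proof -
  have "0 \<le> profile_mass T n" unfolding profile_mass_def
    by (intro Henstock_Kurzweil_Integration.integral_nonneg integrable_continuous_real continuous_intros)
       (simp add: profile_nonneg)
  moreover have "profile_mass T n \<noteq> 0"
  proof
    assume "profile_mass T n = 0"
    hence "(profile T n has_integral 0) (cbox 0 T)"
      unfolding profile_mass_def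
      using integrable_integral[OF integrable_continuous_real[OF continuous_on_profile[of "{0..T}" T n]]] by simp
    hence "profile T n (T / 2) = 0"
      by (rule has_integral_0_cbox_imp_0[rotated 2])
         (use assms in \<open>auto intro!: continuous_intros profile_nonneg\<close>)
    moreover have "pi * (T / 2) / T = pi / 2" using assms by simp
    ultimately show False by (simp only: profile_def sin_pi_half power_one)
  qed
  ultimately show ?thesis by simp
qed

text \<open>
  Two integrations by parts, using that the second derivative of a power of the sine is a
  combination of this power and of the power lower by two. The boundary terms vanish because the
  power on the left is at least \<open>2\<close>.
\<close>

lemma profile_ft_recurrence:
  assumes T: "T > 0"
  shows "of_real (\<mu>\<^sup>2 - (2 * real (n + 1) * (pi / T))\<^sup>2) * profile_ft T (Suc n) \<mu>
     = - (of_real (2 * real (n + 1) * real (2 * n + 1) * (pi / T)\<^sup>2) * profile_ft T n \<mu>)"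
proof -
  define \<omega> where "\<omega> = pi / T"
  define S C where "S = (\<lambda>t. sin (\<omega> * t))" and "C = (\<lambda>t. cos (\<omega> * t))"
  define m where "m = real (2 * n + 2)"
  have prof: "profile T j t = S t ^ (2 * j)" for j t
    by (simp add: profile_def S_def \<omega>_def)
  define G where "G = (\<lambda>t. of_real (m * \<omega> * (S t ^ (2 * n + 1) * C t)) * cis (\<mu> * t)
      - \<i> * of_real \<mu> * (of_real (S t ^ (2 * n + 2)) * cis (\<mu> * t)))"
  define G' where "G' = (\<lambda>t. of_real (m * (2 * n + 1) * \<omega>\<^sup>2) * (of_real (S t ^ (2 * n)) * cis (\<mu> * t))
      + of_real (\<mu>\<^sup>2 - m\<^sup>2 * \<omega>\<^sup>2) * (of_real (S t ^ (2 * n + 2)) * cis (\<mu> * t)))"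
  have S': "(S has_real_derivative \<omega> * C t) (at t within X)"
    and C': "(C has_real_derivative - \<omega> * S t) (at t within X)" for t X
    unfolding S_def C_def by (auto intro!: derivative_eq_intros)
  have dS: "((\<lambda>t. S t ^ (2 * n + 2)) has_real_derivative m * \<omega> * (S t ^ (2 * n + 1) * C t)) (at t within X)" for t X
  proof -
    have "((\<lambda>t. S t ^ Suc (2 * n + 1)) has_real_derivative
        (1 + real (2 * n + 1)) * (\<omega> * C t * S t ^ (2 * n + 1))) (at t within X)"
      by (rule DERIV_power_Suc[OF S'])
    moreover have "(1 + real (2 * n + 1)) * (\<omega> * C t * S t ^ (2 * n + 1)) = m * \<omega> * (S t ^ (2 * n + 1) * C t)"
      by (simp add: m_def)
    moreover have "Suc (2 * n + 1) = 2 * n + 2" by simp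
    ultimately show ?thesis by (simp only:)
  qed
  have dSC: "((\<lambda>t. m * \<omega> * (S t ^ (2 * n + 1) * C t)) has_real_derivative
      m * \<omega>\<^sup>2 * ((2 * n + 1) * S t ^ (2 * n) * (C t)\<^sup>2 - S t ^ (2 * n + 2))) (at t within X)" for t X
  proof -
    have "((\<lambda>t. m * \<omega> * (S t ^ Suc (2 * n) * C t)) has_real_derivative
        m * \<omega> * ((1 + real (2 * n)) * (\<omega> * C t * S t ^ (2 * n)) * C t + (- \<omega> * S t) * S t ^ Suc (2 * n))) (at t within X)"
      by (intro DERIV_cmult DERIV_mult DERIV_power_Suc S' C')
    moreover have "m * \<omega> * ((1 + real (2 * n)) * (\<omega> * C t * S t ^ (2 * n)) * C t + (- \<omega> * S t) * S t ^ Suc (2 * n)) =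
        m * \<omega>\<^sup>2 * ((2 * n + 1) * S t ^ (2 * n) * (C t)\<^sup>2 - S t ^ (2 * n + 2))"
      by (simp add: algebra_simps power2_eq_square)
    moreover have "Suc (2 * n) = 2 * n + 1" by simp
    ultimately show ?thesis by (simp only:)
  qed
  have dcis: "((\<lambda>t. cis (\<mu> * t)) has_vector_derivative \<i> * of_real \<mu> * cis (\<mu> * t)) (at t within X)" for t X
  proof -
    have "((\<lambda>z. exp (\<i> * of_real \<mu> * z)) has_field_derivative
        \<i> * of_real \<mu> * exp (\<i> * of_real \<mu> * complex_of_real t)) (at (complex_of_real t))"
      by (auto intro!: derivative_eq_intros)
    from has_vector_derivative_real_field[OF this, of X] show ?thesis
      by (simp add: cis_conv_exp mult_ac)
  qed
  have "(G has_vector_derivative G' t) (at t within X)" for t X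
  proof -
    have "(G has_vector_derivative
       ((of_real (m * \<omega> * (S t ^ (2 * n + 1) * C t)) * (\<i> * of_real \<mu> * cis (\<mu> * t)) +
        of_real (m * \<omega>\<^sup>2 * ((2 * n + 1) * S t ^ (2 * n) * (C t)\<^sup>2 - S t ^ (2 * n + 2))) * cis (\<mu> * t)) -
       \<i> * of_real \<mu> * (of_real (S t ^ (2 * n + 2)) * (\<i> * of_real \<mu> * cis (\<mu> * t)) +
        of_real (m * \<omega> * (S t ^ (2 * n + 1) * C t)) * cis (\<mu> * t)))) (at t within X)"
      unfolding G_def
      by (intro has_vector_derivative_diff has_vector_derivative_mult has_vector_derivative_mult_right
          has_vector_derivative_of_real dS dSC dcis)
    also have "(C t)\<^sup>2 = 1 - (S t)\<^sup>2" unfolding C_def S_def by (simp add: cos_squared_eq)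
    also have "m * \<omega>\<^sup>2 * ((2 * n + 1) * S t ^ (2 * n) * (1 - (S t)\<^sup>2) - S t ^ (2 * n + 2)) =
        m * (2 * n + 1) * \<omega>\<^sup>2 * S t ^ (2 * n) - m\<^sup>2 * \<omega>\<^sup>2 * S t ^ (2 * n + 2)"
      by (simp add: m_def power2_eq_square algebra_simps)
    finally show ?thesis
      by (rule has_vector_derivative_eq_rhs)
         (simp add: G'_def algebra_simps power2_eq_square)
  qed
  hence "(G' has_integral (G T - G 0)) {0..T}"
    using T by (intro fundamental_theorem_of_calculus) auto
  moreover have "S T = 0" "S 0 = 0" using T by (simp_all add: S_def \<omega>_def)
  hence "G T - G 0 = 0" by (simp add: G_def)
  ultimately have 0: "(G' has_integral 0) {0..T}" by simp
  have ft: "((\<lambda>t. of_real (S t ^ (2 * j)) * cis (\<mu> * t)) has_integral profile_ft T j \<mu>) {0..T}" for j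
    unfolding profile_ft_def prof[symmetric]
    by (intro integrable_integral integrable_continuous_real continuous_intros)
  have "(G' has_integral (of_real (m * (2 * n + 1) * \<omega>\<^sup>2) * profile_ft T n \<mu>
      + of_real (\<mu>\<^sup>2 - m\<^sup>2 * \<omega>\<^sup>2) * profile_ft T (Suc n) \<mu>)) {0..T}"
    unfolding G'_def using ft[of "Suc n"]
    by (intro has_integral_add has_integral_mult_right ft) simp
  from has_integral_unique[OF this 0]
  have "of_real (\<mu>\<^sup>2 - m\<^sup>2 * \<omega>\<^sup>2) * profile_ft T (Suc n) \<mu> = - (of_real (m * (2 * n + 1) * \<omega>\<^sup>2) * profile_ft T n \<mu>)"
    by (simp add: eq_neg_iff_add_eq_0 add.commute)
  moreover have "m\<^sup>2 * \<omega>\<^sup>2 = (2 * real (n + 1) * (pi / T))\<^sup>2"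
    unfolding power_mult_distrib[symmetric] by (simp add: m_def \<omega>_def)
  moreover have "m * (2 * n + 1) * \<omega>\<^sup>2 = 2 * real (n + 1) * real (2 * n + 1) * (pi / T)\<^sup>2"
    by (simp add: m_def \<omega>_def)
  ultimately show ?thesis by (simp only:)
qed

text \<open>
  Comparing the recurrence at \<open>\<mu>\<close> with the recurrence at \<open>0\<close>, one step multiplies the transform,
  normalised by the mass, by \<open>x / (\<mu>\<^sup>2 - x)\<close> with \<open>4x \<le> \<mu>\<^sup>2\<close>.
\<close>

lemma profile_ft_bound:
  assumes T: "T > 0" and "n \<le> m" and \<mu>: "4 * m * (pi / T) \<le> \<bar>\<mu>\<bar>"
  shows "norm (profile_ft T n \<mu>) \<le> profile_mass T n / 3 ^ n"
  using assms(2)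
proof (induction n)
  case 0
  have "norm (profile_ft T 0 \<mu>) \<le> integral {0..T} (\<lambda>t. 1)"
    unfolding profile_ft_def
    by (rule integral_norm_bound_integral)
       (auto intro!: integrable_continuous_real continuous_intros simp: norm_mult profile_def)
  also have "(\<lambda>t. 1) = profile T 0" by (simp add: fun_eq_iff profile_def)
  also have "integral {0..T} (profile T 0) = profile_mass T 0" by (simp add: profile_mass_def)
  finally show ?case by simp
next
  case (Suc n)
  define x where "x = (2 * real (n + 1) * (pi / T))\<^sup>2"
  define y where "y = 2 * real (n + 1) * real (2 * n + 1) * (pi / T)\<^sup>2"
  have pos: "0 < x" "0 < y" unfolding x_def y_def using T by (auto intro!: mult_pos_pos add_pos_nonneg)
  have "4 * real (Suc n) * (pi / T) \<le> 4 * m * (pi / T)"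
    using Suc.prems T by (intro mult_right_mono mult_left_mono) auto
  hence "2 * (2 * (n + 1) * (pi / T)) \<le> \<bar>\<mu>\<bar>" using \<mu> by (simp add: mult_ac)
  hence "(2 * (2 * (n + 1) * (pi / T)))\<^sup>2 \<le> \<bar>\<mu>\<bar>\<^sup>2" by (rule power_mono) (use T in auto)
  hence 4: "4 * x \<le> \<mu>\<^sup>2" unfolding x_def power_mult_distrib[of 2] by simp
  have rec: "of_real (\<nu>\<^sup>2 - x) * profile_ft T (Suc n) \<nu> = - (of_real y * profile_ft T n \<nu>)" for \<nu>
    unfolding x_def y_def by (rule profile_ft_recurrence[OF T])
  have "complex_of_real (x * profile_mass T (Suc n)) = of_real (y * profile_mass T n)"
    using rec[of 0] by (simp add: profile_ft_0)
  hence r0: "x * profile_mass T (Suc n) = y * profile_mass T n" by (simp only: of_real_eq_iff)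
  have "norm (of_real (\<mu>\<^sup>2 - x) * profile_ft T (Suc n) \<mu>) = norm (- (of_real y * profile_ft T n \<mu>))"
    by (rule arg_cong[OF rec])
  hence "\<bar>\<mu>\<^sup>2 - x\<bar> * norm (profile_ft T (Suc n) \<mu>) = y * norm (profile_ft T n \<mu>)"
    using pos by (simp add: norm_mult del: of_real_diff)
  hence "(\<mu>\<^sup>2 - x) * norm (profile_ft T (Suc n) \<mu>) = y * norm (profile_ft T n \<mu>)"
    using 4 pos by simp
  also have "\<dots> \<le> y * (profile_mass T n / 3 ^ n)"
    using Suc pos by (intro mult_left_mono) auto
  also have "\<dots> = x * profile_mass T (Suc n) / 3 ^ n" using r0 by simp
  finally have "(\<mu>\<^sup>2 - x) * norm (profile_ft T (Suc n) \<mu>) \<le> x * profile_mass T (Suc n) / 3 ^ n" .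
  moreover have "3 * x * norm (profile_ft T (Suc n) \<mu>) \<le> (\<mu>\<^sup>2 - x) * norm (profile_ft T (Suc n) \<mu>)"
    using 4 by (intro mult_right_mono) auto
  ultimately have "x * (3 * norm (profile_ft T (Suc n) \<mu>)) \<le> x * (profile_mass T (Suc n) / 3 ^ n)"
    by simp
  hence "3 * norm (profile_ft T (Suc n) \<mu>) \<le> profile_mass T (Suc n) / 3 ^ n"
    using pos by (simp only: mult_le_cancel_left_pos)
  thus ?case by (simp add: field_simps)
qed

lemma norm_profile_ft_le:
  assumes "T > 0" shows "norm (profile_ft T n \<mu>) \<le> profile_mass T n"
  unfolding profile_ft_def profile_mass_def
  by (rule integral_norm_bound_integral)
     (auto intro!: integrable_continuous_real continuous_intros simp: norm_mult profile_nonneg)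

lemma cnj_profile_ft: "cnj (profile_ft T n \<mu>) = profile_ft T n (- \<mu>)"
proof -
  have "((\<lambda>t. cnj (profile T n t * cis (\<mu> * t))) has_integral cnj (profile_ft T n \<mu>)) {0..T}"
    using has_integral_linear[OF integrable_integral[OF integrable_continuous_real] bounded_linear_cnj,
        of 0 T "\<lambda>t. profile T n t * cis (\<mu> * t)"]
    by (simp add: profile_ft_def o_def continuous_intros)
  thus ?thesis by (simp add: profile_ft_def cis_cnj integral_unique)
qed

section \<open>Gaps between the frequencies\<close>

definition dispersion :: "real \<Rightarrow> int \<Rightarrow> real" where
  "dispersion \<alpha> k = (of_int k)\<^sup>2 * (\<alpha> * of_int (sgn k) - of_int k)"

lemma dispersion_minus: "dispersion \<alpha> (- k) = - dispersion \<alpha> k"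
  by (simp add: dispersion_def sgn_minus algebra_simps)

lemma dispersion_nonneg_arg: "0 \<le> k \<Longrightarrow> dispersion \<alpha> k = (of_int k)\<^sup>2 * (\<alpha> - of_int k)"
  by (cases "k = 0") (auto simp: dispersion_def)

text \<open>
  For \<open>0 \<le> l\<close> the difference factors as \<open>(k - l)(k\<^sup>2 + kl + l\<^sup>2 - \<alpha>(k + l))\<close>, and the second factor
  is at least \<open>k\<^sup>2/2\<close> since \<open>\<alpha> \<le> k/2\<close>. For negative \<open>l\<close> the two cubic terms reinforce each other
  and the quadratic terms are too small to compensate them.
\<close>

lemma dispersion_gap_pos:
  assumes \<alpha>: "0 < \<alpha>" "\<alpha> \<le> N / 2" and N: "1 \<le> N" and k: "N < of_int k" and l: "\<bar>l\<bar> \<le> k" "l \<noteq> k"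
  shows "N\<^sup>2 / 2 \<le> \<bar>dispersion \<alpha> k - dispersion \<alpha> l\<bar>"
proof -
  define x y where "x = real_of_int k" and "y = real_of_int l"
  have "1 < k" using N k by linarith
  hence x: "2 \<le> x" "N < x" "\<alpha> \<le> x / 2" using k \<alpha> by (auto simp: x_def)
  have "N\<^sup>2 \<le> x\<^sup>2" by (intro power_mono) (use x N in auto)
  have dk: "dispersion \<alpha> k = x\<^sup>2 * (\<alpha> - x)"
    using \<open>1 < k\<close> by (simp add: dispersion_nonneg_arg x_def)
  show ?thesis
  proof (cases "0 \<le> l")
    case True
    hence y: "0 \<le> y" "y + 1 \<le> x" using l by (auto simp: x_def y_def)
    have dl: "dispersion \<alpha> l = y\<^sup>2 * (\<alpha> - y)" using True by (simp add: dispersion_nonneg_arg y_def)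
    have "\<alpha> * (x + y) \<le> x / 2 * (x + y)" using x y by (intro mult_right_mono) auto
    also have "\<dots> = x * x / 2 + x * y / 2" by (simp add: algebra_simps)
    finally have "\<alpha> * (x + y) \<le> x * x / 2 + x * y / 2" .
    moreover have "0 \<le> x * y" "0 \<le> y * y" using x y by simp_all
    ultimately have b: "x\<^sup>2 / 2 \<le> x\<^sup>2 + x * y + y\<^sup>2 - \<alpha> * (x + y)"
      unfolding power2_eq_square by linarith
    have "1 * (x\<^sup>2 / 2) \<le> (x - y) * (x\<^sup>2 + x * y + y\<^sup>2 - \<alpha> * (x + y))"
      using y b by (intro mult_mono) auto
    also have "\<dots> = dispersion \<alpha> l - dispersion \<alpha> k"
      unfolding dk dl by (simp add: power2_eq_square algebra_simps)
    finally show ?thesis using \<open>N\<^sup>2 \<le> x\<^sup>2\<close> by linarith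
  next
    case False
    define z where "z = - y"
    have z: "0 < z" "z \<le> x" using False l by (auto simp: x_def y_def z_def)
    have dl: "dispersion \<alpha> l = z\<^sup>2 * (z - \<alpha>)"
      using False by (simp add: dispersion_def z_def y_def algebra_simps)
    have "z\<^sup>2 * (\<alpha> - z) \<le> (x / 2)\<^sup>2 * (x / 2)"
    proof (cases "z \<le> \<alpha>")
      case True
      thus ?thesis using z x \<alpha> by (intro mult_mono power_mono) auto
    next
      case False
      hence "z\<^sup>2 * (\<alpha> - z) \<le> 0" by (intro mult_nonneg_nonpos) auto
      also have "0 \<le> (x / 2)\<^sup>2 * (x / 2)" using x by simp
      finally show ?thesis .
    qed
    moreover have "x\<^sup>2 * (x / 2) \<le> x\<^sup>2 * (x - \<alpha>)" using x by (intro mult_left_mono) auto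
    moreover have "dispersion \<alpha> l - dispersion \<alpha> k = x\<^sup>2 * (x - \<alpha>) - z\<^sup>2 * (\<alpha> - z)"
      unfolding dk dl by (simp add: algebra_simps)
    ultimately have "x\<^sup>2 * (x / 2) - (x / 2)\<^sup>2 * (x / 2) \<le> dispersion \<alpha> l - dispersion \<alpha> k" by linarith
    moreover have "x\<^sup>2 * (x / 2) - (x / 2)\<^sup>2 * (x / 2) = x\<^sup>2 * (3 / 8 * x)"
      by (simp add: power2_eq_square algebra_simps)
    moreover have "x\<^sup>2 * (1 / 2) \<le> x\<^sup>2 * (3 / 8 * x)" using x by (intro mult_left_mono) auto
    ultimately show ?thesis using \<open>N\<^sup>2 \<le> x\<^sup>2\<close> by linarith
  qed
qed

lemma dispersion_gap:
  assumes "0 < \<alpha>" "\<alpha> \<le> N / 2" "1 \<le> N" and kl: "N < \<bar>of_int k\<bar>" "l \<noteq> k"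
  shows "N\<^sup>2 / 2 \<le> \<bar>dispersion \<alpha> k - dispersion \<alpha> l\<bar>"
proof -
  have 1: "N\<^sup>2 / 2 \<le> \<bar>dispersion \<alpha> k - dispersion \<alpha> l\<bar>"
    if "N < of_int k" "\<bar>l\<bar> \<le> \<bar>k\<bar>" "l \<noteq> k" for k l
    using dispersion_gap_pos[OF assms(1-3), of k l] that assms(3) by auto
  have 2: "N\<^sup>2 / 2 \<le> \<bar>dispersion \<alpha> k - dispersion \<alpha> l\<bar>"
    if "N < \<bar>of_int k\<bar>" "\<bar>l\<bar> \<le> \<bar>k\<bar>" "l \<noteq> k" for k l
  proof (cases "0 \<le> k")
    case True
    thus ?thesis using 1[of k l] that by simp
  next
    case False
    hence "N\<^sup>2 / 2 \<le> \<bar>dispersion \<alpha> (- k) - dispersion \<alpha> (- l)\<bar>"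
      using that by (intro 1) auto
    thus ?thesis by (simp add: dispersion_minus abs_minus_commute)
  qed
  show ?thesis
  proof (cases "\<bar>l\<bar> \<le> \<bar>k\<bar>")
    case True
    thus ?thesis using 2 kl by blast
  next
    case False
    hence "N < \<bar>of_int l\<bar>" using kl by linarith
    thus ?thesis using 2[of l k] False kl by (simp add: abs_minus_commute)
  qed
qed

text \<open>
  With \<open>p = k + l\<close> and \<open>d = k - l\<close> the difference of the frequencies of two positive modes is
  \<open>d (p (\<alpha> - 3p/4) - d\<^sup>2/4)\<close>. If it is bounded while \<open>d\<close> is bounded, then for large \<open>\<alpha>\<close> the factor
  \<open>\<alpha> - 3p/4\<close> has to be small: a near-resonance takes place around the critical
  point \<open>2\<alpha>/3\<close> of the dispersion relation and \<open>p\<close> is the integer closest to \<open>4\<alpha>/3\<close>.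
\<close>

lemma near_resonance_pos:
  assumes K: "0 \<le> K" and R: "0 < R" and \<alpha>: "4 * R + 4 * K\<^sup>2 \<le> \<alpha>" "2 * M + K \<le> \<alpha>" "R + K ^ 3 \<le> \<alpha>"
    and kl: "0 < k" "l \<noteq> 0" "l \<noteq> k" "\<bar>of_int (k - l)\<bar> \<le> K"
    and res: "\<bar>dispersion \<alpha> k - dispersion \<alpha> l\<bar> < R"
  shows "0 < l \<and> M \<le> of_int k \<and> \<bar>of_int (k + l) - 4 * \<alpha> / 3\<bar> < 1 / 2"
proof -
  define x y where "x = real_of_int k" and "y = real_of_int l"
  have x: "1 \<le> x" using kl by (simp add: x_def)
  have dk: "dispersion \<alpha> k = x\<^sup>2 * (\<alpha> - x)"
    using kl by (simp add: dispersion_nonneg_arg x_def)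
  have "0 \<le> K\<^sup>2" "0 \<le> K ^ 3" using K by auto
  define Q where "Q = K\<^sup>2"
  have aQ: "4 * R + 4 * Q \<le> \<alpha>" and Q0: "0 \<le> Q" using \<alpha>(1) by (simp_all add: Q_def)
  hence a0: "0 < \<alpha>" using R by linarith
  have "0 < l"
  proof (rule ccontr)
    assume "\<not> 0 < l"
    hence l: "l < 0" using kl by simp
    define z where "z = - y"
    have z: "1 \<le> z" "x + z \<le> K" using l kl by (auto simp: x_def y_def z_def)
    have dl: "dispersion \<alpha> l = z\<^sup>2 * (z - \<alpha>)"
      using l by (simp add: dispersion_def z_def y_def algebra_simps)
    have "1 \<le> x\<^sup>2" "1 \<le> z\<^sup>2" using x z by (auto simp: one_le_power)
    hence "\<alpha> * 2 \<le> \<alpha> * (x\<^sup>2 + z\<^sup>2)" using a0 by (intro mult_left_mono) auto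
    moreover have "x ^ 3 \<le> K ^ 3" "z ^ 3 \<le> K ^ 3" using x z by (auto intro!: power_mono)
    moreover have "dispersion \<alpha> k - dispersion \<alpha> l = \<alpha> * (x\<^sup>2 + z\<^sup>2) - x ^ 3 - z ^ 3"
      unfolding dk dl by (simp add: power2_eq_square power3_eq_cube algebra_simps)
    ultimately have "R \<le> dispersion \<alpha> k - dispersion \<alpha> l" using \<alpha>(3) R by linarith
    thus False using res by linarith
  qed
  hence y: "1 \<le> y" by (simp add: y_def)
  define p d where "p = x + y" and "d = x - y"
  have "1 \<le> \<bar>k - l\<bar>" using kl by linarith
  hence "1 \<le> \<bar>real_of_int (k - l)\<bar>" by linarith
  hence d: "1 \<le> \<bar>d\<bar>" "\<bar>d\<bar> \<le> K" using kl by (auto simp: d_def x_def y_def)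
  define w where "w = p * (\<alpha> - 3 * p / 4)"
  have dl: "dispersion \<alpha> l = y\<^sup>2 * (\<alpha> - y)" using \<open>0 < l\<close> by (simp add: dispersion_nonneg_arg y_def)
  have "dispersion \<alpha> k - dispersion \<alpha> l = d * (w - d\<^sup>2 / 4)"
    unfolding dk dl w_def p_def d_def by (simp add: power2_eq_square field_simps)
  hence w1: "\<bar>d\<bar> * \<bar>w - d\<^sup>2 / 4\<bar> < R" using res by (simp add: abs_mult)
  have w2: "1 * \<bar>w - d\<^sup>2 / 4\<bar> \<le> \<bar>d\<bar> * \<bar>w - d\<^sup>2 / 4\<bar>"
    using d by (intro mult_right_mono) auto
  have "\<bar>w - d\<^sup>2 / 4\<bar> < R" using le_less_trans[OF w2 w1] by simp
  moreover have "d\<^sup>2 \<le> Q" using power_mono[OF d(2), of 2] by (simp add: Q_def)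
  moreover have "0 \<le> d\<^sup>2" by simp
  ultimately have *: "\<bar>w\<bar> < R + Q" by linarith
  have p2: "2 \<le> p" using x y by (simp add: p_def)
  have "\<alpha> < p"
  proof (rule ccontr)
    assume "\<not> \<alpha> < p"
    hence "2 * (\<alpha> / 4) \<le> w" unfolding w_def using p2 a0 by (intro mult_mono) auto
    thus False using * aQ a0 by linarith
  qed
  have "\<bar>\<alpha> - 3 * p / 4\<bar> < 1 / 4"
  proof (rule ccontr)
    assume "\<not> ?thesis"
    hence "p * (1 / 4) \<le> p * \<bar>\<alpha> - 3 * p / 4\<bar>" using p2 by (intro mult_left_mono) auto
    also have "\<dots> = \<bar>w\<bar>" using p2 by (simp add: abs_mult w_def)
    finally show False using * aQ \<open>\<alpha> < p\<close> by linarith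
  qed
  hence "\<bar>p - 4 * \<alpha> / 3\<bar> < 1 / 2" by linarith
  moreover have "2 * x = p + d" by (simp add: p_def d_def)
  hence "M \<le> x" using d(2) \<open>\<alpha> < p\<close> \<alpha>(2) by linarith
  ultimately show ?thesis using \<open>0 < l\<close> by (simp add: p_def x_def y_def)
qed

definition resonant :: "real \<Rightarrow> real \<Rightarrow> real \<Rightarrow> int \<Rightarrow> int \<Rightarrow> bool" where
  "resonant K R \<alpha> k l \<longleftrightarrow> l \<noteq> 0 \<and> l \<noteq> k \<and> \<bar>of_int (k - l)\<bar> \<le> K \<and> \<bar>dispersion \<alpha> k - dispersion \<alpha> l\<bar> < R"

text \<open>
  Since \<open>k + l\<close> is determined up to sign by \<open>\<alpha>\<close>, a mode has at most one resonant partner, and only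
  modes of high frequency have one.
\<close>

lemma resonant_unique:
  fixes K R M :: real
  assumes K: "0 \<le> K" and R: "0 < R"
  shows "\<exists>A. \<forall>\<alpha>\<ge>A. \<forall>k l l'. k \<noteq> 0 \<longrightarrow> resonant K R \<alpha> k l \<longrightarrow> resonant K R \<alpha> k l' \<longrightarrow>
    l = l' \<and> M \<le> \<bar>of_int k\<bar>"
proof (intro exI allI impI)
  fix \<alpha> :: real and k l l' :: int
  assume "Max {4 * R + 4 * K\<^sup>2, 2 * M + K, R + K ^ 3} \<le> \<alpha>" and k: "k \<noteq> 0"
    and l: "resonant K R \<alpha> k l" and l': "resonant K R \<alpha> k l'"
  hence a: "4 * R + 4 * K\<^sup>2 \<le> \<alpha>" "2 * M + K \<le> \<alpha>" "R + K ^ 3 \<le> \<alpha>" by auto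
  have pos: "0 < j \<and> M \<le> of_int k \<and> \<bar>of_int (k + j) - 4 * \<alpha> / 3\<bar> < 1 / 2"
    if "0 < k" "resonant K R \<alpha> k j" for k j
    using that by (intro near_resonance_pos[OF K R a]) (auto simp: resonant_def)
  have close: "l = l'"
    if "\<bar>real_of_int (k + l) - 4 * \<alpha> / 3\<bar> < 1 / 2" "\<bar>real_of_int (k + l') - 4 * \<alpha> / 3\<bar> < 1 / 2" for k l l'
  proof -
    have "\<bar>real_of_int (k + l) - real_of_int (k + l')\<bar> < 1" using that by linarith
    thus ?thesis by linarith
  qed
  show "l = l' \<and> M \<le> \<bar>of_int k\<bar>"
  proof (cases "0 < k")
    case True
    hence "M \<le> of_int k" using pos[OF True l] by simp
    moreover have "l = l'" using pos[OF True l] pos[OF True l'] by (intro close[of k]) auto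
    ultimately show ?thesis by linarith
  next
    case False
    have neg: "resonant K R \<alpha> (- k) (- j)" if "resonant K R \<alpha> k j" for j
      using that by (auto simp: resonant_def dispersion_minus abs_minus_commute)
    have k': "0 < - k" using k False by simp
    have "M \<le> of_int (- k)" using pos[OF k' neg[OF l]] by blast
    moreover have "- l = - l'" using pos[OF k' neg[OF l]] pos[OF k' neg[OF l']]
      by (intro close[of "- k"]) blast+
    ultimately show ?thesis by simp
  qed
qed

section \<open>Coercivity of the Gramian\<close>

text \<open>
  Gershgorin's argument in which the block \<open>F\<close> is treated as a single entry: outside the block,
  \<open>|A k l a l a k|\<close> is at most \<open>|A k l| (|a k|\<^sup>2 + |a l|\<^sup>2) / 2\<close>, and the symmetry of the moduli turns
  the sum of these terms into row sums.
\<close>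

lemma block_dominant_form_ge:
  fixes A :: "'i \<Rightarrow> 'i \<Rightarrow> complex"
  assumes S: "finite S" and sym: "\<And>k l. norm (A k l) = norm (A l k)"
    and high: "\<And>k. k \<in> S - F \<Longrightarrow> c + (\<Sum>l\<in>S - {k}. norm (A k l)) \<le> Re (A k k)"
    and low: "\<mu> * (\<Sum>k\<in>S \<inter> F. (norm (a k))\<^sup>2) \<le> Re (\<Sum>k\<in>S \<inter> F. \<Sum>l\<in>S \<inter> F. A k l * a l * cnj (a k))"
    and coupling: "\<And>k. k \<in> S \<inter> F \<Longrightarrow> c + (\<Sum>l\<in>S - F. norm (A k l)) \<le> \<mu>"
  shows "c * (\<Sum>k\<in>S. (norm (a k))\<^sup>2) \<le> Re (\<Sum>k\<in>S. \<Sum>l\<in>S. A k l * a l * cnj (a k))"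
proof -
  define B where "B = (\<lambda>k l. if k = l \<or> k \<in> F \<and> l \<in> F then 0 else norm (A k l))"
  define X where "X = (\<lambda>k l. if k \<in> F \<and> l \<in> F then Re (A k l * a l * cnj (a k)) else 0)"
  define D where "D = (\<lambda>k l. if k = l \<and> k \<notin> F then Re (A k k) * (norm (a k))\<^sup>2 else 0)"
  have entry: "X k l + D k l - B k l * ((norm (a k))\<^sup>2 + (norm (a l))\<^sup>2) / 2 \<le> Re (A k l * a l * cnj (a k))" for k l
  proof -
    consider "k \<in> F \<and> l \<in> F" | "k = l" "k \<notin> F" | "k \<noteq> l" "\<not> (k \<in> F \<and> l \<in> F)" by blast
    thus ?thesis
    proof cases
      case 2
      have "A k k * a k * cnj (a k) = A k k * of_real ((norm (a k))\<^sup>2)"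
        by (simp only: complex_norm_square mult.assoc)
      hence "Re (A k k * a k * cnj (a k)) = Re (A k k * of_real ((norm (a k))\<^sup>2))" by (rule arg_cong)
      also have "\<dots> = Re (A k k) * (norm (a k))\<^sup>2" by (simp del: of_real_power)
      finally have "Re (A k k * a k * cnj (a k)) = Re (A k k) * (norm (a k))\<^sup>2" .
      thus ?thesis using 2 by (simp add: X_def D_def B_def)
    next
      case 3
      have "- Re (A k l * a l * cnj (a k)) \<le> norm (A k l) * (norm (a l) * norm (a k))"
        using abs_Re_le_cmod[of "A k l * a l * cnj (a k)"] by (simp add: norm_mult mult.assoc)
      also have "\<dots> \<le> norm (A k l) * (((norm (a k))\<^sup>2 + (norm (a l))\<^sup>2) / 2)"
        using sum_squares_bound[of "norm (a k)" "norm (a l)"] by (intro mult_left_mono) (auto simp: mult_ac)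
      also have "norm (A k l) = B k l" using 3 by (auto simp: B_def)
      finally have "- Re (A k l * a l * cnj (a k)) \<le> B k l * ((norm (a k))\<^sup>2 + (norm (a l))\<^sup>2) / 2"
        by (simp only: times_divide_eq_right)
      moreover have "X k l = 0" "D k l = 0" using 3 by (auto simp: X_def D_def)
      ultimately show ?thesis by simp
    qed (auto simp: X_def D_def B_def)
  qed
  have sB: "(\<Sum>k\<in>S. \<Sum>l\<in>S. B k l * (norm (a l))\<^sup>2) = (\<Sum>k\<in>S. \<Sum>l\<in>S. B k l * (norm (a k))\<^sup>2)"
  proof -
    have "B k l = B l k" for k l using sym[of k l] by (auto simp: B_def)
    thus ?thesis by (subst sum.swap) simp
  qed
  have half: "(\<Sum>k\<in>S. \<Sum>l\<in>S. B k l * ((norm (a k))\<^sup>2 + (norm (a l))\<^sup>2) / 2) = (\<Sum>k\<in>S. (\<Sum>l\<in>S. B k l) * (norm (a k))\<^sup>2)"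
    using sB by (simp add: distrib_left add_divide_distrib sum.distrib sum_distrib_right flip: sum_divide_distrib)
  have XF: "(\<Sum>k\<in>S. \<Sum>l\<in>S. X k l) = Re (\<Sum>k\<in>S \<inter> F. \<Sum>l\<in>S \<inter> F. A k l * a l * cnj (a k))"
  proof -
    define Y where "Y = (\<lambda>k l. Re (A k l * a l * cnj (a k)))"
    have X: "X = (\<lambda>k l. if k \<in> F \<and> l \<in> F then Y k l else 0)" by (simp only: X_def Y_def)
    have "(\<Sum>l\<in>S. X k l) = (if k \<in> F then \<Sum>l\<in>S \<inter> F. Y k l else 0)" for k
      using S by (simp add: X sum.inter_restrict)
    hence "(\<Sum>k\<in>S. \<Sum>l\<in>S. X k l) = (\<Sum>k\<in>S \<inter> F. \<Sum>l\<in>S \<inter> F. Y k l)"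
      using S by (simp add: sum.inter_restrict[of S "\<lambda>k. \<Sum>l\<in>S \<inter> F. Y k l"])
    thus ?thesis by (simp only: Y_def Re_sum)
  qed
  have DS: "(\<Sum>k\<in>S. \<Sum>l\<in>S. D k l) = (\<Sum>k\<in>S. if k \<in> F then 0 else Re (A k k) * (norm (a k))\<^sup>2)"
  proof (rule sum.cong[OF refl])
    fix k assume "k \<in> S"
    have "(\<Sum>l\<in>S. D k l) = (\<Sum>l\<in>S. if k = l then D k k else 0)"
      by (intro sum.cong) (auto simp: D_def)
    thus "(\<Sum>l\<in>S. D k l) = (if k \<in> F then 0 else Re (A k k) * (norm (a k))\<^sup>2)"
      using S \<open>k \<in> S\<close> by (simp add: D_def)
  qed
  have row: "c * (norm (a k))\<^sup>2 \<le> (if k \<in> F then \<mu> * (norm (a k))\<^sup>2 else Re (A k k) * (norm (a k))\<^sup>2) - (\<Sum>l\<in>S. B k l) * (norm (a k))\<^sup>2"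
    if "k \<in> S" for k
  proof (cases "k \<in> F")
    case True
    have "(\<Sum>l\<in>S. B k l) = (\<Sum>l\<in>S - F. norm (A k l))"
      using S True by (intro sum.mono_neutral_cong_right) (auto simp: B_def)
    hence "c + (\<Sum>l\<in>S. B k l) \<le> \<mu>" using coupling[of k] True that by simp
    hence "(c + (\<Sum>l\<in>S. B k l)) * (norm (a k))\<^sup>2 \<le> \<mu> * (norm (a k))\<^sup>2" by (rule mult_right_mono) simp
    thus ?thesis using True by (simp add: distrib_right)
  next
    case False
    have "(\<Sum>l\<in>S. B k l) = (\<Sum>l\<in>S - {k}. norm (A k l))"
      using S False by (intro sum.mono_neutral_cong_right) (auto simp: B_def)
    hence "c + (\<Sum>l\<in>S. B k l) \<le> Re (A k k)" using high[of k] False that by simp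
    hence "(c + (\<Sum>l\<in>S. B k l)) * (norm (a k))\<^sup>2 \<le> Re (A k k) * (norm (a k))\<^sup>2" by (rule mult_right_mono) simp
    thus ?thesis using False by (simp add: distrib_right)
  qed
  have "c * (\<Sum>k\<in>S. (norm (a k))\<^sup>2) \<le> (\<Sum>k\<in>S. (if k \<in> F then \<mu> * (norm (a k))\<^sup>2 else Re (A k k) * (norm (a k))\<^sup>2) - (\<Sum>l\<in>S. B k l) * (norm (a k))\<^sup>2)"
    unfolding sum_distrib_left by (rule sum_mono[OF row])
  also have "\<dots> = \<mu> * (\<Sum>k\<in>S \<inter> F. (norm (a k))\<^sup>2) + (\<Sum>k\<in>S. \<Sum>l\<in>S. D k l) - (\<Sum>k\<in>S. (\<Sum>l\<in>S. B k l) * (norm (a k))\<^sup>2)"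
  proof -
    have "(\<Sum>k\<in>S. if k \<in> F then \<mu> * (norm (a k))\<^sup>2 else Re (A k k) * (norm (a k))\<^sup>2) =
        (\<Sum>k\<in>S. (if k \<in> F then \<mu> * (norm (a k))\<^sup>2 else 0) + (if k \<in> F then 0 else Re (A k k) * (norm (a k))\<^sup>2))"
      by (intro sum.cong) auto
    also have "\<dots> = \<mu> * (\<Sum>k\<in>S \<inter> F. (norm (a k))\<^sup>2) + (\<Sum>k\<in>S. \<Sum>l\<in>S. D k l)"
      unfolding DS sum.distrib using S by (simp add: sum.inter_restrict sum_distrib_left if_distrib[of "(*) \<mu>"] cong: if_cong)
    finally show ?thesis by (simp add: sum_subtractf)
  qed
  also have "\<dots> \<le> (\<Sum>k\<in>S. \<Sum>l\<in>S. X k l) + (\<Sum>k\<in>S. \<Sum>l\<in>S. D k l) - (\<Sum>k\<in>S. (\<Sum>l\<in>S. B k l) * (norm (a k))\<^sup>2)"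
    unfolding XF using low by simp
  also have "\<dots> = (\<Sum>k\<in>S. \<Sum>l\<in>S. X k l + D k l - B k l * ((norm (a k))\<^sup>2 + (norm (a l))\<^sup>2) / 2)"
    unfolding half[symmetric] by (simp add: sum.distrib sum_subtractf)
  also have "\<dots> \<le> (\<Sum>k\<in>S. \<Sum>l\<in>S. Re (A k l * a l * cnj (a k)))"
    by (intro sum_mono entry)
  finally show ?thesis by simp
qed

lemma summable_tail_small:
  fixes \<kappa> :: "int \<Rightarrow> real"
  assumes \<kappa>: "\<kappa> summable_on UNIV" "\<And>d. 0 \<le> \<kappa> d" and "0 < \<epsilon>"
  shows "\<exists>K. \<forall>X. finite X \<longrightarrow> (\<forall>d\<in>X. int K < \<bar>d\<bar>) \<longrightarrow> sum \<kappa> X \<le> \<epsilon>"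
proof -
  have "(\<lambda>n. sum \<kappa> {- int n..int n}) \<longlonglongrightarrow> infsum \<kappa> UNIV"
    by (rule has_sum_int_symmetric) (simp add: \<kappa>)
  hence "\<forall>\<^sub>F n in sequentially. infsum \<kappa> UNIV - \<epsilon> < sum \<kappa> {- int n..int n}"
    using \<open>0 < \<epsilon>\<close> by (intro order_tendstoD) auto
  then obtain K where K: "infsum \<kappa> UNIV - \<epsilon> < sum \<kappa> {- int K..int K}"
    by (auto simp: eventually_sequentially)
  have "sum \<kappa> X \<le> \<epsilon>" if X: "finite X" "\<forall>d\<in>X. int K < \<bar>d\<bar>" for X
  proof -
    have "X \<inter> {- int K..int K} = {}" using X(2) by fastforce
    hence "sum \<kappa> X + sum \<kappa> {- int K..int K} = sum \<kappa> (X \<union> {- int K..int K})"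
      using X by (simp add: sum.union_disjoint)
    also have "\<dots> \<le> infsum \<kappa> UNIV" using X \<kappa> by (intro finite_sum_le_infsum) auto
    finally show ?thesis using K by linarith
  qed
  thus ?thesis by blast
qed

lemma square_le_3_power: "real j ^ 2 \<le> 3 ^ j"
proof (induction j rule: nat_less_induct)
  case (1 j)
  show ?case
  proof (cases "j \<le> 1")
    case True
    thus ?thesis by (cases j) auto
  next
    case False
    then obtain i where j: "j = Suc i" "1 \<le> i" by (cases j) auto
    have "real i ^ 2 \<le> 3 ^ i" using 1 j by simp
    moreover have "real (Suc i) ^ 2 \<le> 3 * real i ^ 2 + (if i = 1 then 1 else 0)"
    proof (cases "i = 1")
      case False
      hence "2 \<le> real i" using j(2) by simp
      hence "2 * real i \<le> real i * real i" by (auto intro!: mult_right_mono)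
      moreover have "2 * 2 \<le> real i * real i" using \<open>2 \<le> real i\<close> by (intro mult_mono) auto
      ultimately show ?thesis using False by (simp add: power2_eq_square algebra_simps) 
    qed simp
    ultimately show ?thesis using j by (cases "i = 1") (auto simp: power2_eq_square)
  qed
qed

text \<open>
  The choice of the cut-off \<open>N\<close> and of the exponent \<open>n\<close> of the profile. The number \<open>j\<close> is such that
  \<open>16N/l \<le> 3\<^sup>j\<close> although \<open>N\<close> is linear in \<open>j\<close>; with \<open>n = (4N + 2) j\<close> the power \<open>3\<^sup>n\<close> exceeds
  \<open>(16N/l)\<^sup>4\<^sup>N\<^sup>+\<^sup>2\<close>, while \<open>n\<close> stays below a prescribed multiple of \<open>N\<^sup>2\<close>.
\<close>

lemma cutoff_choice:
  assumes "0 < D" "0 < b" "0 < l" "l \<le> 1" "0 < \<omega>"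
  obtains N n where "N0 \<le> N" "0 < N" "4 * real n * \<omega> \<le> (real N)\<^sup>2 / 2"
    "D / 3 ^ n \<le> b * inverse (real N) * (l / (16 * real N)) ^ (4 * N)"
proof -
  define N1 where "N1 = N0 + nat \<lceil>D / b\<rceil> + 1"
  define B where "B = 16 * (48 * \<omega> + 1 + real N1) / l"
  define j where "j = nat \<lceil>B\<rceil> + 1"
  define N where "N = nat \<lceil>48 * \<omega> * j\<rceil> + N1"
  define n where "n = (4 * N + 2) * j"
  have B0: "0 \<le> B" using assms by (simp add: B_def)
  have jB: "B \<le> j" "1 \<le> real j" unfolding j_def using B0 by linarith+
  have N: "48 * \<omega> * j \<le> N" "real N \<le> 48 * \<omega> * j + 1 + N1" "1 \<le> N" "D / b \<le> N"
  proof -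
    have "0 \<le> 48 * \<omega> * j" using assms by simp
    thus "48 * \<omega> * j \<le> N" "real N \<le> 48 * \<omega> * j + 1 + N1" unfolding N_def by linarith+
    show "1 \<le> N" by (simp add: N_def N1_def)
    show "D / b \<le> N" unfolding N_def N1_def by linarith
  qed
  define x where "x = 16 * real N / l"
  have "x \<le> 16 * (48 * \<omega> * j + 1 + N1) / l"
    unfolding x_def using N assms by (intro divide_right_mono mult_left_mono) auto
  also have "\<dots> \<le> 16 * (48 * \<omega> * j + 1 * j + N1 * j) / l"
    using jB assms by (intro divide_right_mono mult_left_mono add_mono) (auto intro: mult_left_mono simp: mult_le_cancel_left1)
  also have "\<dots> = B * j" by (simp add: B_def algebra_simps)
  also have "\<dots> \<le> real j ^ 2" unfolding power2_eq_square using jB by (intro mult_right_mono) auto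
  also have "\<dots> \<le> 3 ^ j" by (rule square_le_3_power)
  finally have x3: "x \<le> 3 ^ j" .
  have "real N * l \<le> real N * 16" using assms by (intro mult_left_mono) auto
  hence Nx: "real N \<le> x" using assms unfolding x_def by (simp add: field_simps)
  have x1: "1 \<le> x" using Nx N by linarith
  have "8 * real n * \<omega> = (48 * \<omega> * j) * ((4 * N + 2) / 6)" by (simp add: n_def field_simps)
  also have "\<dots> \<le> real N * real N" using N assms by (intro mult_mono) auto
  finally have 1: "4 * real n * \<omega> \<le> (real N)\<^sup>2 / 2" by (simp add: power2_eq_square)
  have "D \<le> b * N" using N(4) assms by (simp add: field_simps)
  hence "D * N * x ^ (4 * N) \<le> (b * N) * N * x ^ (4 * N)"
    using x1 by (intro mult_right_mono) auto
  also have "\<dots> \<le> b * (x * x * x ^ (4 * N))"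
    using Nx x1 assms unfolding mult.assoc by (intro mult_left_mono mult_mono) auto
  also have "\<dots> = b * x ^ (4 * N + 2)" by (simp add: mult_ac)
  also have "\<dots> \<le> b * (3 ^ j) ^ (4 * N + 2)"
    using x3 x1 assms by (intro mult_left_mono power_mono) auto
  also have "\<dots> = b * 3 ^ n" by (simp only: n_def power_mult[symmetric] mult.commute)
  finally have "D * N * x ^ (4 * N) \<le> b * 3 ^ n" .
  moreover have "(l / (16 * real N)) ^ (4 * N) = inverse (x ^ (4 * N))"
    unfolding x_def by (simp add: inverse_eq_divide power_divide)
  moreover have "0 < x ^ (4 * N)" using x1 by simp
  ultimately have 2: "D / 3 ^ n \<le> b * inverse (real N) * (l / (16 * real N)) ^ (4 * N)"
    using N(3) by (simp add: field_simps)
  show thesis using that[of N n] 1 2 N(3) by (simp add: N_def N1_def)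
qed

definition gramian :: "(real \<Rightarrow> real) \<Rightarrow> real \<Rightarrow> nat \<Rightarrow> real \<Rightarrow> int \<Rightarrow> int \<Rightarrow> complex" where
  "gramian g T n \<alpha> k l = control_matrix g k l * profile_ft T n (dispersion \<alpha> l - dispersion \<alpha> k)"

text \<open>
  Stated for finitely supported vectors, so that no convergence is involved; \<open>0 \<notin> S\<close> is the
  mean-zero condition.
\<close>

definition coercive_on_mean_zero :: "(int \<Rightarrow> int \<Rightarrow> complex) \<Rightarrow> real \<Rightarrow> bool" where
  "coercive_on_mean_zero A c \<longleftrightarrow> (\<forall>S a. finite S \<longrightarrow> 0 \<notin> S \<longrightarrow>
     c * (\<Sum>k\<in>S. (norm (a k))\<^sup>2) \<le> Re (\<Sum>k\<in>S. \<Sum>l\<in>S. A k l * a l * cnj (a k)))"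

context control_density
begin

lemma norm_gramian_sym: "norm (gramian g T n \<alpha> k l) = norm (gramian g T n \<alpha> l k)"
proof -
  have "gramian g T n \<alpha> k l = cnj (gramian g T n \<alpha> l k)"
    by (simp add: gramian_def control_matrix_cnj cnj_profile_ft)
  thus ?thesis by simp
qed

lemma Re_gramian_diag: "Re (gramian g T n \<alpha> k k) = (1 - (norm (density_coeff g k))\<^sup>2) * profile_mass T n"
  by (simp add: gramian_def control_matrix_diag profile_ft_0 flip: of_real_mult)

text \<open>
  The form of the Gramian is the average over time, with the non-negative profile as density, of
  the form of the control matrix at the vectors \<open>a k e\<^sup>i\<^sup>\<lambda>\<^sup>t\<close>, whose coordinates have the moduli of
  those of \<open>a\<close>. So a lower bound for a block is inherited.
\<close>

lemma gramian_block_ge: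
  assumes T: "T > 0" and F: "finite F"
    and low: "\<And>a. \<mu> * (\<Sum>k\<in>F. (norm (a k))\<^sup>2) \<le> Re (\<Sum>k\<in>F. \<Sum>l\<in>F. control_matrix g k l * a l * cnj (a k))"
  shows "\<mu> * profile_mass T n * (\<Sum>k\<in>F. (norm (a k))\<^sup>2) \<le>
    Re (\<Sum>k\<in>F. \<Sum>l\<in>F. gramian g T n \<alpha> k l * a l * cnj (a k))"
proof -
  define f where "f = (\<lambda>t. \<Sum>k\<in>F. \<Sum>l\<in>F. control_matrix g k l * (a l * cis (dispersion \<alpha> l * t)) * cnj (a k * cis (dispersion \<alpha> k * t)))"
  have ft: "((\<lambda>t. profile T n t * cis (\<mu> * t)) has_integral profile_ft T n \<mu>) {0..T}" for \<mu>
    unfolding profile_ft_def by (intro integrable_integral integrable_continuous_real continuous_intros)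
  have "((\<lambda>t. \<Sum>k\<in>F. \<Sum>l\<in>F. (profile T n t * cis ((dispersion \<alpha> l - dispersion \<alpha> k) * t)) * (control_matrix g k l * a l * cnj (a k)))
      has_integral (\<Sum>k\<in>F. \<Sum>l\<in>F. profile_ft T n (dispersion \<alpha> l - dispersion \<alpha> k) * (control_matrix g k l * a l * cnj (a k)))) {0..T}"
    by (intro has_integral_sum F has_integral_mult_left ft)
  moreover have "(\<Sum>k\<in>F. \<Sum>l\<in>F. (profile T n t * cis ((dispersion \<alpha> l - dispersion \<alpha> k) * t)) * (control_matrix g k l * a l * cnj (a k)))
      = profile T n t * f t" for t
    unfolding f_def sum_distrib_left
  proof (intro sum.cong refl)
    fix k l
    have "cis ((dispersion \<alpha> l - dispersion \<alpha> k) * t) = cis (dispersion \<alpha> l * t) * cnj (cis (dispersion \<alpha> k * t))"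
      by (simp add: cis_cnj cis_mult left_diff_distrib)
    thus "(profile T n t * cis ((dispersion \<alpha> l - dispersion \<alpha> k) * t)) * (control_matrix g k l * a l * cnj (a k)) =
        profile T n t * (control_matrix g k l * (a l * cis (dispersion \<alpha> l * t)) * cnj (a k * cis (dispersion \<alpha> k * t)))"
      by (simp only: complex_cnj_mult mult_ac)
  qed
  ultimately have "((\<lambda>t. profile T n t * f t) has_integral
      (\<Sum>k\<in>F. \<Sum>l\<in>F. gramian g T n \<alpha> k l * a l * cnj (a k))) {0..T}"
    by (simp add: gramian_def mult_ac)
  from has_integral_linear[OF this bounded_linear_Re]
  have i: "((\<lambda>t. profile T n t * Re (f t)) has_integral
      Re (\<Sum>k\<in>F. \<Sum>l\<in>F. gramian g T n \<alpha> k l * a l * cnj (a k))) {0..T}"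
  proof -
    have "Re (of_real p * z) = p * Re z" for p z by simp
    with \<open>(Re \<circ> (\<lambda>t. profile T n t * f t) has_integral _) _\<close> show ?thesis
      by (simp only: o_def)
  qed
  have j: "((\<lambda>t. profile T n t * (\<mu> * (\<Sum>k\<in>F. (norm (a k))\<^sup>2))) has_integral
      profile_mass T n * (\<mu> * (\<Sum>k\<in>F. (norm (a k))\<^sup>2))) {0..T}"
    unfolding profile_mass_def
    by (intro has_integral_mult_left integrable_integral integrable_continuous_real continuous_intros)
  have "\<mu> * (\<Sum>k\<in>F. (norm (a k))\<^sup>2) \<le> Re (f t)" for t
    using low[of "\<lambda>k. a k * cis (dispersion \<alpha> k * t)"] by (simp add: f_def norm_mult)
  hence "profile_mass T n * (\<mu> * (\<Sum>k\<in>F. (norm (a k))\<^sup>2)) \<le>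
      Re (\<Sum>k\<in>F. \<Sum>l\<in>F. gramian g T n \<alpha> k l * a l * cnj (a k))"
    by (intro has_integral_le[OF j i] mult_left_mono) (auto simp: profile_nonneg)
  thus ?thesis by (simp add: mult_ac)
qed

lemma sum_row_le:
  fixes \<kappa> :: "int \<Rightarrow> real"
  assumes "\<kappa> summable_on UNIV" "\<And>d. 0 \<le> \<kappa> d" "finite X"
  shows "(\<Sum>l\<in>X. \<kappa> (k - l)) \<le> infsum \<kappa> UNIV"
proof -
  have "(\<Sum>l\<in>X. \<kappa> (k - l)) = sum \<kappa> ((\<lambda>l. k - l) ` X)"
    by (subst sum.reindex) (auto simp: inj_on_def)
  also have "\<dots> \<le> infsum \<kappa> UNIV" using assms by (intro finite_sum_le_infsum) auto
  finally show ?thesis .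
qed

text \<open>
  For bounded \<open>\<alpha>\<close> no frequency above a large cut-off \<open>N\<close> is close to any other one. The entries
  outside the low block are therefore of size \<open>3\<^sup>-\<^sup>n\<close> apart from the diagonal, and \<open>n\<close> can be chosen so
  large that even the very small lower bound of the low block dominates them.
\<close>

lemma gramian_coercive_bounded_alpha:
  assumes T: "T > 0"
  shows "\<exists>c>0. \<exists>n. \<forall>\<alpha>. 0 < \<alpha> \<longrightarrow> \<alpha> \<le> real A \<longrightarrow> coercive_on_mean_zero (gramian g T n \<alpha>) c"
proof -
  obtain l b where lb: "0 < l" "l \<le> 1" "0 < b"
    "\<forall>N F a. 0 < N \<longrightarrow> F \<subseteq> {- int N..int N} - {0} \<longrightarrow>
      b * inverse (real N) * (l / (16 * real N)) ^ (4 * N) * (\<Sum>k\<in>F. (norm (a k))\<^sup>2) \<le>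
      Re (\<Sum>k\<in>F. \<Sum>l\<in>F. control_matrix g k l * a l * cnj (a k))"
    using control_form_ge by (elim exE conjE)
  obtain \<eta> where \<eta>: "0 < \<eta>" "\<eta> \<le> 1" "\<And>k. k \<noteq> 0 \<Longrightarrow> norm (density_coeff g k) \<le> 1 - \<eta>"
    using density_coeff_spectral_gap by blast
  obtain C where C: "C > 0" "\<And>k l. norm (control_matrix g k l) \<le> C * inverse (weight (k - l) ^ 2)"
    using control_matrix_decay by blast
  define \<kappa> where "\<kappa> = (\<lambda>d. C * inverse (weight d ^ 2))"
  have \<kappa>: "\<kappa> summable_on UNIV" "\<And>d. 0 \<le> \<kappa> d"
    unfolding \<kappa>_def using C(1) by (auto intro!: summable_on_cmult_right summable_inverse_weight)
  define D where "D = infsum \<kappa> UNIV + 1"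
  have D: "0 < D" unfolding D_def using infsum_nonneg[of UNIV \<kappa>] \<kappa>(2) by (simp add: add_nonneg_pos)
  \<comment> \<open>The factor \<open>\<eta>\<close> makes the block constant at most the diagonal margin as well.\<close>
  obtain N n where N: "2 * A \<le> N" "0 < N" "4 * real n * (pi / T) \<le> (real N)\<^sup>2 / 2"
    "2 * D / 3 ^ n \<le> (b * \<eta> / (b + 1)) * inverse (real N) * (l / (16 * real N)) ^ (4 * N)"
    using cutoff_choice[of "2 * D" "b * \<eta> / (b + 1)" l "pi / T" "2 * A"] D lb(1-3) \<eta>(1) T by auto
  define \<mu> where "\<mu> = (b * \<eta> / (b + 1)) * inverse (real N) * (l / (16 * real N)) ^ (4 * N)"
  define r where "r = profile_mass T n"
  have r: "0 < r" unfolding r_def by (rule profile_mass_pos[OF T])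
  have \<mu>0: "0 < \<mu>" unfolding \<mu>_def using lb \<eta> N by simp
  have q: "0 < inverse (real N) * (l / (16 * real N)) ^ (4 * N)" "inverse (real N) * (l / (16 * real N)) ^ (4 * N) \<le> 1"
  proof -
    have "l \<le> 16 * real N" using lb N by linarith
    hence "l / (16 * N) \<le> 1" using N by simp
    hence "(l / (16 * real N)) ^ (4 * N) \<le> 1" using lb by (intro power_le_one) auto
    thus "inverse (real N) * (l / (16 * real N)) ^ (4 * N) \<le> 1"
      using N lb by (intro mult_le_one) (auto simp: inverse_le_1_iff)
  qed (use lb N in simp)
  have "b * \<eta> / (b + 1) \<le> \<eta>" using lb(3) \<eta>(1) by (simp add: field_simps)
  hence "\<mu> \<le> \<eta> * 1" unfolding \<mu>_def mult.assoc using q \<eta> by (intro mult_mono) auto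
  hence \<mu>\<eta>: "\<mu> \<le> \<eta>" by simp
  have "b * \<eta> \<le> b * (b + 1)" using lb \<eta> by (intro mult_left_mono) auto
  hence "b * \<eta> / (b + 1) \<le> b" using lb(3) by (simp add: field_simps)
  hence \<mu>b: "\<mu> \<le> b * inverse (real N) * (l / (16 * real N)) ^ (4 * N)"
    unfolding \<mu>_def mult.assoc using q by (intro mult_right_mono) auto
  have coup: "(\<Sum>l\<in>X. norm (gramian g T n \<alpha> k l)) \<le> \<mu> / 2 * r"
    if "0 < \<alpha>" "\<alpha> \<le> real A" "finite X" "k \<notin> X" "\<And>l. l \<in> X \<Longrightarrow> real N < \<bar>of_int k\<bar> \<or> real N < \<bar>of_int l\<bar>" for \<alpha> X k
  proof -
    have "norm (gramian g T n \<alpha> k l) \<le> \<kappa> (k - l) * (r / 3 ^ n)" if l: "l \<in> X" for l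
    proof -
      have "k \<noteq> l" using \<open>k \<notin> X\<close> l by blast
      have "\<alpha> \<le> real N / 2" "1 \<le> real N" using \<open>\<alpha> \<le> real A\<close> N(1,2) by linarith+
      hence "(real N)\<^sup>2 / 2 \<le> \<bar>dispersion \<alpha> l - dispersion \<alpha> k\<bar>"
        using dispersion_gap[of \<alpha> "real N" k l] dispersion_gap[of \<alpha> "real N" l k] that(1) l \<open>k \<noteq> l\<close> \<open>0 < \<alpha>\<close>
          \<open>\<And>l. l \<in> X \<Longrightarrow> real N < \<bar>of_int k\<bar> \<or> real N < \<bar>of_int l\<bar>\<close>[OF l]
        by (auto simp: abs_minus_commute)
      hence "norm (profile_ft T n (dispersion \<alpha> l - dispersion \<alpha> k)) \<le> r / 3 ^ n"
        unfolding r_def using N(3) by (intro profile_ft_bound[OF T order_refl]) auto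
      thus ?thesis unfolding gramian_def norm_mult \<kappa>_def
        using r C(1) by (intro mult_mono C(2)) auto
    qed
    hence "(\<Sum>l\<in>X. norm (gramian g T n \<alpha> k l)) \<le> (\<Sum>l\<in>X. \<kappa> (k - l) * (r / 3 ^ n))" by (rule sum_mono)
    also have "\<dots> = (\<Sum>l\<in>X. \<kappa> (k - l)) * (r / 3 ^ n)" by (rule sum_distrib_right[symmetric])
    also have "\<dots> \<le> D * (r / 3 ^ n)"
      using sum_row_le[OF \<kappa> \<open>finite X\<close>, of k] r by (intro mult_right_mono) (auto simp: D_def)
    also have "\<dots> = (2 * D / 3 ^ n) / 2 * r" by simp
    also have "\<dots> \<le> \<mu> / 2 * r" using N(4) r unfolding \<mu>_def by (intro mult_right_mono divide_right_mono) auto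
    finally show ?thesis .
  qed
  have "coercive_on_mean_zero (gramian g T n \<alpha>) (\<mu> / 2 * r)" if \<alpha>: "0 < \<alpha>" "\<alpha> \<le> real A" for \<alpha>
    unfolding coercive_on_mean_zero_def
  proof (intro allI impI)
    fix S :: "int set" and a :: "int \<Rightarrow> complex" assume S: "finite S" "0 \<notin> S"
    define F where "F = {k::int. \<bar>of_int k\<bar> \<le> real N}"
    show "\<mu> / 2 * r * (\<Sum>k\<in>S. (norm (a k))\<^sup>2) \<le> Re (\<Sum>k\<in>S. \<Sum>l\<in>S. gramian g T n \<alpha> k l * a l * cnj (a k))"
    proof (rule block_dominant_form_ge[where F = F and \<mu> = "\<mu> * r", OF S(1) norm_gramian_sym])
      fix k assume k: "k \<in> S - F"
      hence "(\<Sum>l\<in>S - {k}. norm (gramian g T n \<alpha> k l)) \<le> \<mu> / 2 * r"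
        using S by (intro coup \<alpha>) (auto simp: F_def)
      moreover have "\<mu> * r \<le> (1 - (norm (density_coeff g k))\<^sup>2) * r"
      proof (rule mult_right_mono)
        have d: "norm (density_coeff g k) \<le> 1 - \<eta>" using k S by (intro \<eta>(3)) auto
        hence "(norm (density_coeff g k))\<^sup>2 \<le> norm (density_coeff g k) * 1"
          unfolding power2_eq_square using \<eta>(1) by (intro mult_left_mono) auto
        thus "\<mu> \<le> 1 - (norm (density_coeff g k))\<^sup>2" using d \<mu>\<eta> by linarith
      qed (use r in simp)
      ultimately show "\<mu> / 2 * r + (\<Sum>l\<in>S - {k}. norm (gramian g T n \<alpha> k l)) \<le> Re (gramian g T n \<alpha> k k)"
        unfolding Re_gramian_diag r_def[symmetric] by (simp add: field_simps)
    next
      fix k assume "k \<in> S \<inter> F"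
      hence "(\<Sum>l\<in>S - F. norm (gramian g T n \<alpha> k l)) \<le> \<mu> / 2 * r"
        using S by (intro coup \<alpha>) (auto simp: F_def)
      thus "\<mu> / 2 * r + (\<Sum>l\<in>S - F. norm (gramian g T n \<alpha> k l)) \<le> \<mu> * r" by (simp add: field_simps)
    next
      have "S \<inter> F \<subseteq> {- int N..int N} - {0}" using S by (auto simp: F_def)
      have "\<mu> * (\<Sum>k\<in>S \<inter> F. (norm (a k))\<^sup>2) \<le> Re (\<Sum>k\<in>S \<inter> F. \<Sum>l\<in>S \<inter> F. control_matrix g k l * a l * cnj (a k))" for a
        by (rule order_trans[OF mult_right_mono[OF \<mu>b] lb(4)[rule_format, OF N(2) \<open>S \<inter> F \<subseteq> _\<close>]])
           (simp add: sum_nonneg)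
      thus "\<mu> * r * (\<Sum>k\<in>S \<inter> F. (norm (a k))\<^sup>2) \<le> Re (\<Sum>k\<in>S \<inter> F. \<Sum>l\<in>S \<inter> F. gramian g T n \<alpha> k l * a l * cnj (a k))"
        unfolding r_def using S by (intro gramian_block_ge T) auto
    qed
  qed
  moreover have "0 < \<mu> / 2 * r" using \<mu>0 r by simp
  ultimately show ?thesis by blast
qed

text \<open>
  For large \<open>\<alpha>\<close> the Gramian is diagonally dominant. In each row the entries far from the diagonal
  are small since \<open>g\<close> is smooth, and those with a large difference of frequencies are small by the
  choice of the profile. At most one further entry remains. It occurs only at high frequencies,
  where the diagonal entry is close to \<open>1\<close> and the remaining one is at most about \<open>1 - \<eta>\<close>.
\<close>

lemma gramian_coercive_large_alpha:
  assumes T: "T > 0"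
  shows "\<exists>A. \<exists>c>0. \<exists>n. \<forall>\<alpha>. real A \<le> \<alpha> \<longrightarrow> coercive_on_mean_zero (gramian g T n \<alpha>) c"
proof -
  obtain \<eta> where \<eta>: "0 < \<eta>" "\<eta> \<le> 1" "\<And>k. k \<noteq> 0 \<Longrightarrow> norm (density_coeff g k) \<le> 1 - \<eta>"
    using density_coeff_spectral_gap by blast
  obtain C where C: "C > 0" "\<And>k l. norm (control_matrix g k l) \<le> C * inverse (weight (k - l) ^ 2)"
    using control_matrix_decay by blast
  obtain C1 where C1: "C1 > 0" "\<And>k. norm (density_coeff g k) \<le> C1 * inverse (weight k ^ 1)"
    using density_coeff_decay[OF smooth] by blast
  define \<kappa> where "\<kappa> = (\<lambda>d. C * inverse (weight d ^ 2))"
  have \<kappa>: "\<kappa> summable_on UNIV" "\<And>d. 0 \<le> \<kappa> d"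
    unfolding \<kappa>_def using C(1) by (auto intro!: summable_on_cmult_right summable_inverse_weight)
  define D where "D = infsum \<kappa> UNIV + 1"
  have D: "0 < D" unfolding D_def using infsum_nonneg[of UNIV \<kappa>] \<kappa>(2) by (simp add: add_nonneg_pos)
  obtain K where K: "\<forall>X. finite X \<longrightarrow> (\<forall>d\<in>X. int K < \<bar>d\<bar>) \<longrightarrow> sum \<kappa> X \<le> \<eta> / 8"
    using summable_tail_small[OF \<kappa>, of "\<eta> / 8"] \<eta>(1) by auto
  obtain n0 where n0: "8 * D / \<eta> < 3 ^ n0" using real_arch_pow[of 3 "8 * D / \<eta>"] by auto
  define n where "n = Suc n0"
  have n: "D / 3 ^ n \<le> \<eta> / 8" "0 < n"
  proof -
    have "8 * D / \<eta> < 3 ^ n" using n0 unfolding n_def by (simp add: less_trans)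
    thus "D / 3 ^ n \<le> \<eta> / 8" using \<eta>(1) by (simp add: field_simps)
  qed (simp add: n_def)
  define M where "M = 8 * C1 / \<eta>"
  define R where "R = 4 * n * (pi / T)"
  have R: "0 < R" using n T by (simp add: R_def)
  obtain A0 where A0: "\<forall>\<alpha>\<ge>A0. \<forall>k l l'. k \<noteq> 0 \<longrightarrow> resonant (real K) R \<alpha> k l \<longrightarrow> resonant (real K) R \<alpha> k l' \<longrightarrow>
      l = l' \<and> M \<le> \<bar>of_int k\<bar>"
    using resonant_unique[of "real K" R M] R by auto
  define r where "r = profile_mass T n"
  have r: "0 < r" unfolding r_def by (rule profile_mass_pos[OF T])
  have far: "norm (density_coeff g k) \<le> \<eta> / 8" if "M \<le> \<bar>of_int k\<bar>" for k
  proof -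
    have "8 * C1 / \<eta> \<le> weight k" using that by (simp add: M_def weight_def)
    hence "C1 * inverse (weight k ^ 1) \<le> \<eta> / 8" using \<eta>(1) by (simp add: field_simps)
    thus ?thesis using C1(2)[of k] by linarith
  qed
  have "coercive_on_mean_zero (gramian g T n \<alpha>) (\<eta> / 2 * r)" if \<alpha>: "A0 \<le> \<alpha>" for \<alpha>
    unfolding coercive_on_mean_zero_def
  proof (intro allI impI)
    fix S :: "int set" and a :: "int \<Rightarrow> complex" assume S: "finite S" "0 \<notin> S"
    have "\<eta> / 2 * r + (\<Sum>l\<in>S - {k}. norm (gramian g T n \<alpha> k l)) \<le> Re (gramian g T n \<alpha> k k)" if k: "k \<in> S" for k
    proof -
      have k0: "k \<noteq> 0" using k S by auto
      \<comment> \<open>The row splits into entries far from the diagonal, entries with a large difference of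
        frequencies, and resonant entries.\<close>
      define Far where "Far = {l \<in> S - {k}. int K < \<bar>k - l\<bar>}"
      define Res where "Res = {l \<in> S - {k}. \<bar>k - l\<bar> \<le> int K \<and> \<bar>dispersion \<alpha> k - dispersion \<alpha> l\<bar> < R}"
      define Non where "Non = {l \<in> S - {k}. \<bar>k - l\<bar> \<le> int K \<and> R \<le> \<bar>dispersion \<alpha> k - dispersion \<alpha> l\<bar>}"
      have fin: "finite Far" "finite Res" "finite Non" using S by (auto simp: Far_def Res_def Non_def)
      have entry: "norm (gramian g T n \<alpha> k l) \<le> norm (control_matrix g k l) * r" for l
        unfolding gramian_def norm_mult r_def by (intro mult_left_mono norm_profile_ft_le T) auto
      have "norm (gramian g T n \<alpha> k l) \<le> \<kappa> (k - l) * r" for l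
        unfolding \<kappa>_def using C(2)[of k l] r by (intro order_trans[OF entry] mult_right_mono) auto
      hence "(\<Sum>l\<in>Far. norm (gramian g T n \<alpha> k l)) \<le> (\<Sum>l\<in>Far. \<kappa> (k - l) * r)" by (rule sum_mono)
      also have "\<dots> = sum \<kappa> ((\<lambda>l. k - l) ` Far) * r"
        by (subst sum.reindex) (auto simp: inj_on_def sum_distrib_right)
      also have "\<dots> \<le> \<eta> / 8 * r"
        using r fin(1) by (intro mult_right_mono K[rule_format]) (auto simp: Far_def)
      finally have sFar: "(\<Sum>l\<in>Far. norm (gramian g T n \<alpha> k l)) \<le> \<eta> / 8 * r" .
      have "norm (gramian g T n \<alpha> k l) \<le> \<kappa> (k - l) * (r / 3 ^ n)" if "l \<in> Non" for l
      proof -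
        have "norm (profile_ft T n (dispersion \<alpha> l - dispersion \<alpha> k)) \<le> r / 3 ^ n"
          unfolding r_def using that
          by (intro profile_ft_bound[OF T order_refl]) (auto simp: Non_def R_def abs_minus_commute)
        thus ?thesis unfolding gramian_def norm_mult \<kappa>_def
          using r C(1) by (intro mult_mono C(2)) auto
      qed
      hence "(\<Sum>l\<in>Non. norm (gramian g T n \<alpha> k l)) \<le> (\<Sum>l\<in>Non. \<kappa> (k - l) * (r / 3 ^ n))" by (rule sum_mono)
      also have "\<dots> = (\<Sum>l\<in>Non. \<kappa> (k - l)) * (r / 3 ^ n)" by (rule sum_distrib_right[symmetric])
      also have "\<dots> \<le> D * (r / 3 ^ n)"
        using sum_row_le[OF \<kappa> fin(3), of k] r by (intro mult_right_mono) (auto simp: D_def)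
      also have "\<dots> = D / 3 ^ n * r" by simp
      also have "\<dots> \<le> \<eta> / 8 * r" using n r by (intro mult_right_mono) auto
      finally have sNon: "(\<Sum>l\<in>Non. norm (gramian g T n \<alpha> k l)) \<le> \<eta> / 8 * r" .
      have "S - {k} = Far \<union> (Non \<union> Res)" by (auto simp: Far_def Res_def Non_def)
      moreover have "Far \<inter> (Non \<union> Res) = {}" "Non \<inter> Res = {}" by (auto simp: Far_def Res_def Non_def)
      ultimately have split: "(\<Sum>l\<in>S - {k}. norm (gramian g T n \<alpha> k l)) =
          (\<Sum>l\<in>Far. norm (gramian g T n \<alpha> k l)) + ((\<Sum>l\<in>Non. norm (gramian g T n \<alpha> k l)) + (\<Sum>l\<in>Res. norm (gramian g T n \<alpha> k l)))"
        using fin by (simp add: sum.union_disjoint)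
      have uniq: "l = l' \<and> M \<le> \<bar>of_int k\<bar>" if "l \<in> Res" "l' \<in> Res" for l l'
      proof -
        have "resonant (real K) R \<alpha> k j" if "j \<in> Res" for j
        proof -
          have "\<bar>k - j\<bar> \<le> int K" using that by (simp add: Res_def)
          hence "real_of_int \<bar>k - j\<bar> \<le> real_of_int (int K)" by (simp only: of_int_le_iff)
          thus ?thesis using that S by (auto simp: Res_def resonant_def)
        qed
        thus ?thesis using A0[rule_format, OF \<alpha> k0] that by blast
      qed
      have main: "(\<Sum>l\<in>Res. norm (gramian g T n \<alpha> k l)) + 3 / 4 * \<eta> * r \<le> (1 - (norm (density_coeff g k))\<^sup>2) * r"
      proof (cases "Res = {}")
        case True
        have d: "norm (density_coeff g k) \<le> 1 - \<eta>" by (rule \<eta>(3)[OF k0])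
        hence "(norm (density_coeff g k))\<^sup>2 \<le> norm (density_coeff g k) * 1"
          unfolding power2_eq_square using \<eta>(1) by (intro mult_left_mono) auto
        hence "3 / 4 * \<eta> \<le> 1 - (norm (density_coeff g k))\<^sup>2" using d \<eta>(1) by linarith
        thus ?thesis using True r by (simp add: mult_right_mono)
      next
        case False
        then obtain j where j: "j \<in> Res" by blast
        have "i = j" if "i \<in> Res" for i using uniq[OF that j] by (rule conjunct1)
        hence Rj: "Res = {j}" using j by blast
        have dk: "norm (density_coeff g k) \<le> \<eta> / 8" using uniq[OF j j] by (intro far) simp
        have "norm (control_matrix g k j) \<le> norm (density_coeff g (k - j)) + norm (density_coeff g k) * norm (density_coeff g (- j))"
          unfolding control_matrix_def norm_mult[symmetric] by (rule norm_triangle_ineq4)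
        also have "norm (density_coeff g k) * norm (density_coeff g (- j)) \<le> \<eta> / 8 * 1"
        proof (intro mult_mono dk)
          have "- j \<noteq> 0" using j S by (auto simp: Res_def)
          from \<eta>(3)[OF this] show "norm (density_coeff g (- j)) \<le> 1" using \<eta>(1) by linarith
        qed (use \<eta> in auto)
        also have "norm (density_coeff g (k - j)) \<le> 1 - \<eta>" using j by (intro \<eta>(3)) (auto simp: Res_def)
        finally have "norm (control_matrix g k j) \<le> 1 - \<eta> + \<eta> / 8 * 1" by simp
        moreover have "(norm (density_coeff g k))\<^sup>2 \<le> \<eta> / 8 * 1"
          unfolding power2_eq_square using dk \<eta> by (intro mult_mono) auto
        ultimately have "norm (control_matrix g k j) + 3 / 4 * \<eta> \<le> 1 - (norm (density_coeff g k))\<^sup>2"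
          by linarith
        hence "(norm (control_matrix g k j) + 3 / 4 * \<eta>) * r \<le> (1 - (norm (density_coeff g k))\<^sup>2) * r"
          using r by (intro mult_right_mono) auto
        thus ?thesis using entry[of j] Rj by (simp add: distrib_right)
      qed
      have "\<eta> / 2 * r + (\<Sum>l\<in>S - {k}. norm (gramian g T n \<alpha> k l)) \<le>
          (\<Sum>l\<in>Res. norm (gramian g T n \<alpha> k l)) + 3 / 4 * \<eta> * r"
        unfolding split using sFar sNon by (simp add: field_simps)
      thus ?thesis unfolding Re_gramian_diag r_def[symmetric] using main by linarith
    qed
    thus "\<eta> / 2 * r * (\<Sum>k\<in>S. (norm (a k))\<^sup>2) \<le> Re (\<Sum>k\<in>S. \<Sum>l\<in>S. gramian g T n \<alpha> k l * a l * cnj (a k))"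
      by (intro block_dominant_form_ge[where F = "{}" and \<mu> = 0, OF S(1) norm_gramian_sym]) auto
  qed
  moreover have "0 < \<eta> / 2 * r" using \<eta>(1) r by simp
  moreover have "A0 \<le> \<alpha>" if "real (nat \<lceil>A0\<rceil>) \<le> \<alpha>" for \<alpha> using that by linarith
  ultimately show ?thesis by blast
qed

theorem gramian_coercive:
  assumes T: "T > 0"
  shows "\<exists>c>0. \<forall>\<alpha>>0. \<exists>n. coercive_on_mean_zero (gramian g T n \<alpha>) c"
proof -
  obtain A c1 n1 where 1: "0 < c1" "\<And>\<alpha>. real A \<le> \<alpha> \<Longrightarrow> coercive_on_mean_zero (gramian g T n1 \<alpha>) c1"
    using gramian_coercive_large_alpha[OF T] by blast
  obtain c2 n2 where 2: "0 < c2" "\<And>\<alpha>. 0 < \<alpha> \<Longrightarrow> \<alpha> \<le> real A \<Longrightarrow> coercive_on_mean_zero (gramian g T n2 \<alpha>) c2"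
    using gramian_coercive_bounded_alpha[OF T, of A] by blast
  have mono: "coercive_on_mean_zero B (min c1 c2)" if "coercive_on_mean_zero B c" "c = c1 \<or> c = c2" for B c
    unfolding coercive_on_mean_zero_def
  proof (intro allI impI)
    fix S :: "int set" and a :: "int \<Rightarrow> complex" assume "finite S" "0 \<notin> S"
    have "min c1 c2 * (\<Sum>k\<in>S. (norm (a k))\<^sup>2) \<le> c * (\<Sum>k\<in>S. (norm (a k))\<^sup>2)"
      using that(2) by (intro mult_right_mono sum_nonneg) auto
    also have "\<dots> \<le> Re (\<Sum>k\<in>S. \<Sum>l\<in>S. B k l * a l * cnj (a k))"
      using that(1) \<open>finite S\<close> \<open>0 \<notin> S\<close> unfolding coercive_on_mean_zero_def by blast
    finally show "min c1 c2 * (\<Sum>k\<in>S. (norm (a k))\<^sup>2) \<le> Re (\<Sum>k\<in>S. \<Sum>l\<in>S. B k l * a l * cnj (a k))" .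
  qed
  have "\<exists>n. coercive_on_mean_zero (gramian g T n \<alpha>) (min c1 c2)" if "0 < \<alpha>" for \<alpha>
  proof (cases "real A \<le> \<alpha>")
    case True
    thus ?thesis using mono[OF 1(2)] by blast
  next
    case False
    hence "\<alpha> \<le> real A" by simp
    thus ?thesis using mono[OF 2(2)[OF that]] by blast
  qed
  moreover have "0 < min c1 c2" using 1 2 by simp
  ultimately show ?thesis by blast
qed

end

section \<open>The Hilbert space of square-summable sequences\<close>

text \<open>
  Making the sequence space a type in the class of real Hilbert spaces gives access to fixed points
  of contractions and to integration of vector-valued functions. The inner
  product is the real part of the complex one, as required by that class.
\<close>

typedef ell2 = "{a :: int \<Rightarrow> complex. (\<lambda>k. (norm (a k))\<^sup>2) summable_on UNIV}"
  morphisms coord Abs_ell2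
  by (rule exI[of _ "\<lambda>_. 0"]) simp

setup_lifting type_definition_ell2

lemma summable_coord: "(\<lambda>k. (norm (coord x k))\<^sup>2) summable_on UNIV"
  using coord[of x] by simp

lemma ell2_eqI: "(\<And>k. coord x k = coord y k) \<Longrightarrow> x = y"
  by (simp add: coord_inject[symmetric] fun_eq_iff)

lemma square_summable_diff:
  fixes a b :: "int \<Rightarrow> complex"
  assumes "(\<lambda>k. (norm (a k))\<^sup>2) summable_on UNIV" "(\<lambda>k. (norm (b k))\<^sup>2) summable_on UNIV"
  shows "(\<lambda>k. (norm (a k - b k))\<^sup>2) summable_on UNIV"
proof (rule summable_on_comparison_test)
  show "(\<lambda>k. 2 * (norm (a k))\<^sup>2 + 2 * (norm (b k))\<^sup>2) summable_on UNIV"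
    by (intro summable_on_add summable_on_cmult_right assms)
qed (auto simp: norm_diff_squared_le)

lemma square_summable_add:
  fixes a b :: "int \<Rightarrow> complex"
  assumes "(\<lambda>k. (norm (a k))\<^sup>2) summable_on UNIV" "(\<lambda>k. (norm (b k))\<^sup>2) summable_on UNIV"
  shows "(\<lambda>k. (norm (a k + b k))\<^sup>2) summable_on UNIV"
  using square_summable_diff[of a "\<lambda>k. - b k"] assms by simp

instantiation ell2 :: real_vector
begin

lift_definition zero_ell2 :: ell2 is "\<lambda>_. 0" by simp
lift_definition plus_ell2 :: "ell2 \<Rightarrow> ell2 \<Rightarrow> ell2" is "\<lambda>a b k. a k + b k"
  by (rule square_summable_add)
lift_definition minus_ell2 :: "ell2 \<Rightarrow> ell2 \<Rightarrow> ell2" is "\<lambda>a b k. a k - b k"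
  by (rule square_summable_diff)
lift_definition uminus_ell2 :: "ell2 \<Rightarrow> ell2" is "\<lambda>a k. - a k" by simp
lift_definition scaleR_ell2 :: "real \<Rightarrow> ell2 \<Rightarrow> ell2" is "\<lambda>r a k. r *\<^sub>R a k"
  by (simp add: power_mult_distrib summable_on_cmult_right)

instance
  by standard (transfer; simp add: fun_eq_iff algebra_simps)+

end

lemma coord_simps [simp]:
  "coord 0 k = 0" "coord (x + y) k = coord x k + coord y k" "coord (x - y) k = coord x k - coord y k"
  "coord (- x) k = - coord x k" "coord (r *\<^sub>R x) k = r *\<^sub>R coord x k"
  by (transfer; simp)+

lemma coord_sum: "coord (\<Sum>i\<in>I. f i) k = (\<Sum>i\<in>I. coord (f i) k)"
  by (induction I rule: infinite_finite_induct) auto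

lemma summable_inner_coord: "(\<lambda>k. coord x k \<bullet> coord y k) summable_on UNIV"
proof (rule abs_summable_summable, rule summable_on_comparison_test)
  show "(\<lambda>k. (norm (coord x k))\<^sup>2 + (norm (coord y k))\<^sup>2) summable_on UNIV"
    by (intro summable_on_add summable_coord)
  fix k
  have "norm (coord x k \<bullet> coord y k) \<le> norm (coord x k) * norm (coord y k)"
    by (simp add: Cauchy_Schwarz_ineq2)
  also have "\<dots> \<le> (norm (coord x k))\<^sup>2 + (norm (coord y k))\<^sup>2"
    using sum_squares_bound[of "norm (coord x k)" "norm (coord y k)"]
      mult_nonneg_nonneg[OF norm_ge_zero norm_ge_zero, of "coord x k" "coord y k"] by linarith
  finally show "norm (coord x k \<bullet> coord y k) \<le> (norm (coord x k))\<^sup>2 + (norm (coord y k))\<^sup>2" .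
qed auto

instantiation ell2 :: real_inner
begin

definition inner_ell2 :: "ell2 \<Rightarrow> ell2 \<Rightarrow> real" where
  "inner_ell2 x y = (\<Sum>\<^sub>\<infinity>k. coord x k \<bullet> coord y k)"
definition norm_ell2 :: "ell2 \<Rightarrow> real" where
  "norm_ell2 x = sqrt (inner x x)"
definition sgn_ell2 :: "ell2 \<Rightarrow> ell2" where
  "sgn_ell2 x = x /\<^sub>R norm x"
definition dist_ell2 :: "ell2 \<Rightarrow> ell2 \<Rightarrow> real" where
  "dist_ell2 x y = norm (x - y)"
definition uniformity_ell2 :: "(ell2 \<times> ell2) filter" where
  "uniformity_ell2 = (INF e\<in>{0<..}. principal {(x, y). dist x y < e})"
definition open_ell2 :: "ell2 set \<Rightarrow> bool" where
  "open_ell2 U = (\<forall>x\<in>U. eventually (\<lambda>(x', y). x' = x \<longrightarrow> y \<in> U) uniformity)"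

instance
proof
  fix x y z :: ell2 and r :: real and U :: "ell2 set"
  show "inner x y = inner y x" by (simp add: inner_ell2_def inner_commute)
  show "inner (x + y) z = inner x z + inner y z"
    by (simp add: inner_ell2_def inner_add_left infsum_add summable_inner_coord)
  show "inner (r *\<^sub>R x) y = r * inner x y"
    by (simp add: inner_ell2_def infsum_cmult_right')
  show "0 \<le> inner x x" by (simp add: inner_ell2_def infsum_nonneg)
  show "inner x x = 0 \<longleftrightarrow> x = 0"
  proof
    assume "inner x x = 0"
    hence "coord x k \<bullet> coord x k = 0" for k
      using nonneg_infsum_le_0D[of "\<lambda>k. coord x k \<bullet> coord x k" UNIV k] summable_inner_coord[of x x]
      by (simp add: inner_ell2_def)
    thus "x = 0" by (intro ell2_eqI) simp
  qed (simp add: inner_ell2_def)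
qed (simp_all add: norm_ell2_def sgn_ell2_def dist_ell2_def uniformity_ell2_def open_ell2_def)

end

lemma has_sum_norm_ell2: "((\<lambda>k. (norm (coord x k))\<^sup>2) has_sum (norm x)\<^sup>2) UNIV"
proof -
  have "(norm x)\<^sup>2 = (\<Sum>\<^sub>\<infinity>k. (norm (coord x k))\<^sup>2)"
    by (simp add: power2_norm_eq_inner inner_ell2_def)
  thus ?thesis using summable_coord[of x] by (simp add: has_sum_infsum)
qed

lemma sum_coord_le: "finite S \<Longrightarrow> (\<Sum>k\<in>S. (norm (coord x k))\<^sup>2) \<le> (norm x)\<^sup>2"
  by (rule finite_sum_le_has_sum[OF has_sum_norm_ell2]) auto

lemma norm_coord_le: "norm (coord x k) \<le> norm x"
  using sum_coord_le[of "{k}" x] by (simp add: abs_le_square_iff)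

lemma bounded_linear_coord: "bounded_linear (\<lambda>x. coord x k)"
  by (rule bounded_linear_intro[where K = 1]) (auto simp: norm_coord_le)

lemma ell2_of_finite_bound:
  assumes "\<And>S. finite S \<Longrightarrow> (\<Sum>k\<in>S. (norm (a k))\<^sup>2) \<le> B\<^sup>2" and "0 \<le> B"
  obtains x where "\<And>k. coord x k = a k" "norm x \<le> B"
proof -
  have s: "(\<lambda>k. (norm (a k))\<^sup>2) summable_on UNIV"
    by (rule nonneg_bdd_above_summable_on) (auto intro!: bdd_aboveI2 assms)
  define x where "x = Abs_ell2 a"
  have x: "coord x k = a k" for k using s by (simp add: x_def Abs_ell2_inverse)
  have "(norm x)\<^sup>2 \<le> B\<^sup>2"
    by (rule has_sum_le_finite_sums[OF has_sum_norm_ell2]) (simp add: x assms)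
  hence "norm x \<le> B" using assms(2) by (simp add: power2_le_iff_abs_le)
  with x show thesis using that by blast
qed

instance ell2 :: complete_space
proof
  fix X :: "nat \<Rightarrow> ell2" assume X: "Cauchy X"
  have "Cauchy (\<lambda>n. coord (X n) k)" for k
    by (rule bounded_linear.Cauchy[OF bounded_linear_coord X])
  hence "\<exists>c. (\<lambda>n. coord (X n) k) \<longlonglongrightarrow> c" for k
    using Cauchy_convergent convergent_def by blast
  then obtain c where c: "\<And>k. (\<lambda>n. coord (X n) k) \<longlonglongrightarrow> c k" by metis
  have tail: "\<exists>N. \<forall>m\<ge>N. \<forall>S. finite S \<longrightarrow> (\<Sum>k\<in>S. (norm (coord (X m) k - c k))\<^sup>2) \<le> e\<^sup>2" if "0 < e" for e
  proof -
    obtain N where N: "\<And>m n. N \<le> m \<Longrightarrow> N \<le> n \<Longrightarrow> norm (X m - X n) < e"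
      using CauchyD[OF X \<open>0 < e\<close>] by blast
    have "(\<Sum>k\<in>S. (norm (coord (X m) k - c k))\<^sup>2) \<le> e\<^sup>2" if "N \<le> m" "finite S" for m S
    proof (rule tendsto_upperbound)
      show "(\<lambda>n. \<Sum>k\<in>S. (norm (coord (X m) k - coord (X n) k))\<^sup>2) \<longlonglongrightarrow> (\<Sum>k\<in>S. (norm (coord (X m) k - c k))\<^sup>2)"
        by (intro tendsto_intros c)
      show "\<forall>\<^sub>F n in sequentially. (\<Sum>k\<in>S. (norm (coord (X m) k - coord (X n) k))\<^sup>2) \<le> e\<^sup>2"
        using eventually_ge_at_top[of N]
      proof eventually_elim
        case (elim n)
        have "(\<Sum>k\<in>S. (norm (coord (X m - X n) k))\<^sup>2) \<le> (norm (X m - X n))\<^sup>2"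
          by (rule sum_coord_le[OF that(2)])
        also have "\<dots> \<le> e\<^sup>2" using N[OF that(1) elim] by (intro power_mono) auto
        finally show ?case by simp
      qed
    qed simp
    thus ?thesis by blast
  qed
  obtain N where N: "\<And>S. finite S \<Longrightarrow> (\<Sum>k\<in>S. (norm (coord (X N) k - c k))\<^sup>2) \<le> 1\<^sup>2"
    using tail[of 1] by auto
  obtain d where d: "\<And>k. coord d k = coord (X N) k - c k"
    by (rule ell2_of_finite_bound[OF N]) auto
  define x where "x = X N - d"
  have x: "coord x k = c k" for k by (simp add: x_def d)
  have "X \<longlonglongrightarrow> x"
  proof (rule LIMSEQ_I)
    fix r :: real assume "0 < r"
    then obtain N where N: "\<And>m S. N \<le> m \<Longrightarrow> finite S \<Longrightarrow> (\<Sum>k\<in>S. (norm (coord (X m) k - c k))\<^sup>2) \<le> (r / 2)\<^sup>2"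
      using tail[of "r / 2"] by auto
    have "norm (X m - x) < r" if m: "N \<le> m" for m
    proof -
      have "(norm (X m - x))\<^sup>2 \<le> (r / 2)\<^sup>2"
        by (rule has_sum_le_finite_sums[OF has_sum_norm_ell2]) (simp add: x N[OF m])
      hence "norm (X m - x) \<le> r / 2" using \<open>0 < r\<close> by (simp add: power2_le_iff_abs_le)
      thus ?thesis using \<open>0 < r\<close> by linarith
    qed
    thus "\<exists>no. \<forall>n\<ge>no. norm (X n - x) < r" by blast
  qed
  thus "convergent X" by (rule convergentI)
qed

instance ell2 :: banach ..

lift_definition single :: "int \<Rightarrow> complex \<Rightarrow> ell2" is "\<lambda>j z k. if k = j then z else 0"
proof -
  fix j z
  have "(\<lambda>k. (norm (if k = j then z else 0 :: complex))\<^sup>2) summable_on {j}" by simp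
  thus "(\<lambda>k. (norm (if k = j then z else 0 :: complex))\<^sup>2) summable_on UNIV"
    by (rule summable_on_cong_neutral[THEN iffD1, rotated -1]) auto
qed

lemma coord_single: "coord (single j z) k = (if k = j then z else 0)"
  by transfer simp

lemma coord_sum_single:
  assumes "finite S" shows "coord (\<Sum>k\<in>S. single k (a k)) j = (if j \<in> S then a j else 0)"
  using assms by (simp add: coord_sum coord_single)

lemma norm_single [simp]: "norm (single j z) = norm z"
proof -
  have "((\<lambda>k. (norm (coord (single j z) k))\<^sup>2) has_sum (norm z)\<^sup>2) UNIV"
    by (rule has_sum_finite_neutralI[of "{j}"]) (auto simp: coord_single)
  hence "(norm (single j z))\<^sup>2 = (norm z)\<^sup>2" by (rule has_sum_unique[OF has_sum_norm_ell2])
  thus ?thesis by simp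
qed

lemma bounded_linear_single: "bounded_linear (single j)"
  by (rule bounded_linear_intro[where K = 1]) (auto intro!: ell2_eqI simp: coord_single)

lemma has_sum_single: "((\<lambda>k. single k (coord x k)) has_sum x) UNIV"
proof -
  have e: "norm (x - (\<Sum>k\<in>S. single k (coord x k))) = sqrt ((norm x)\<^sup>2 - (\<Sum>k\<in>S. (norm (coord x k))\<^sup>2))"
    if S: "finite S" for S
  proof -
    have "((\<lambda>k. (norm (coord x k))\<^sup>2 - (if k \<in> S then (norm (coord x k))\<^sup>2 else 0)) has_sum
        ((norm x)\<^sup>2 - (\<Sum>k\<in>S. (norm (coord x k))\<^sup>2))) UNIV"
      by (intro has_sum_minus has_sum_norm_ell2 has_sum_finite_neutralI[OF S]) auto
    moreover have "(norm (coord x k))\<^sup>2 - (if k \<in> S then (norm (coord x k))\<^sup>2 else 0) =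
        (norm (coord (x - (\<Sum>k\<in>S. single k (coord x k))) k))\<^sup>2" for k
      using S by (simp add: coord_sum_single)
    ultimately have "(norm (x - (\<Sum>k\<in>S. single k (coord x k))))\<^sup>2 = (norm x)\<^sup>2 - (\<Sum>k\<in>S. (norm (coord x k))\<^sup>2)"
      using has_sum_unique[OF has_sum_norm_ell2] by simp
    thus ?thesis by (metis norm_ge_zero real_sqrt_unique)
  qed
  have "((\<lambda>S. sqrt ((norm x)\<^sup>2 - (\<Sum>k\<in>S. (norm (coord x k))\<^sup>2))) \<longlongrightarrow> sqrt ((norm x)\<^sup>2 - (norm x)\<^sup>2))
      (finite_subsets_at_top UNIV)"
    using has_sum_norm_ell2[of x] unfolding has_sum_def by (intro tendsto_intros)
  hence "((\<lambda>S. norm (x - (\<Sum>k\<in>S. single k (coord x k)))) \<longlongrightarrow> 0) (finite_subsets_at_top UNIV)"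
    unfolding diff_self real_sqrt_zero
    by (rule Lim_transform_eventually)
       (auto intro!: eventually_finite_subsets_at_top_weakI simp: e)
  hence "((\<lambda>S. (\<Sum>k\<in>S. single k (coord x k)) - x) \<longlongrightarrow> 0) (finite_subsets_at_top UNIV)"
    by (subst (asm) norm_minus_commute) (simp add: tendsto_norm_zero_iff)
  thus ?thesis unfolding has_sum_def by (rule LIM_zero_cancel)
qed

lemma bounded_linear_ell2_eqI:
  fixes L1 L2 :: "ell2 \<Rightarrow> 'a::real_normed_vector"
  assumes "bounded_linear L1" "bounded_linear L2" "\<And>k z. L1 (single k z) = L2 (single k z)"
  shows "L1 x = L2 x"
proof -
  have "((\<lambda>k. L1 (single k (coord x k))) has_sum L1 x) UNIV"
    "((\<lambda>k. L2 (single k (coord x k))) has_sum L2 x) UNIV"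
    using has_sum_bounded_linear[OF assms(1) has_sum_single] has_sum_bounded_linear[OF assms(2) has_sum_single]
    by (simp_all add: o_def)
  thus ?thesis by (simp add: assms(3) has_sum_unique)
qed

text \<open>Separability is needed for the measurability of Hilbert-space valued functions.\<close>

fun rational_ell2 :: "(int \<times> rat \<times> rat) list \<Rightarrow> ell2" where
  "rational_ell2 [] = 0"
| "rational_ell2 ((k, p, q) # xs) = single k (Complex (of_rat p) (of_rat q)) + rational_ell2 xs"

lemma rational_ell2_dense:
  assumes "0 < e" shows "\<exists>xs. norm (x - rational_ell2 xs) < e"
proof -
  have fin: "\<exists>xs. norm ((\<Sum>k\<in>S. single k (a k)) - rational_ell2 xs) < e" if "finite S" "0 < e" for S a e
    using that
  proof (induction S arbitrary: e rule: finite_induct)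
    case empty
    thus ?case by (intro exI[of _ "[]"]) simp
  next
    case (insert j S)
    obtain xs where xs: "norm ((\<Sum>k\<in>S. single k (a k)) - rational_ell2 xs) < e / 2"
      using insert.IH[of "e / 2"] insert.prems by auto
    obtain p where p: "Re (a j) < of_rat p" "of_rat p < Re (a j) + e / 4"
      using of_rat_dense[of "Re (a j)" "Re (a j) + e / 4"] insert.prems by auto
    obtain q where q: "Im (a j) < of_rat q" "of_rat q < Im (a j) + e / 4"
      using of_rat_dense[of "Im (a j)" "Im (a j) + e / 4"] insert.prems by auto
    define z where "z = Complex (of_rat p) (of_rat q)"
    have "norm (a j - z) \<le> \<bar>Re (a j - z)\<bar> + \<bar>Im (a j - z)\<bar>" by (rule cmod_le)
    also have "\<dots> < e / 2" using p q by (simp add: z_def)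
    finally have "norm (single j (a j - z)) < e / 2" by simp
    moreover have d: "(\<Sum>k\<in>insert j S. single k (a k)) - rational_ell2 ((j, p, q) # xs) =
        single j (a j - z) + ((\<Sum>k\<in>S. single k (a k)) - rational_ell2 xs)"
      using insert.hyps linear_diff[OF bounded_linear.linear[OF bounded_linear_single], of j "a j" z]
      by (simp add: z_def)
    ultimately have "norm ((\<Sum>k\<in>insert j S. single k (a k)) - rational_ell2 ((j, p, q) # xs)) < e"
      unfolding d using xs norm_triangle_ineq[of "single j (a j - z)" "(\<Sum>k\<in>S. single k (a k)) - rational_ell2 xs"]
      by linarith
    thus ?case by blast
  qed
  obtain S where S: "finite S" "dist (\<Sum>k\<in>S. single k (coord x k)) x \<le> e / 2"
    using has_sum_finite_approximation[OF has_sum_single, of "e / 2" x] assms by auto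
  obtain xs where xs: "norm ((\<Sum>k\<in>S. single k (coord x k)) - rational_ell2 xs) < e / 2"
    using fin[OF S(1), of "e / 2"] assms by auto
  have "norm (x - rational_ell2 xs) < e"
    using S(2) xs norm_triangle_ineq[of "x - (\<Sum>k\<in>S. single k (coord x k))" "(\<Sum>k\<in>S. single k (coord x k)) - rational_ell2 xs"]
    by (simp add: dist_norm norm_minus_commute)
  thus ?thesis by blast
qed

instance ell2 :: second_countable_topology
proof
  define B where "B = range (\<lambda>(xs, n). ball (rational_ell2 xs) (inverse (real (Suc n))))"
  have "countable B" unfolding B_def by (rule countable_image) simp
  have "topological_basis B"
  proof (rule topological_basisI)
    fix U :: "ell2 set" and x assume "open U" "x \<in> U"
    then obtain e where e: "0 < e" "ball x e \<subseteq> U" using openE by blast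
    obtain n where n: "inverse (real (Suc n)) < e / 2" using reals_Archimedean[of "e / 2"] e by auto
    obtain xs where xs: "norm (x - rational_ell2 xs) < inverse (real (Suc n))"
      using rational_ell2_dense[of "inverse (real (Suc n))" x] by auto
    have "ball (rational_ell2 xs) (inverse (real (Suc n))) \<subseteq> U"
    proof
      fix y assume "y \<in> ball (rational_ell2 xs) (inverse (real (Suc n)))"
      hence "dist x y < e"
        using xs n dist_triangle[of x y "rational_ell2 xs"] by (simp add: dist_norm)
      thus "y \<in> U" using e by auto
    qed
    moreover have "x \<in> ball (rational_ell2 xs) (inverse (real (Suc n)))"
      using xs by (simp add: dist_norm norm_minus_commute)
    ultimately show "\<exists>B'\<in>B. x \<in> B' \<and> B' \<subseteq> U" unfolding B_def by blast
  qed (auto simp: B_def)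
  thus "\<exists>B::ell2 set set. countable B \<and> open = generate_topology B"
    using \<open>countable B\<close> topological_basis_imp_subbasis by blast
qed

section \<open>Operators on the sequence space\<close>

text \<open>
  The building block is a single diagonal of a matrix. A matrix whose entries are dominated by a
  summable function of the distance to the main diagonal is the absolutely convergent sum of its
  diagonals, which bounds its norm without any further estimate.
\<close>

definition diagonal_op :: "int \<Rightarrow> (int \<Rightarrow> complex) \<Rightarrow> ell2 \<Rightarrow> ell2" where
  "diagonal_op d m x = Abs_ell2 (\<lambda>k. m k * coord x (k - d))"

lemma diagonal_op:
  assumes m: "\<And>k. norm (m k) \<le> C"
  shows "coord (diagonal_op d m x) k = m k * coord x (k - d)"
    and "norm (diagonal_op d m x) \<le> C * norm x"
proof -
  have C: "0 \<le> C" using m[of 0] norm_ge_zero order_trans by blast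
  obtain y where y: "\<And>k. coord y k = m k * coord x (k - d)" "norm y \<le> C * norm x"
  proof (rule ell2_of_finite_bound)
    fix S :: "int set" assume S: "finite S"
    have "(\<Sum>k\<in>S. (norm (m k * coord x (k - d)))\<^sup>2) \<le> (\<Sum>k\<in>S. C\<^sup>2 * (norm (coord x (k - d)))\<^sup>2)"
      unfolding norm_mult power_mult_distrib by (intro sum_mono mult_right_mono power_mono m) auto
    also have "\<dots> = C\<^sup>2 * (\<Sum>k\<in>(\<lambda>k. k - d) ` S. (norm (coord x k))\<^sup>2)"
      by (subst sum.reindex) (auto simp: inj_on_def sum_distrib_left)
    also have "\<dots> \<le> C\<^sup>2 * (norm x)\<^sup>2" using S by (intro mult_left_mono sum_coord_le) auto
    finally show "(\<Sum>k\<in>S. (norm (m k * coord x (k - d)))\<^sup>2) \<le> (C * norm x)\<^sup>2"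
      by (simp add: power_mult_distrib)
  qed (use C in auto)
  have "diagonal_op d m x = y"
    unfolding diagonal_op_def by (simp add: y(1)[symmetric] coord_inverse flip: fun_eq_iff)
  thus "coord (diagonal_op d m x) k = m k * coord x (k - d)" "norm (diagonal_op d m x) \<le> C * norm x"
    using y by auto
qed

definition matrix_op :: "(int \<Rightarrow> int \<Rightarrow> complex) \<Rightarrow> ell2 \<Rightarrow> ell2" where
  "matrix_op A x = (\<Sum>\<^sub>\<infinity>d. diagonal_op d (\<lambda>k. A k (k - d)) x)"

locale dominated_matrix =
  fixes A :: "int \<Rightarrow> int \<Rightarrow> complex" and \<kappa> :: "int \<Rightarrow> real"
  assumes dom: "\<And>k l. norm (A k l) \<le> \<kappa> (k - l)" and summable: "\<kappa> summable_on UNIV"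
begin

lemma entry_bound: "norm (A k (k - d)) \<le> \<kappa> d"
  using dom[of k "k - d"] by simp

lemma summable_diagonals: "(\<lambda>d. norm (diagonal_op d (\<lambda>k. A k (k - d)) x)) summable_on UNIV"
  by (rule summable_on_comparison_test[OF summable_on_cmult_left[OF summable]])
     (auto intro: diagonal_op(2)[OF entry_bound])

lemma has_sum_matrix_op:
  "((\<lambda>l. A k l * coord x l) has_sum coord (matrix_op A x) k) UNIV"
proof -
  have "((\<lambda>d. diagonal_op d (\<lambda>k. A k (k - d)) x) has_sum matrix_op A x) UNIV"
    unfolding matrix_op_def by (rule has_sum_infsum[OF abs_summable_summable[OF summable_diagonals]])
  from has_sum_bounded_linear[OF bounded_linear_coord this]
  have "((\<lambda>d. A k (k - d) * coord x (k - d)) has_sum coord (matrix_op A x) k) UNIV"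
    by (simp add: o_def diagonal_op(1)[OF entry_bound])
  moreover have "bij_betw (\<lambda>d. k - d) UNIV (UNIV :: int set)"
    by (rule bij_betwI[where g = "\<lambda>d. k - d"]) auto
  ultimately show ?thesis
    using has_sum_reindex_bij_betw[of "\<lambda>d. k - d" UNIV UNIV "\<lambda>l. A k l * coord x l"] by simp
qed

lemma norm_matrix_op_le: "norm (matrix_op A x) \<le> infsum \<kappa> UNIV * norm x"
proof -
  have "norm (matrix_op A x) \<le> (\<Sum>\<^sub>\<infinity>d. norm (diagonal_op d (\<lambda>k. A k (k - d)) x))"
    unfolding matrix_op_def by (rule norm_infsum_bound[OF summable_diagonals])
  also have "\<dots> \<le> (\<Sum>\<^sub>\<infinity>d. \<kappa> d * norm x)"
    by (intro infsum_mono summable_diagonals summable_on_cmult_left summable diagonal_op(2) entry_bound)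
  also have "\<dots> = infsum \<kappa> UNIV * norm x" by (rule infsum_cmult_left')
  finally show ?thesis .
qed

lemma bounded_linear_matrix_op: "bounded_linear (matrix_op A)"
proof (rule bounded_linear_intro[where K = "infsum \<kappa> UNIV"])
  fix x y :: ell2 and r :: real
  show "matrix_op A (x + y) = matrix_op A x + matrix_op A y"
  proof (rule ell2_eqI)
    fix k
    have "((\<lambda>l. A k l * coord (x + y) l) has_sum (coord (matrix_op A x) k + coord (matrix_op A y) k)) UNIV"
      using has_sum_add[OF has_sum_matrix_op has_sum_matrix_op, of k x k y] by (simp add: distrib_left)
    thus "coord (matrix_op A (x + y)) k = coord (matrix_op A x + matrix_op A y) k"
      using has_sum_unique[OF has_sum_matrix_op] by simp
  qed
  show "matrix_op A (r *\<^sub>R x) = r *\<^sub>R matrix_op A x"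
  proof (rule ell2_eqI)
    fix k
    have "((\<lambda>l. A k l * coord (r *\<^sub>R x) l) has_sum (r *\<^sub>R coord (matrix_op A x) k)) UNIV"
      using has_sum_scaleR[OF has_sum_matrix_op, of r k x] by simp
    thus "coord (matrix_op A (r *\<^sub>R x)) k = coord (r *\<^sub>R matrix_op A x) k"
      using has_sum_unique[OF has_sum_matrix_op] by simp
  qed
  show "norm (matrix_op A x) \<le> norm x * infsum \<kappa> UNIV"
    using norm_matrix_op_le by (simp add: mult.commute)
qed

lemma coord_matrix_op_single: "coord (matrix_op A (single j z)) k = A k j * z"
proof -
  have "((\<lambda>l. A k l * coord (single j z) l) has_sum (A k j * z)) UNIV"
    by (rule has_sum_finite_neutralI[of "{j}"]) (auto simp: coord_single)
  thus ?thesis by (rule has_sum_unique[OF has_sum_matrix_op])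
qed

text \<open>
  Both sides are continuous in \<open>x\<close> and finitely supported sequences are dense.
\<close>

lemma matrix_op_coercive:
  assumes "\<And>S a. finite S \<Longrightarrow> c * (\<Sum>k\<in>S. (norm (a k))\<^sup>2) \<le> Re (\<Sum>k\<in>S. \<Sum>l\<in>S. A k l * a l * cnj (a k))"
  shows "c * (norm x)\<^sup>2 \<le> matrix_op A x \<bullet> x"
proof -
  define y where "y = (\<lambda>S. \<Sum>k\<in>S. single k (coord x k))"
  have fin: "c * (norm (y S))\<^sup>2 \<le> matrix_op A (y S) \<bullet> y S" if S: "finite S" for S
  proof -
    have cy: "coord (y S) k = (if k \<in> S then coord x k else 0)" for k
      using S by (simp add: y_def coord_sum_single)
    have "((\<lambda>k. (norm (coord (y S) k))\<^sup>2) has_sum (\<Sum>k\<in>S. (norm (coord x k))\<^sup>2)) UNIV"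
      by (rule has_sum_finite_neutralI[OF S]) (auto simp: cy)
    hence n: "(norm (y S))\<^sup>2 = (\<Sum>k\<in>S. (norm (coord x k))\<^sup>2)"
      by (rule has_sum_unique[OF has_sum_norm_ell2])
    have m: "coord (matrix_op A (y S)) k = (\<Sum>l\<in>S. A k l * coord x l)" for k
    proof -
      have "((\<lambda>l. A k l * coord (y S) l) has_sum (\<Sum>l\<in>S. A k l * coord x l)) UNIV"
        by (rule has_sum_finite_neutralI[OF S]) (auto simp: cy)
      thus ?thesis by (rule has_sum_unique[OF has_sum_matrix_op])
    qed
    have "matrix_op A (y S) \<bullet> y S = (\<Sum>\<^sub>\<infinity>k. coord (matrix_op A (y S)) k \<bullet> coord (y S) k)"
      by (rule inner_ell2_def)
    also have "\<dots> = (\<Sum>k\<in>S. coord (matrix_op A (y S)) k \<bullet> coord x k)"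
      by (rule infsumI, rule has_sum_finite_neutralI[OF S]) (auto simp: cy)
    also have "\<dots> = (\<Sum>k\<in>S. Re (\<Sum>l\<in>S. A k l * coord x l * cnj (coord x k)))"
    proof (intro sum.cong refl)
      fix k
      have "u \<bullet> v = Re (u * cnj v)" for u v :: complex by (simp add: inner_complex_def)
      thus "coord (matrix_op A (y S)) k \<bullet> coord x k = Re (\<Sum>l\<in>S. A k l * coord x l * cnj (coord x k))"
        by (simp only: m sum_distrib_right)
    qed
    finally show ?thesis using assms[OF S, of "coord x"] by (simp only: n Re_sum)
  qed
  have ylim: "(y \<longlongrightarrow> x) (finite_subsets_at_top UNIV)"
    using has_sum_single[of x] unfolding has_sum_def y_def .
  show ?thesis
  proof (rule tendsto_le)
    show "((\<lambda>S. c * (norm (y S))\<^sup>2) \<longlongrightarrow> c * (norm x)\<^sup>2) (finite_subsets_at_top UNIV)"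
      by (intro tendsto_intros ylim)
    show "((\<lambda>S. matrix_op A (y S) \<bullet> y S) \<longlongrightarrow> matrix_op A x \<bullet> x) (finite_subsets_at_top UNIV)"
      by (intro tendsto_intros ylim bounded_linear.tendsto[OF bounded_linear_matrix_op])
    show "\<forall>\<^sub>F S in finite_subsets_at_top UNIV. c * (norm (y S))\<^sup>2 \<le> matrix_op A (y S) \<bullet> y S"
      by (rule eventually_finite_subsets_at_top_weakI) (simp add: fin)
  qed simp
qed

end

text \<open>
  The map \<open>x \<mapsto> x - \<tau> (B x - y)\<close> with \<open>\<tau> = c/L\<^sup>2\<close>, where \<open>L\<close> is at least the norm of \<open>B\<close> and at least
  \<open>c\<close>, is a contraction.
\<close>

lemma lax_milgram:
  fixes B :: "'a::{real_inner,complete_space} \<Rightarrow> 'a"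
  assumes B: "bounded_linear B" and c: "0 < c" "\<And>x. c * (norm x)\<^sup>2 \<le> B x \<bullet> x"
  shows "\<exists>x. B x = y \<and> norm x \<le> norm y / c"
proof -
  interpret B: bounded_linear B by fact
  obtain K where K: "0 < K" "\<And>x. norm (B x) \<le> norm x * K" using B.pos_bounded by blast
  define L where "L = max K c"
  have "norm x * K \<le> L * norm x" for x
    unfolding L_def mult.commute[of "norm x"] by (rule mult_right_mono) auto
  hence L: "0 < L" "c \<le> L" "norm (B x) \<le> L * norm x" for x
    using K(1) order_trans[OF K(2)[of x], of "L * norm x"] by (auto simp: L_def)
  define \<tau> where "\<tau> = c / L\<^sup>2"
  define q where "q = sqrt (1 - c\<^sup>2 / L\<^sup>2)"
  have \<tau>: "0 < \<tau>" using c L by (simp add: \<tau>_def)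
  have "0 < c\<^sup>2 / L\<^sup>2" "c\<^sup>2 / L\<^sup>2 \<le> 1" using c L by (auto intro: power_mono)
  hence q: "0 \<le> q" "q < 1" "q\<^sup>2 = 1 - c\<^sup>2 / L\<^sup>2" by (simp_all add: q_def)
  have contr: "norm (x - \<tau> *\<^sub>R B x) \<le> q * norm x" for x
  proof -
    have "(norm (x - \<tau> *\<^sub>R B x))\<^sup>2 = (norm x)\<^sup>2 - 2 * \<tau> * (B x \<bullet> x) + \<tau>\<^sup>2 * (norm (B x))\<^sup>2"
      unfolding power2_norm_eq_inner
      by (simp add: inner_diff_left inner_diff_right inner_commute power2_eq_square algebra_simps)
    also have "\<dots> \<le> (norm x)\<^sup>2 - 2 * \<tau> * (c * (norm x)\<^sup>2) + \<tau>\<^sup>2 * (L * norm x)\<^sup>2"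
      using \<tau> by (intro add_mono diff_mono mult_left_mono c power_mono L) auto
    also have "\<dots> = (1 - 2 * \<tau> * c + \<tau>\<^sup>2 * L\<^sup>2) * (norm x)\<^sup>2"
      by (simp add: algebra_simps power_mult_distrib)
    also have "1 - 2 * \<tau> * c + \<tau>\<^sup>2 * L\<^sup>2 = q\<^sup>2"
      unfolding q(3) \<tau>_def using L(1) by (simp add: power2_eq_square field_simps)
    finally have "(norm (x - \<tau> *\<^sub>R B x))\<^sup>2 \<le> (q * norm x)\<^sup>2" by (simp add: power_mult_distrib)
    thus ?thesis using q by (simp add: power2_le_iff_abs_le)
  qed
  have "\<exists>!x. x - \<tau> *\<^sub>R (B x - y) = x"
  proof (rule banach_fix_type[OF q(1,2)], intro allI)
    fix x z
    have "dist (x - \<tau> *\<^sub>R (B x - y)) (z - \<tau> *\<^sub>R (B z - y)) = norm ((x - z) - \<tau> *\<^sub>R B (x - z))"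
      by (simp add: dist_norm B.diff algebra_simps)
    also have "\<dots> \<le> q * norm (x - z)" by (rule contr)
    finally show "dist (x - \<tau> *\<^sub>R (B x - y)) (z - \<tau> *\<^sub>R (B z - y)) \<le> q * dist x z"
      by (simp add: dist_norm)
  qed
  then obtain x where "x - \<tau> *\<^sub>R (B x - y) = x" by blast
  hence x: "B x = y" using \<tau> by simp
  have "c * norm x * norm x \<le> norm y * norm x"
    using order_trans[OF c(2)[of x] norm_cauchy_schwarz] by (simp add: x power2_eq_square mult.assoc)
  hence "norm x \<le> norm y / c"
    using c(1) by (cases "x = 0") (auto simp: field_simps)
  with x show ?thesis by blast
qed

definition phase_op :: "(int \<Rightarrow> real) \<Rightarrow> real \<Rightarrow> ell2 \<Rightarrow> ell2" where
  "phase_op \<theta> t = diagonal_op 0 (\<lambda>k. cis (\<theta> k * t))"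

lemma coord_phase_op [simp]: "coord (phase_op \<theta> t x) k = cis (\<theta> k * t) * coord x k"
  using diagonal_op(1)[of "\<lambda>k. cis (\<theta> k * t)" 1 0 x k] by (simp add: phase_op_def)

lemma norm_phase_op [simp]: "norm (phase_op \<theta> t x) = norm x"
proof -
  have "((\<lambda>k. (norm (coord (phase_op \<theta> t x) k))\<^sup>2) has_sum (norm x)\<^sup>2) UNIV"
    using has_sum_norm_ell2[of x] by (simp add: norm_mult)
  hence "(norm (phase_op \<theta> t x))\<^sup>2 = (norm x)\<^sup>2" by (rule has_sum_unique[OF has_sum_norm_ell2])
  thus ?thesis by simp
qed

lemma phase_op_add: "phase_op \<theta> t (x + y) = phase_op \<theta> t x + phase_op \<theta> t y"
  and phase_op_diff: "phase_op \<theta> t (x - y) = phase_op \<theta> t x - phase_op \<theta> t y"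
  and phase_op_scaleR: "phase_op \<theta> t (r *\<^sub>R x) = r *\<^sub>R phase_op \<theta> t x"
  by (rule ell2_eqI, simp add: algebra_simps)+

lemma phase_op_phase_op: "phase_op \<theta> s (phase_op \<theta> t x) = phase_op \<theta> (s + t) x"
  by (rule ell2_eqI) (simp add: algebra_simps cis_mult flip: mult.assoc)

lemma bounded_linear_phase_op: "bounded_linear (phase_op \<theta> t)"
  by (rule bounded_linear_intro[where K = 1]) (simp_all add: phase_op_add phase_op_scaleR)

lemma phase_op_single: "phase_op \<theta> t (single k z) = single k (cis (\<theta> k * t) * z)"
  by (rule ell2_eqI) (simp add: coord_single)

text \<open>
  Clear for finitely supported sequences; they approximate \<open>x\<close> uniformly in time because the phases
  act by isometries.
\<close>

lemma continuous_phase_op_fixed: "continuous_on UNIV (\<lambda>t. phase_op \<theta> t x)"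
proof (rule uniform_limit_theorem)
  define y where "y = (\<lambda>S. \<Sum>k\<in>S. single k (coord x k))"
  show "\<forall>\<^sub>F S in finite_subsets_at_top UNIV. continuous_on UNIV (\<lambda>t. phase_op \<theta> t (y S))"
  proof (rule eventually_finite_subsets_at_top_weakI)
    fix S :: "int set" assume "finite S"
    have "phase_op \<theta> t (y S) = (\<Sum>k\<in>S. single k (cis (\<theta> k * t) * coord x k))" for t
      unfolding y_def by (simp add: linear_sum[OF bounded_linear.linear[OF bounded_linear_phase_op]] phase_op_single)
    moreover have "continuous_on UNIV (\<lambda>t. \<Sum>k\<in>S. single k (cis (\<theta> k * t) * coord x k))"
      by (intro continuous_intros continuous_on_cis bounded_linear.continuous_on[OF bounded_linear_single])
    ultimately show "continuous_on UNIV (\<lambda>t. phase_op \<theta> t (y S))" by simp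
  qed
  show "uniform_limit UNIV (\<lambda>S t. phase_op \<theta> t (y S)) (\<lambda>t. phase_op \<theta> t x) (finite_subsets_at_top UNIV)"
  proof (rule uniform_limitI)
    fix e :: real assume "0 < e"
    have "(y \<longlongrightarrow> x) (finite_subsets_at_top UNIV)"
      using has_sum_single[of x] unfolding has_sum_def y_def .
    from tendstoD[OF this \<open>0 < e\<close>]
    show "\<forall>\<^sub>F S in finite_subsets_at_top UNIV. \<forall>t\<in>UNIV. dist (phase_op \<theta> t (y S)) (phase_op \<theta> t x) < e"
      by eventually_elim (simp add: dist_norm flip: phase_op_diff)
  qed
qed simp

lemma continuous_on_phase_op:
  assumes "continuous_on S f" "continuous_on S F"
  shows "continuous_on S (\<lambda>t. phase_op \<theta> (f t) (F t))"
  unfolding continuous_on_def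
proof
  fix r assume r: "r \<in> S"
  have F: "(F \<longlongrightarrow> F r) (at r within S)" using assms(2) r by (simp add: continuous_on_def)
  have "((\<lambda>t. phase_op \<theta> (f t) (F t - F r)) \<longlongrightarrow> 0) (at r within S)"
    using tendsto_norm_zero[OF LIM_zero[OF F]] by (subst tendsto_norm_zero_iff[symmetric]) simp
  moreover have "continuous_on S (\<lambda>t. phase_op \<theta> (f t) (F r))"
    by (rule continuous_on_compose2[OF continuous_phase_op_fixed assms(1)]) simp
  hence "((\<lambda>t. phase_op \<theta> (f t) (F r)) \<longlongrightarrow> phase_op \<theta> (f r) (F r)) (at r within S)"
    using r by (simp add: continuous_on_def)
  ultimately have "((\<lambda>t. phase_op \<theta> (f t) (F t - F r) + phase_op \<theta> (f t) (F r)) \<longlongrightarrow> 0 + phase_op \<theta> (f r) (F r)) (at r within S)"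
    by (rule tendsto_add)
  thus "((\<lambda>t. phase_op \<theta> (f t) (F t)) \<longlongrightarrow> phase_op \<theta> (f r) (F r)) (at r within S)"
    by (simp flip: phase_op_add)
qed

section \<open>Sobolev spaces as sequence spaces\<close>

locale sobolev =
  fixes s :: real
  assumes s_nonneg: "0 \<le> s"
begin

text \<open>
  The square root of the weight in the norm of \<open>H\<^sup>s\<close>; dividing a square-summable sequence by it gives
  the Fourier coefficients of an element of \<open>H\<^sup>s\<close> of the same norm.
\<close>

definition factor :: "int \<Rightarrow> real" where
  "factor k = sqrt (2 * pi * (1 + (real_of_int \<bar>k\<bar>)\<^sup>2) powr s)"

lemma factor_ge_1: "1 \<le> factor k"
proof -
  have "1 \<le> (1 + (real_of_int \<bar>k\<bar>)\<^sup>2) powr s" using s_nonneg by (intro ge_one_powr_ge_zero) auto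
  moreover have "1 \<le> 2 * pi" using pi_gt3 by simp
  ultimately have "1 * 1 \<le> 2 * pi * (1 + (real_of_int \<bar>k\<bar>)\<^sup>2) powr s" by (intro mult_mono) auto
  thus ?thesis by (simp add: factor_def)
qed

lemma factor_pos [simp]: "0 < factor k" "factor k \<noteq> 0"
  using factor_ge_1[of k] by linarith+

lemma factor_square: "(factor k)\<^sup>2 = 2 * pi * (1 + (real_of_int \<bar>k\<bar>)\<^sup>2) powr s"
proof -
  have "0 \<le> 2 * pi * (1 + (real_of_int \<bar>k\<bar>)\<^sup>2) powr s" by simp
  thus ?thesis unfolding factor_def by (rule real_sqrt_pow2)
qed

definition of_ell2 :: "ell2 \<Rightarrow> pdist" where
  "of_ell2 x = (SOME f. \<forall>k. fourier f k = coord x k / of_real (factor k))"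

lemma fourier_of_ell2: "fourier (of_ell2 x) k = coord x k / of_real (factor k)"
proof -
  have "norm (coord x k / of_real (factor k)) \<le> norm x" for k
  proof -
    have "norm (coord x k / of_real (factor k)) = norm (coord x k) / factor k"
      by (simp add: norm_divide abs_of_pos)
    also have "\<dots> \<le> norm (coord x k) / 1" using factor_ge_1 by (intro divide_left_mono) auto
    also have "\<dots> \<le> norm x" by (simp add: norm_coord_le)
    finally show ?thesis .
  qed
  then obtain f where "\<And>k. fourier f k = coord x k / of_real (factor k)"
    using pdist_of_bounded_coefficients[of "\<lambda>k. coord x k / of_real (factor k)"] by metis
  hence "\<exists>f. \<forall>k. fourier f k = coord x k / of_real (factor k)" by blast
  from someI_ex[OF this] show ?thesis unfolding of_ell2_def by blast
qed

lemma of_ell2_add: "of_ell2 (x + y) = of_ell2 x + of_ell2 y"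
  and of_ell2_diff: "of_ell2 (x - y) = of_ell2 x - of_ell2 y"
  and of_ell2_scaleR: "of_ell2 (r *\<^sub>R x) = r *\<^sub>R of_ell2 x"
  by (rule pdist_eqI; simp add: fourier_of_ell2 fourier_add fourier_diff fourier_scaleR
      add_divide_distrib diff_divide_distrib scaleR_conv_of_real)+

lemma linear_of_ell2: "linear of_ell2"
  by (rule linearI) (simp_all add: of_ell2_add of_ell2_scaleR)

lemma Hs_term: "2 * pi * ((1 + (real_of_int \<bar>k\<bar>)\<^sup>2) powr s * (norm (fourier f k))\<^sup>2) =
    (norm (fourier f k * of_real (factor k)))\<^sup>2"
  by (simp only: norm_mult power_mult_distrib norm_of_real power2_abs factor_square mult_ac)

lemma Hs_norm_of_ell2: "of_ell2 x \<in> Hs s" "Hs_norm s (of_ell2 x) = norm x"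
proof -
  have t: "(1 + (real_of_int \<bar>k\<bar>)\<^sup>2) powr s * (norm (fourier (of_ell2 x) k))\<^sup>2 =
      (1 / (2 * pi)) * (norm (coord x k))\<^sup>2" for k
  proof -
    have "2 * pi * ((1 + (real_of_int \<bar>k\<bar>)\<^sup>2) powr s * (norm (fourier (of_ell2 x) k))\<^sup>2) = (norm (coord x k))\<^sup>2"
      unfolding Hs_term by (simp add: fourier_of_ell2)
    thus ?thesis by (simp add: field_simps)
  qed
  have "((\<lambda>k. (1 / (2 * pi)) * (norm (coord x k))\<^sup>2) has_sum (1 / (2 * pi)) * (norm x)\<^sup>2) UNIV"
    by (intro has_sum_cmult_right has_sum_norm_ell2)
  hence "((\<lambda>k. (1 + (real_of_int \<bar>k\<bar>)\<^sup>2) powr s * (norm (fourier (of_ell2 x) k))\<^sup>2) has_sum (1 / (2 * pi)) * (norm x)\<^sup>2) UNIV"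
    by (simp only: t)
  thus "of_ell2 x \<in> Hs s" "Hs_norm s (of_ell2 x) = norm x"
    by (auto simp: Hs_def Hs_norm_def has_sum_imp_summable infsumI)
qed

lemma of_ell2_inject: "of_ell2 x = of_ell2 y \<longleftrightarrow> x = y"
proof
  assume "of_ell2 x = of_ell2 y"
  hence "norm (x - y) = Hs_norm s (of_ell2 y - of_ell2 y)"
    by (simp add: Hs_norm_of_ell2(2)[symmetric] of_ell2_diff)
  also have "\<dots> = norm (y - y)" by (simp only: of_ell2_diff[symmetric] Hs_norm_of_ell2(2))
  finally show "x = y" by simp
qed simp

lemma Hs_conv_of_ell2:
  assumes "f \<in> Hs s" obtains x where "f = of_ell2 x"
proof -
  have "(\<lambda>k. 2 * pi * ((1 + (real_of_int \<bar>k\<bar>)\<^sup>2) powr s * (norm (fourier f k))\<^sup>2)) summable_on UNIV"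
    using assms unfolding Hs_def by (intro summable_on_cmult_right) simp
  hence "(\<lambda>k. (norm (fourier f k * of_real (factor k)))\<^sup>2) summable_on UNIV"
    by (simp only: Hs_term)
  hence "coord (Abs_ell2 (\<lambda>k. fourier f k * of_real (factor k))) = (\<lambda>k. fourier f k * of_real (factor k))"
    by (intro Abs_ell2_inverse) simp
  hence "f = of_ell2 (Abs_ell2 (\<lambda>k. fourier f k * of_real (factor k)))"
    by (intro pdist_eqI) (simp add: fourier_of_ell2)
  thus thesis by (rule that)
qed

text \<open>
  Since \<open>of_ell2\<close> is a linear isometry onto \<open>H\<^sup>s\<close>, the spelled-out notions of measurability and
  integral are those of the Bochner theory of the separable Hilbert space.
\<close>

lemma simple_of_ell2:
  assumes "Bochner_Integration.simple_bochner_integrable M S"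
  shows "Hs_simple s M (\<lambda>t. of_ell2 (S t))"
  unfolding Hs_simple_def
  using simple_bochner_integrable_compose2[OF _ assms assms, where p = "\<lambda>x y. of_ell2 x"]
    linear_0[OF linear_of_ell2] Hs_norm_of_ell2(1) by simp

lemma Hs_measurable_of_ell2:
  assumes "finite_measure M" and F: "F \<in> borel_measurable M"
  shows "Hs_measurable s M (\<lambda>t. of_ell2 (F t))"
proof -
  interpret finite_measure M by fact
  obtain S where S: "\<And>i. simple_function M (S i)" "\<And>t. t \<in> space M \<Longrightarrow> (\<lambda>i. S i t) \<longlonglongrightarrow> F t"
    using borel_measurable_implies_sequence_metric[OF F, of 0] by metis
  have "Bochner_Integration.simple_bochner_integrable M (S i)" for i
    by (rule Bochner_Integration.simple_bochner_integrable.intros[OF S(1)]) (simp add: emeasure_eq_measure)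
  moreover have "(\<lambda>n. Hs_norm s (of_ell2 (F t) - of_ell2 (S n t))) \<longlonglongrightarrow> 0" if "t \<in> space M" for t
  proof -
    have "(\<lambda>n. norm (S n t - F t)) \<longlonglongrightarrow> 0"
      using S(2)[OF that] by (intro tendsto_norm_zero LIM_zero)
    thus ?thesis by (simp add: Hs_norm_of_ell2(2) norm_minus_commute flip: of_ell2_diff)
  qed
  ultimately show ?thesis
    unfolding Hs_measurable_def
    by (intro conjI ballI Hs_norm_of_ell2(1) exI[of _ "\<lambda>n t. of_ell2 (S n t)"] allI simple_of_ell2 AE_I2)
qed

lemma has_Hs_integral_of_ell2:
  assumes "finite_measure M" and F: "has_bochner_integral M F I"
  shows "has_Hs_integral s M (\<lambda>t. of_ell2 (F t)) J \<longleftrightarrow> J = of_ell2 I"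
proof
  assume "J = of_ell2 I"
  from F have "\<exists>S. F \<in> borel_measurable M \<and> (\<forall>i. Bochner_Integration.simple_bochner_integrable M (S i)) \<and>
      (\<lambda>i. \<integral>\<^sup>+t. norm (F t - S i t) \<partial>M) \<longlonglongrightarrow> 0 \<and>
      (\<lambda>i. Bochner_Integration.simple_bochner_integral M (S i)) \<longlonglongrightarrow> I"
    by cases blast
  then obtain S where S: "F \<in> borel_measurable M" "\<And>i. Bochner_Integration.simple_bochner_integrable M (S i)"
    "(\<lambda>i. \<integral>\<^sup>+t. norm (F t - S i t) \<partial>M) \<longlonglongrightarrow> 0"
    "(\<lambda>i. Bochner_Integration.simple_bochner_integral M (S i)) \<longlonglongrightarrow> I"
    by blast
  have "(\<lambda>n. Hs_norm s (Bochner_Integration.simple_bochner_integral M (\<lambda>t. of_ell2 (S n t)) - of_ell2 I)) \<longlonglongrightarrow> 0"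
    using tendsto_norm_zero[OF LIM_zero[OF S(4)]]
    by (simp add: simple_bochner_integral_linear[OF linear_of_ell2 S(2)] Hs_norm_of_ell2(2) flip: of_ell2_diff)
  moreover have "(\<lambda>n. \<integral>\<^sup>+t. ennreal (Hs_norm s (of_ell2 (F t) - of_ell2 (S n t))) \<partial>M) \<longlonglongrightarrow> 0"
    using S(3) by (simp add: Hs_norm_of_ell2(2) flip: of_ell2_diff)
  ultimately show "has_Hs_integral s M (\<lambda>t. of_ell2 (F t)) J"
    unfolding has_Hs_integral_def \<open>J = of_ell2 I\<close>
    by (intro conjI Hs_norm_of_ell2(1) Hs_measurable_of_ell2 assms(1) S(1)
        exI[of _ "\<lambda>n t. of_ell2 (S n t)"] allI simple_of_ell2 S(2))
next
  assume "has_Hs_integral s M (\<lambda>t. of_ell2 (F t)) J"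
  then obtain S where J: "J \<in> Hs s" and S: "\<And>n. Hs_simple s M (S n)"
    "(\<lambda>n. \<integral>\<^sup>+t. ennreal (Hs_norm s (of_ell2 (F t) - S n t)) \<partial>M) \<longlonglongrightarrow> 0"
    "(\<lambda>n. Hs_norm s (Bochner_Integration.simple_bochner_integral M (S n) - J)) \<longlonglongrightarrow> 0"
    by (auto simp: has_Hs_integral_def)
  obtain x where x: "J = of_ell2 x" using J by (rule Hs_conv_of_ell2)
  define S' where "S' = (\<lambda>n t. inv of_ell2 (S n t))"
  have inv: "inv of_ell2 (of_ell2 y) = y" for y
    by (rule inv_f_f) (simp add: inj_def of_ell2_inject)
  have S': "S n t = of_ell2 (S' n t)" if "t \<in> space M" for n t
  proof -
    have "S n t \<in> Hs s" using S(1) that by (simp add: Hs_simple_def)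
    then obtain y where "S n t = of_ell2 y" by (rule Hs_conv_of_ell2)
    thus ?thesis by (simp add: S'_def inv)
  qed
  have int': "Bochner_Integration.simple_bochner_integrable M (S' n)" for n
  proof -
    have "inv of_ell2 0 = 0" using inv[of 0] linear_0[OF linear_of_ell2] by simp
    thus ?thesis unfolding S'_def
      using simple_bochner_integrable_compose2[where p = "\<lambda>x y. inv of_ell2 x" and f = "S n" and g = "S n" and M = M] S(1)
      by (simp add: Hs_simple_def)
  qed
  have ie: "Bochner_Integration.simple_bochner_integral M (S n) = of_ell2 (Bochner_Integration.simple_bochner_integral M (S' n))" for n
  proof -
    have "Bochner_Integration.simple_bochner_integral M (S n) = Bochner_Integration.simple_bochner_integral M (\<lambda>t. of_ell2 (S' n t))"
      unfolding simple_bochner_integral_def using S'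
      by (intro sum.cong) (auto intro!: image_cong arg_cong2[where f = scaleR] arg_cong[where f = "measure M"])
    thus ?thesis by (simp add: simple_bochner_integral_linear[OF linear_of_ell2 int'])
  qed
  have "has_bochner_integral M F x"
  proof (rule has_bochner_integral.intros[OF borel_measurable_has_bochner_integral[OF F] int'])
    have "(\<integral>\<^sup>+t. ennreal (Hs_norm s (of_ell2 (F t) - S n t)) \<partial>M) = (\<integral>\<^sup>+t. ennreal (norm (F t - S' n t)) \<partial>M)" for n
      by (intro nn_integral_cong) (simp add: S' Hs_norm_of_ell2(2) flip: of_ell2_diff)
    thus "(\<lambda>n. \<integral>\<^sup>+t. ennreal (norm (F t - S' n t)) \<partial>M) \<longlonglongrightarrow> 0" using S(2) by simp
    have "(\<lambda>n. norm (Bochner_Integration.simple_bochner_integral M (S' n) - x)) \<longlonglongrightarrow> 0"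
      using S(3) by (simp add: ie x Hs_norm_of_ell2(2) flip: of_ell2_diff)
    thus "(\<lambda>n. Bochner_Integration.simple_bochner_integral M (S' n)) \<longlonglongrightarrow> x"
      by (simp add: tendsto_norm_zero_iff LIM_zero_iff)
  qed
  thus "J = of_ell2 I" using has_bochner_integral_eq[OF _ F] x by blast
qed

end

text \<open>
  The Bochner integral of a continuous function exists; it agrees with the Henstock-Kurzweil
  integral because coordinatewise both are the integral of a complex-valued function.
\<close>

lemma has_bochner_integral_continuous:
  fixes F :: "real \<Rightarrow> ell2"
  assumes F: "continuous_on {a..b} F"
  shows "has_bochner_integral (lebesgue_on {a..b}) F (integral {a..b} F)"
proof -
  have fm: "finite_measure (lebesgue_on {a..b})" by (rule finite_measure_lebesgue_on) simp
  have "bounded (F ` {a..b})" by (intro compact_imp_bounded compact_continuous_image F) simp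
  then obtain B where "\<forall>x\<in>F ` {a..b}. norm x \<le> B" unfolding bounded_iff ..
  hence B: "norm (F t) \<le> B" if "t \<in> {a..b}" for t using that by blast
  have int: "integrable (lebesgue_on {a..b}) F"
    by (rule finite_measure.integrable_const_bound[OF fm, of _ B])
       (auto intro!: AE_I2 B continuous_imp_measurable_on_sets_lebesgue F)
  have "integral\<^sup>L (lebesgue_on {a..b}) F = integral {a..b} F"
  proof (rule ell2_eqI)
    fix k
    have "coord (integral\<^sup>L (lebesgue_on {a..b}) F) k = integral\<^sup>L (lebesgue_on {a..b}) (\<lambda>t. coord (F t) k)"
      by (rule integral_bounded_linear[OF bounded_linear_coord int, symmetric])
    also have "\<dots> = integral {a..b} (\<lambda>t. coord (F t) k)"
      by (intro lebesgue_integral_eq_integral integrable_bounded_linear[OF bounded_linear_coord int]) simp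
    also have "\<dots> = coord (integral {a..b} F) k"
      using integral_linear[OF integrable_continuous_real[OF F] bounded_linear_coord, of k] by (simp add: o_def)
    finally show "coord (integral\<^sup>L (lebesgue_on {a..b}) F) k = coord (integral {a..b} F) k" .
  qed
  with has_bochner_integral_integrable[OF int] show ?thesis by simp
qed

section \<open>Solving the control equation in a weighted space\<close>

lemma weight_quotient_le:
  fixes k l :: int
  shows "(1 + (real_of_int \<bar>k\<bar>)\<^sup>2) / (1 + (real_of_int \<bar>l\<bar>)\<^sup>2) \<le> 2 * (weight (k - l))\<^sup>2"
proof -
  define x y where "x = real_of_int l" and "y = real_of_int (k - l)"
  have k: "real_of_int k = x + y" by (simp add: x_def y_def)
  have "(x + y)\<^sup>2 \<le> 2 * x\<^sup>2 + 2 * y\<^sup>2" using norm_diff_squared_le[of x "- y"] by simp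
  moreover have "0 \<le> x\<^sup>2 * y\<^sup>2" by simp
  moreover have "2 * (1 + y\<^sup>2) * (1 + x\<^sup>2) = 2 + 2 * x\<^sup>2 + 2 * y\<^sup>2 + 2 * (x\<^sup>2 * y\<^sup>2)"
    by (simp add: algebra_simps)
  ultimately have "1 + (x + y)\<^sup>2 \<le> 2 * (1 + y\<^sup>2) * (1 + x\<^sup>2)" by linarith
  also have w: "1 + y\<^sup>2 \<le> (weight (k - l))\<^sup>2"
  proof -
    have "(weight (k - l))\<^sup>2 = 1 + 2 * \<bar>y\<bar> + y\<^sup>2"
      unfolding weight_def y_def power2_sum power2_abs by simp
    thus ?thesis by simp
  qed
  hence "2 * (1 + y\<^sup>2) * (1 + x\<^sup>2) \<le> 2 * (weight (k - l))\<^sup>2 * (1 + x\<^sup>2)"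
    by (intro mult_right_mono) auto
  finally have "1 + (real_of_int \<bar>k\<bar>)\<^sup>2 \<le> 2 * (weight (k - l))\<^sup>2 * (1 + (real_of_int \<bar>l\<bar>)\<^sup>2)"
    by (simp add: k x_def)
  moreover have "0 < 1 + (real_of_int \<bar>l\<bar>)\<^sup>2" by (simp add: add_pos_nonneg)
  ultimately show ?thesis by (simp only: pos_divide_le_eq)
qed

text \<open>
  Flattening a polynomial weight by a small factor \<open>\<epsilon>\<close> changes neither the space nor, up to
  constants, its norm, but makes the ratio of neighbouring weights close to \<open>1\<close>.
\<close>

definition slow_weight :: "real \<Rightarrow> real \<Rightarrow> int \<Rightarrow> real" where
  "slow_weight s \<epsilon> k = (1 + \<epsilon> * \<bar>of_int k\<bar>) powr s"

lemma slow_weight_pos: "0 \<le> \<epsilon> \<Longrightarrow> 0 < slow_weight s \<epsilon> k"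
proof -
  assume "0 \<le> \<epsilon>"
  hence "0 \<le> \<epsilon> * \<bar>of_int k\<bar>" by simp
  hence "1 + \<epsilon> * \<bar>of_int k\<bar> \<noteq> 0" by linarith
  thus ?thesis by (simp add: slow_weight_def)
qed

lemma power_minus_1_scaled:
  fixes y \<epsilon> :: real
  assumes "0 \<le> \<epsilon>" "\<epsilon> \<le> 1" "0 \<le> y"
  shows "(1 + \<epsilon> * y) ^ m - 1 \<le> \<epsilon> * ((1 + y) ^ m - 1)"
proof (induction m)
  case (Suc m)
  have "\<epsilon> * y \<le> 1 * y" by (rule mult_right_mono[OF assms(2,3)])
  hence p: "(1 + \<epsilon> * y) ^ m \<le> (1 + y) ^ m" using assms by (intro power_mono) auto
  have "(1 + \<epsilon> * y) ^ Suc m - 1 = ((1 + \<epsilon> * y) ^ m - 1) + \<epsilon> * y * (1 + \<epsilon> * y) ^ m"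
    by (simp add: algebra_simps)
  also have "\<dots> \<le> \<epsilon> * ((1 + y) ^ m - 1) + \<epsilon> * y * (1 + y) ^ m"
    using Suc p assms by (intro add_mono mult_left_mono) auto
  also have "\<dots> = \<epsilon> * ((1 + y) ^ Suc m - 1)" by (simp add: algebra_simps)
  finally show ?case .
qed simp

text \<open>
  The ratio \<open>r\<close> and its inverse are at most \<open>q\<^sup>m\<close> with \<open>q = 1 + \<epsilon>|k - l|\<close>, and \<open>r + 1/r \<ge> 2\<close>, so
  \<open>|r - 1| \<le> q\<^sup>m - 1\<close>. Convexity in \<open>\<epsilon>\<close> makes this bound linear in \<open>\<epsilon>\<close>.
\<close>

lemma slow_weight_ratio:
  assumes \<epsilon>: "0 \<le> \<epsilon>" "\<epsilon> \<le> 1" and s: "0 \<le> s" "s \<le> real m"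
  shows "\<bar>slow_weight s \<epsilon> k / slow_weight s \<epsilon> l - 1\<bar> \<le> \<epsilon> * weight (k - l) ^ m"
proof -
  define a b d where "a = 1 + \<epsilon> * \<bar>real_of_int k\<bar>" and "b = 1 + \<epsilon> * \<bar>real_of_int l\<bar>" and "d = \<bar>real_of_int (k - l)\<bar>"
  define q where "q = 1 + \<epsilon> * d"
  have ab: "1 \<le> a" "1 \<le> b" "1 \<le> q" using \<epsilon> by (simp_all add: a_def b_def q_def d_def)
  have step: "1 + \<epsilon> * x \<le> q * (1 + \<epsilon> * y)" if "x \<le> y + d" "0 \<le> y" for x y
  proof -
    have "\<epsilon> * x \<le> \<epsilon> * (y + d)" using that \<epsilon> by (intro mult_left_mono) auto
    moreover have "0 \<le> (\<epsilon> * d) * (\<epsilon> * y)" using that \<epsilon> by (simp add: d_def)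
    ultimately show ?thesis by (simp add: q_def algebra_simps)
  qed
  have "a \<le> q * b" "b \<le> q * a" unfolding a_def b_def by (intro step; simp add: d_def)+
  hence v: "a / b \<le> q" "b / a \<le> q" using ab by (simp_all add: pos_divide_le_eq)
  have Q: "x powr s \<le> q ^ m" if "0 < x" "x \<le> q" for x
  proof -
    have "x powr s \<le> q powr s" using that s by (intro powr_mono2) auto
    also have "\<dots> \<le> q powr real m" using s ab by (intro powr_mono) auto
    also have "\<dots> = q ^ m" using ab by (simp add: powr_realpow)
    finally show ?thesis .
  qed
  define r where "r = slow_weight s \<epsilon> k / slow_weight s \<epsilon> l"
  have r: "r = (a / b) powr s" "inverse r = (b / a) powr s"
    using ab by (simp_all add: r_def slow_weight_def a_def b_def powr_divide)
  have p: "0 < a / b" "0 < b / a" using ab by auto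
  have up: "r \<le> q ^ m" "inverse r \<le> q ^ m" "0 < r"
  proof -
    show "r \<le> q ^ m" unfolding r(1) by (rule Q[OF p(1) v(1)])
    show "inverse r \<le> q ^ m" unfolding r(2) by (rule Q[OF p(2) v(2)])
    show "0 < r" unfolding r(1) using ab by simp
  qed
  have "2 \<le> r + inverse r"
  proof -
    have "0 \<le> (r - 1)\<^sup>2 / r" using up by simp
    also have "\<dots> = r + inverse r - 2" using up(3) by (simp add: power2_eq_square field_simps)
    finally show ?thesis by simp
  qed
  hence "\<bar>r - 1\<bar> \<le> q ^ m - 1" using up by linarith
  also have "\<dots> \<le> \<epsilon> * ((1 + d) ^ m - 1)"
    unfolding q_def using \<epsilon> by (intro power_minus_1_scaled) (auto simp: d_def)
  also have "\<dots> \<le> \<epsilon> * weight (k - l) ^ m"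
    using \<epsilon> by (intro mult_left_mono) (auto simp: weight_def d_def)
  finally show ?thesis by (simp add: r_def)
qed

locale control_problem = control_density g + sobolev s for g :: "real \<Rightarrow> real" and s :: real +
  fixes T :: real
  assumes T_pos: "0 < T"
begin

definition order_bound :: nat where
  "order_bound = nat \<lceil>s\<rceil>"

lemma order_bound: "s \<le> real order_bound"
  using s_nonneg unfolding order_bound_def by linarith

lemma factor_ratio_le: "factor k / factor l \<le> 2 ^ order_bound * weight (k - l) ^ (2 * order_bound)"
proof -
  define v where "v = 2 * (weight (k - l))\<^sup>2"
  have v1: "1 \<le> v" unfolding v_def using one_le_power[OF weight_ge_1, of "k - l" 2] by linarith
  have pos: "0 < 1 + (real_of_int \<bar>j\<bar>)\<^sup>2" for j by (simp add: add_pos_nonneg)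
  have "(factor k / factor l)\<^sup>2 = ((1 + (real_of_int \<bar>k\<bar>)\<^sup>2) / (1 + (real_of_int \<bar>l\<bar>)\<^sup>2)) powr s"
    by (simp add: power_divide factor_square powr_divide)
  also have "\<dots> \<le> v powr s"
    using s_nonneg weight_quotient_le[of k l] pos[of k] pos[of l] unfolding v_def
    by (intro powr_mono2) (auto intro: divide_nonneg_nonneg)
  also have "\<dots> \<le> v powr real order_bound" using order_bound v1 by (intro powr_mono) auto
  also have "\<dots> = v ^ order_bound" using v1 by (simp add: powr_realpow)
  also have "\<dots> \<le> (v ^ order_bound)\<^sup>2"
    using one_le_power[OF v1, of order_bound] by (simp add: power2_eq_square)
  finally have "factor k / factor l \<le> v ^ order_bound"
    by (rule power2_le_imp_le) (use v1 in simp)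
  thus ?thesis by (simp add: v_def power_mult_distrib power_mult)
qed

definition control_entry :: "int \<Rightarrow> int \<Rightarrow> complex" where
  "control_entry k l = control_matrix g k l / (2 * pi) * of_real (factor k / factor l)"

definition gramian_entry :: "nat \<Rightarrow> real \<Rightarrow> int \<Rightarrow> int \<Rightarrow> complex" where
  "gramian_entry n \<alpha> k l = gramian g T n \<alpha> k l * of_real (factor k / factor l)"

lemma norm_rescaled_entry_le:
  fixes z :: complex
  assumes "norm z \<le> C * inverse (weight (k - l) ^ (2 * order_bound + 2))" "0 \<le> C"
  shows "norm (z * of_real (factor k / factor l)) \<le> C * 2 ^ order_bound * inverse (weight (k - l) ^ 2)"
proof -
  have w: "weight (k - l) \<noteq> 0" using weight_pos[of "k - l"] by linarith
  have "norm (z * of_real (factor k / factor l)) = norm z * (factor k / factor l)"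
    by (simp add: norm_mult norm_divide abs_of_pos)
  also have "\<dots> \<le> C * inverse (weight (k - l) ^ (2 * order_bound + 2)) * (2 ^ order_bound * weight (k - l) ^ (2 * order_bound))"
    using assms by (intro mult_mono factor_ratio_le) (auto intro: divide_nonneg_nonneg less_imp_le)
  also have "\<dots> = C * 2 ^ order_bound * (inverse (weight (k - l) ^ (2 * order_bound + 2)) * weight (k - l) ^ (2 * order_bound))"
    by simp
  also have "inverse (weight (k - l) ^ (2 * order_bound + 2)) * weight (k - l) ^ (2 * order_bound) = inverse (weight (k - l) ^ 2)"
    by (simp only: power_add inverse_mult_distrib) (simp add: w)
  finally show ?thesis .
qed

lemma norm_gramian_le: "norm (gramian g T n \<alpha> k l) \<le> norm (control_matrix g k l) * T"
proof -
  have "profile_mass T n \<le> integral {0..T} (\<lambda>t. 1)"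
    unfolding profile_mass_def
    by (intro integral_le integrable_continuous_real continuous_intros profile_le_1)
  hence "profile_mass T n \<le> T" using T_pos by simp
  hence "norm (profile_ft T n \<mu>) \<le> T" for \<mu>
    using norm_profile_ft_le[OF T_pos, of n \<mu>] by linarith
  thus ?thesis unfolding gramian_def norm_mult by (intro mult_left_mono) auto
qed

lemma dominated_entries:
  "\<exists>C>0. dominated_matrix control_entry (\<lambda>d. C * inverse (weight d ^ 2)) \<and>
    (\<forall>n \<alpha>. dominated_matrix (gramian_entry n \<alpha>) (\<lambda>d. C * inverse (weight d ^ 2)))"
proof -
  obtain C where C: "C > 0" "\<And>k l. norm (control_matrix g k l) \<le> C * inverse (weight (k - l) ^ (2 * order_bound + 2))"
    using control_matrix_decay by blast
  define C' where "C' = C * (1 + T) * 2 ^ order_bound"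
  have sum: "(\<lambda>d. C' * inverse (weight d ^ 2)) summable_on UNIV"
    by (intro summable_on_cmult_right summable_inverse_weight) simp
  have mono: "norm (z * of_real (factor k / factor l)) \<le> C' * inverse (weight (k - l) ^ 2)"
    if "norm z \<le> norm (control_matrix g k l) * (1 + T)" for z :: complex and k l
    unfolding C'_def
  proof (rule norm_rescaled_entry_le)
    have "norm z \<le> C * inverse (weight (k - l) ^ (2 * order_bound + 2)) * (1 + T)"
      by (rule order_trans[OF that mult_right_mono[OF C(2)]]) (use T_pos in simp)
    thus "norm z \<le> C * (1 + T) * inverse (weight (k - l) ^ (2 * order_bound + 2))" by (simp add: mult_ac)
  qed (use C T_pos in simp)
  have "dominated_matrix control_entry (\<lambda>d. C' * inverse (weight d ^ 2))"
  proof (unfold_locales, unfold control_entry_def, rule mono)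
    fix k l
    have "norm (control_matrix g k l / (2 * pi)) = norm (control_matrix g k l) / (2 * pi)"
      by (simp add: norm_divide)
    also have "\<dots> \<le> norm (control_matrix g k l) / 1" using pi_gt3 by (intro divide_left_mono) auto
    also have "\<dots> = norm (control_matrix g k l) * 1" by simp
    also have "\<dots> \<le> norm (control_matrix g k l) * (1 + T)" using T_pos by (intro mult_left_mono) auto
    finally show "norm (control_matrix g k l / (2 * pi)) \<le> norm (control_matrix g k l) * (1 + T)" .
  qed (rule sum)
  moreover have "dominated_matrix (gramian_entry n \<alpha>) (\<lambda>d. C' * inverse (weight d ^ 2))" for n \<alpha>
  proof (unfold_locales, unfold gramian_entry_def, rule mono)
    fix k l
    have "norm (control_matrix g k l) * T \<le> norm (control_matrix g k l) * (1 + T)" by (intro mult_left_mono) auto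
    thus "norm (gramian g T n \<alpha> k l) \<le> norm (control_matrix g k l) * (1 + T)"
      using norm_gramian_le[of n \<alpha> k l] by linarith
  qed (rule sum)
  moreover have "0 < C'" using C T_pos by (simp add: C'_def)
  ultimately show ?thesis by blast
qed

text \<open>
  The mean-zero constraint is removed by filling the vanishing zeroth row and column of the
  Gramian with the coercivity constant.
\<close>

definition augmented :: "real \<Rightarrow> nat \<Rightarrow> real \<Rightarrow> int \<Rightarrow> int \<Rightarrow> complex" where
  "augmented c n \<alpha> k l = gramian g T n \<alpha> k l + (if k = 0 \<and> l = 0 then of_real c else 0)"

lemma gramian_0 [simp]: "gramian g T n \<alpha> 0 l = 0" "gramian g T n \<alpha> k 0 = 0"
  by (simp_all add: gramian_def)

lemma augmented_coercive:
  assumes "coercive_on_mean_zero (gramian g T n \<alpha>) c" and S: "finite S"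
  shows "c * (\<Sum>k\<in>S. (norm (a k))\<^sup>2) \<le> Re (\<Sum>k\<in>S. \<Sum>l\<in>S. augmented c n \<alpha> k l * a l * cnj (a k))"
proof -
  define e where "e = (if 0 \<in> S then c * (norm (a 0))\<^sup>2 else 0)"
  have row: "(\<Sum>l\<in>S. gramian g T n \<alpha> k l * a l * cnj (a k)) = (\<Sum>l\<in>S - {0}. gramian g T n \<alpha> k l * a l * cnj (a k))" for k
    using S by (intro sum.mono_neutral_right) auto
  have "(\<Sum>k\<in>S. \<Sum>l\<in>S. gramian g T n \<alpha> k l * a l * cnj (a k)) =
      (\<Sum>k\<in>S - {0}. \<Sum>l\<in>S - {0}. gramian g T n \<alpha> k l * a l * cnj (a k))"
    unfolding row using S by (intro sum.mono_neutral_right) auto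
  moreover have "(\<Sum>k\<in>S. \<Sum>l\<in>S. (if k = 0 \<and> l = 0 then of_real c else 0) * a l * cnj (a k)) = of_real e"
  proof -
    have i: "(\<Sum>l\<in>S. (if k = 0 \<and> l = 0 then of_real c else 0) * a l * cnj (a k)) = (if k = 0 then of_real e else 0)"
      if "k \<in> S" for k
    proof (cases "k = 0")
      case True
      have "(\<Sum>l\<in>S. (if k = 0 \<and> l = 0 then of_real c else 0) * a l * cnj (a k)) =
          (\<Sum>l\<in>S. if l = 0 then of_real c * a 0 * cnj (a 0) else 0)"
        using True by (intro sum.cong) auto
      also have "\<dots> = of_real c * (a 0 * cnj (a 0))" using S True that by (simp add: mult.assoc)
      also have "\<dots> = of_real e"
        using True that by (simp only: e_def complex_norm_square[symmetric] of_real_mult if_True)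
      finally show ?thesis using True by simp
    qed simp
    have "(\<Sum>k\<in>S. \<Sum>l\<in>S. (if k = 0 \<and> l = 0 then of_real c else 0) * a l * cnj (a k)) =
        (\<Sum>k\<in>S. if k = 0 then of_real e else 0)"
      by (rule sum.cong[OF refl i])
    also have "\<dots> = of_real e" using S by (simp add: e_def)
    finally show ?thesis .
  qed
  ultimately have "(\<Sum>k\<in>S. \<Sum>l\<in>S. augmented c n \<alpha> k l * a l * cnj (a k)) =
      (\<Sum>k\<in>S - {0}. \<Sum>l\<in>S - {0}. gramian g T n \<alpha> k l * a l * cnj (a k)) + of_real e"
    by (simp add: augmented_def distrib_right sum.distrib)
  moreover have "c * (\<Sum>k\<in>S - {0}. (norm (a k))\<^sup>2) \<le> Re (\<Sum>k\<in>S - {0}. \<Sum>l\<in>S - {0}. gramian g T n \<alpha> k l * a l * cnj (a k))"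
    using assms unfolding coercive_on_mean_zero_def by auto
  moreover have "c * (\<Sum>k\<in>S. (norm (a k))\<^sup>2) = c * (\<Sum>k\<in>S - {0}. (norm (a k))\<^sup>2) + e"
  proof (cases "0 \<in> S")
    case True
    thus ?thesis using S by (simp add: e_def sum.remove[of S 0] distrib_left)
  qed (simp add: e_def)
  ultimately show ?thesis by (simp only: plus_complex.sel Re_complex_of_real)
qed

lemma slow_weight_over_factor: "slow_weight s \<epsilon> k / factor k \<le> 2 ^ order_bound" if "0 \<le> \<epsilon>" "\<epsilon> \<le> 1"
proof -
  define x where "x = \<bar>real_of_int k\<bar>"
  have x: "0 \<le> x" by (simp add: x_def)
  have "\<epsilon> * x \<le> 1 * x" using that x by (intro mult_right_mono) auto
  hence "(1 + \<epsilon> * x)\<^sup>2 \<le> (1 + x)\<^sup>2" using that x by (intro power_mono) auto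
  also have "\<dots> \<le> 2 * (1 + x\<^sup>2)" using zero_le_power2[of "1 - x"] by (simp add: power2_eq_square algebra_simps)
  finally have b: "(1 + \<epsilon> * x)\<^sup>2 / (1 + x\<^sup>2) \<le> 2" by (simp add: pos_divide_le_eq add_pos_nonneg)
  have e: "0 \<le> \<epsilon> * x" using that x by simp
  have "(slow_weight s \<epsilon> k)\<^sup>2 = ((1 + \<epsilon> * x) powr s) * ((1 + \<epsilon> * x) powr s)"
    by (simp add: slow_weight_def x_def power2_eq_square)
  also have "\<dots> = ((1 + \<epsilon> * x)\<^sup>2) powr s" using e by (simp add: powr_mult power2_eq_square)
  finally have "(slow_weight s \<epsilon> k / factor k)\<^sup>2 = ((1 + \<epsilon> * x)\<^sup>2) powr s / (2 * pi * (1 + x\<^sup>2) powr s)"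
    by (simp add: power_divide factor_square x_def)
  also have "\<dots> = ((1 + \<epsilon> * x)\<^sup>2 / (1 + x\<^sup>2)) powr s / (2 * pi)"
    using e by (simp add: powr_divide add_nonneg_nonneg)
  also have "\<dots> \<le> ((1 + \<epsilon> * x)\<^sup>2 / (1 + x\<^sup>2)) powr s / 1"
    using pi_gt3 by (intro divide_left_mono) auto
  also have "\<dots> \<le> 2 powr s" using b s_nonneg by (simp add: powr_mono2)
  also have "\<dots> \<le> 2 powr real order_bound" using order_bound by (intro powr_mono) auto
  also have "\<dots> = 2 ^ order_bound" by (simp add: powr_realpow)
  also have "(2::real) ^ order_bound \<le> (2 ^ order_bound)\<^sup>2"
    using one_le_power[of "2::real" order_bound] by (simp add: power2_eq_square)
  finally show ?thesis by (rule power2_le_imp_le) simp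
qed

lemma factor_over_slow_weight: "factor k / slow_weight s \<epsilon> k \<le> sqrt (2 * pi) / \<epsilon> powr s" if "0 < \<epsilon>" "\<epsilon> \<le> 1"
proof -
  define x where "x = \<bar>real_of_int k\<bar>"
  have x: "0 \<le> x" by (simp add: x_def)
  have "(1 + x\<^sup>2) powr s \<le> ((1 + x)\<^sup>2) powr s"
    using x s_nonneg by (intro powr_mono2) (auto simp: power2_sum)
  also have "\<dots> = ((1 + x) powr s)\<^sup>2" using x by (simp add: powr_mult power2_eq_square)
  finally have "2 * pi * (1 + x\<^sup>2) powr s \<le> 2 * pi * ((1 + x) powr s)\<^sup>2" by simp
  hence "sqrt (2 * pi * (1 + x\<^sup>2) powr s) \<le> sqrt (2 * pi * ((1 + x) powr s)\<^sup>2)"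
    by (rule real_sqrt_le_mono)
  hence "factor k \<le> sqrt (2 * pi) * (1 + x) powr s"
    by (simp add: factor_def x_def real_sqrt_mult)
  moreover have "\<epsilon> powr s * (1 + x) powr s \<le> slow_weight s \<epsilon> k"
  proof -
    have "\<epsilon> * (1 + x) \<le> 1 + \<epsilon> * x" using that by (simp add: algebra_simps)
    hence "(\<epsilon> * (1 + x)) powr s \<le> (1 + \<epsilon> * x) powr s" using that x s_nonneg by (intro powr_mono2) auto
    thus ?thesis using that x by (simp add: slow_weight_def x_def powr_mult)
  qed
  moreover have e: "0 < \<epsilon> powr s" using that by simp
  ultimately have "factor k * \<epsilon> powr s \<le> sqrt (2 * pi) * slow_weight s \<epsilon> k"
  proof -
    assume a: "factor k \<le> sqrt (2 * pi) * (1 + x) powr s" and b: "\<epsilon> powr s * (1 + x) powr s \<le> slow_weight s \<epsilon> k"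
    have "factor k * \<epsilon> powr s \<le> sqrt (2 * pi) * (1 + x) powr s * \<epsilon> powr s" by (rule mult_right_mono[OF a]) simp
    also have "\<dots> = sqrt (2 * pi) * (\<epsilon> powr s * (1 + x) powr s)" by simp
    also have "\<dots> \<le> sqrt (2 * pi) * slow_weight s \<epsilon> k" by (rule mult_left_mono[OF b]) simp
    finally show ?thesis .
  qed
  thus ?thesis using slow_weight_pos[of \<epsilon> s k] that e by (simp add: field_simps)
qed

text \<open>
  Conjugating the augmented Gramian with the slow weight changes each entry by a factor close to
  \<open>1\<close>, uniformly thanks to the off-diagonal decay. For small \<open>\<epsilon>\<close> the conjugated matrix is still
  coercive on square-summable sequences, and the Lax-Milgram theorem solves the system. Undoing the
  conjugation gives a solution in the Sobolev scale, with constants that involve \<open>\<epsilon>\<close> but not \<open>\<alpha>\<close>.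
\<close>

theorem gramian_solvable:
  "\<exists>C>0. \<forall>\<alpha>>0. \<exists>n. \<forall>y. coord y 0 = 0 \<longrightarrow> (\<exists>x. matrix_op (gramian_entry n \<alpha>) x = y \<and> norm x \<le> C * norm y)"
proof -
  obtain c where cm: "0 < c" "\<forall>\<alpha>>0. \<exists>n. coercive_on_mean_zero (gramian g T n \<alpha>) c"
    using gramian_coercive[OF T_pos] by blast
  obtain C0 where C0: "C0 > 0" "\<And>k l. norm (control_matrix g k l) \<le> C0 * inverse (weight (k - l) ^ (order_bound + 2))"
    using control_matrix_decay by blast
  define K where "K = C0 * T + c"
  have K: "0 < K" using C0 T_pos cm by (simp add: K_def add_pos_pos)
  define W where "W = (\<Sum>\<^sub>\<infinity>d. inverse (weight d ^ 2))"
  have sumW: "(\<lambda>d. inverse (weight d ^ p)) summable_on UNIV" if "2 \<le> p" for p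
    by (rule summable_inverse_weight[OF that])
  have "(\<Sum>d\<in>{0}. inverse (weight d ^ 2)) \<le> W"
    unfolding W_def by (rule finite_sum_le_infsum) (auto intro: sumW)
  hence W: "0 < W" by (simp add: weight_def)
  \<comment> \<open>The perturbation has norm at most \<open>\<epsilon> K W\<close>, which must not exceed half of \<open>c\<close>.\<close>
  define \<epsilon> where "\<epsilon> = min 1 (c / (2 * K * W))"
  have \<epsilon>: "0 < \<epsilon>" "\<epsilon> \<le> 1" "\<epsilon> * (K * W) \<le> c / 2"
  proof -
    show "0 < \<epsilon>" "\<epsilon> \<le> 1" using cm K W by (auto simp: \<epsilon>_def)
    have "\<epsilon> \<le> c / (2 * K * W)" by (simp add: \<epsilon>_def)
    hence "\<epsilon> * (K * W) \<le> c / (2 * K * W) * (K * W)" using K W by (intro mult_right_mono) auto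
    thus "\<epsilon> * (K * W) \<le> c / 2" using K W by simp
  qed
  define V where "V = slow_weight s \<epsilon>"
  have V: "0 < V k" for k unfolding V_def using \<epsilon> by (intro slow_weight_pos) auto
  have Vne: "complex_of_real (V k) \<noteq> 0" for k using V[of k] by simp
  define c1 where "c1 = (2::real) ^ order_bound"
  define c2 where "c2 = sqrt (2 * pi) / \<epsilon> powr s"
  have c12: "0 < c1" "0 < c2" using \<epsilon> by (simp_all add: c1_def c2_def)
  define C where "C = c2 * (2 / c * c1)"
  have "\<exists>n. \<forall>y. coord y 0 = 0 \<longrightarrow> (\<exists>x. matrix_op (gramian_entry n \<alpha>) x = y \<and> norm x \<le> C * norm y)"
    if \<alpha>: "0 < \<alpha>" for \<alpha>
  proof -
    obtain n where n: "coercive_on_mean_zero (gramian g T n \<alpha>) c" using cm \<alpha> by blast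
    define A where "A = augmented c n \<alpha>"
    define D where "D = (\<lambda>k l. A k l * of_real (V k / V l - 1))"
    have Ab: "norm (A k l) \<le> K * inverse (weight (k - l) ^ (order_bound + 2))" for k l
    proof -
      have "norm (A k l) \<le> norm (gramian g T n \<alpha> k l) + norm (if k = 0 \<and> l = 0 then of_real c else 0 :: complex)"
        unfolding A_def augmented_def by (rule norm_triangle_ineq)
      also have "norm (if k = 0 \<and> l = 0 then of_real c else 0 :: complex) \<le> c * inverse (weight (k - l) ^ (order_bound + 2))"
        using cm(1) by (auto simp: weight_def)
      also have "norm (gramian g T n \<alpha> k l) \<le> C0 * inverse (weight (k - l) ^ (order_bound + 2)) * T"
        using norm_gramian_le[of n \<alpha> k l] mult_right_mono[OF C0(2), of T k l] T_pos by linarith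
      finally show ?thesis by (simp add: K_def algebra_simps)
    qed
    interpret A: dominated_matrix A "\<lambda>d. K * inverse (weight d ^ (order_bound + 2))"
      by unfold_locales (rule Ab, intro summable_on_cmult_right sumW, simp)
    interpret D: dominated_matrix D "\<lambda>d. \<epsilon> * K * inverse (weight d ^ 2)"
    proof unfold_locales
      fix k l
      have w: "weight (k - l) \<noteq> 0" using weight_pos[of "k - l"] by linarith
      have "norm (D k l) = norm (A k l) * \<bar>V k / V l - 1\<bar>"
        unfolding D_def norm_mult norm_of_real ..
      also have "\<dots> \<le> K * inverse (weight (k - l) ^ (order_bound + 2)) * (\<epsilon> * weight (k - l) ^ order_bound)"
        unfolding V_def using \<epsilon> s_nonneg order_bound K by (intro mult_mono Ab slow_weight_ratio) auto
      also have "\<dots> = \<epsilon> * K * (inverse (weight (k - l) ^ (order_bound + 2)) * weight (k - l) ^ order_bound)"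
        by simp
      also have "inverse (weight (k - l) ^ (order_bound + 2)) * weight (k - l) ^ order_bound = inverse (weight (k - l) ^ 2)"
        by (simp only: power_add inverse_mult_distrib) (simp add: w)
      finally show "norm (D k l) \<le> \<epsilon> * K * inverse (weight (k - l) ^ 2)" .
    qed (auto intro: summable_on_cmult_right sumW)
    define B where "B = (\<lambda>z. matrix_op A z + matrix_op D z)"
    have blB: "bounded_linear B"
      unfolding B_def by (intro bounded_linear_add A.bounded_linear_matrix_op D.bounded_linear_matrix_op)
    have coer: "c / 2 * (norm z)\<^sup>2 \<le> B z \<bullet> z" for z
    proof -
      have "c * (norm z)\<^sup>2 \<le> matrix_op A z \<bullet> z"
        unfolding A_def by (rule A.matrix_op_coercive[unfolded A_def]) (rule augmented_coercive[OF n])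
      moreover have "norm (matrix_op D z) \<le> c / 2 * norm z"
      proof -
        have "norm (matrix_op D z) \<le> (\<epsilon> * K * W) * norm z"
          using D.norm_matrix_op_le[of z] by (simp add: W_def infsum_cmult_right')
        also have "\<dots> \<le> c / 2 * norm z" using \<epsilon>(3) by (intro mult_right_mono) (auto simp: mult.assoc)
        finally show ?thesis .
      qed
      hence "norm (matrix_op D z) * norm z \<le> c / 2 * norm z * norm z" by (rule mult_right_mono) simp
      hence "- (matrix_op D z \<bullet> z) \<le> c / 2 * (norm z)\<^sup>2"
        using Cauchy_Schwarz_ineq2[of "matrix_op D z" z] by (simp add: power2_eq_square abs_le_iff)
      ultimately show ?thesis by (simp add: B_def inner_add_left)
    qed
    have cB: "((\<lambda>l. A k l * of_real (V k / V l) * coord z l) has_sum coord (B z) k) UNIV" for k z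
    proof -
      have "((\<lambda>l. A k l * coord z l + D k l * coord z l) has_sum coord (B z) k) UNIV"
        unfolding B_def coord_simps by (intro has_sum_add A.has_sum_matrix_op D.has_sum_matrix_op)
      moreover have "A k l * coord z l + D k l * coord z l = A k l * of_real (V k / V l) * coord z l" for l
        by (simp add: D_def algebra_simps)
      ultimately show ?thesis by (simp only:)
    qed
    have "\<exists>x. matrix_op (gramian_entry n \<alpha>) x = y \<and> norm x \<le> C * norm y" if y0: "coord y 0 = 0" for y
    proof -
      have b1: "norm (complex_of_real (V k / factor k)) \<le> c1" for k
        using slow_weight_over_factor[of \<epsilon> k] \<epsilon> V[of k] by (simp add: V_def c1_def norm_divide abs_of_pos)
      have b2: "norm (complex_of_real (factor k / V k)) \<le> c2" for k
        using factor_over_slow_weight[of \<epsilon> k] \<epsilon> V[of k] by (simp add: V_def c2_def norm_divide abs_of_pos)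
      define y' where "y' = diagonal_op 0 (\<lambda>k. of_real (V k / factor k)) y"
      have y': "coord y' k = of_real (V k / factor k) * coord y k" "norm y' \<le> c1 * norm y" for k
        unfolding y'_def using diagonal_op[of "\<lambda>k. of_real (V k / factor k)" c1 0 y] b1 by auto
      obtain z where z: "B z = y'" "norm z \<le> norm y' / (c / 2)"
        using lax_milgram[OF blB _ coer, of y'] cm(1) by auto
      define x where "x = diagonal_op 0 (\<lambda>k. of_real (factor k / V k)) z"
      have x: "coord x k = of_real (factor k / V k) * coord z k" "norm x \<le> c2 * norm z" for k
        unfolding x_def using diagonal_op[of "\<lambda>k. of_real (factor k / V k)" c2 0 z] b2 by auto
      obtain C1 where "dominated_matrix (gramian_entry n \<alpha>) (\<lambda>d. C1 * inverse (weight d ^ 2))"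
        using dominated_entries by blast
      then interpret G: dominated_matrix "gramian_entry n \<alpha>" "\<lambda>d. C1 * inverse (weight d ^ 2)" .
      have "matrix_op (gramian_entry n \<alpha>) x = y"
      proof (rule ell2_eqI)
        fix k
        show "coord (matrix_op (gramian_entry n \<alpha>) x) k = coord y k"
        proof (cases "k = 0")
          case True
          have "((\<lambda>l. gramian_entry n \<alpha> 0 l * coord x l) has_sum 0) UNIV"
            by (simp add: gramian_entry_def)
          thus ?thesis using has_sum_unique[OF G.has_sum_matrix_op] True y0 by simp
        next
          case False
          have "((\<lambda>l. of_real (factor k / V k) * (A k l * of_real (V k / V l) * coord z l)) has_sum
              of_real (factor k / V k) * coord (B z) k) UNIV"
            by (intro has_sum_cmult_right cB)
          moreover have "of_real (factor k / V k) * (A k l * of_real (V k / V l) * coord z l) = gramian_entry n \<alpha> k l * coord x l" for l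
            using False Vne[of k] by (simp add: A_def augmented_def gramian_entry_def x field_simps)
          moreover have "of_real (factor k / V k) * coord (B z) k = coord y k"
            using Vne[of k] by (simp add: z y')
          ultimately have "((\<lambda>l. gramian_entry n \<alpha> k l * coord x l) has_sum coord y k) UNIV" by (simp only:)
          thus ?thesis by (rule has_sum_unique[OF G.has_sum_matrix_op])
        qed
      qed
      moreover have "norm x \<le> C * norm y"
      proof -
        have "norm z \<le> 2 / c * norm y'" using z(2) by (simp add: mult.commute)
        also have "\<dots> \<le> 2 / c * (c1 * norm y)" using y'(2) cm(1) by (intro mult_left_mono) auto
        finally have "c2 * norm z \<le> c2 * (2 / c * (c1 * norm y))" using c12 by (intro mult_left_mono) auto
        thus ?thesis using x(2) by (simp add: C_def mult.assoc)
      qed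
      ultimately show ?thesis by blast
    qed
    thus ?thesis by blast
  qed
  moreover have "0 < C" using c12 cm by (simp add: C_def)
  ultimately show ?thesis by blast
qed

end

section \<open>The controlled evolution\<close>

lemma bounded_linear_integral:
  fixes P :: "real \<Rightarrow> 'a::real_normed_vector \<Rightarrow> 'b::banach"
  assumes "a \<le> b" "\<And>t. bounded_linear (P t)" "\<And>t x. t \<in> {a..b} \<Longrightarrow> norm (P t x) \<le> K * norm x"
    and cont: "\<And>x. continuous_on {a..b} (\<lambda>t. P t x)"
  shows "bounded_linear (\<lambda>x. integral {a..b} (\<lambda>t. P t x))"
proof (rule bounded_linear_intro[where K = "K * (b - a)"])
  have lin: "linear (P t)" for t using assms(2) by (rule bounded_linear.linear)
  have int: "(\<lambda>t. P t x) integrable_on {a..b}" for x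
    by (rule integrable_continuous_real[OF cont])
  fix x y :: 'a and r :: real
  show "integral {a..b} (\<lambda>t. P t (x + y)) = integral {a..b} (\<lambda>t. P t x) + integral {a..b} (\<lambda>t. P t y)"
    by (simp add: linear_add[OF lin] Henstock_Kurzweil_Integration.integral_add int)
  show "integral {a..b} (\<lambda>t. P t (r *\<^sub>R x)) = r *\<^sub>R integral {a..b} (\<lambda>t. P t x)"
    by (simp add: linear_scale[OF lin])
  have "norm (integral {a..b} (\<lambda>t. P t x)) \<le> (K * norm x) * (b - a)"
    by (rule integral_bound[OF assms(1) cont]) (use assms(3) in auto)
  thus "norm (integral {a..b} (\<lambda>t. P t x)) \<le> norm x * (K * (b - a))" by (simp add: mult_ac)
qed

context sobolev
begin

lemma benjamin_group_of_ell2: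
  "benjamin_group \<alpha> t (of_ell2 x) = of_ell2 (phase_op (dispersion \<alpha>) t x)"
proof -
  have e: "exp (\<i> * complex_of_real ((of_int k)\<^sup>2 * (\<alpha> * of_int (sgn k) - of_int k) * t)) =
      cis (dispersion \<alpha> k * t)" for k
    unfolding cis_conv_exp dispersion_def ..
  show ?thesis unfolding benjamin_group_def
  proof (rule the_equality)
    show "\<forall>k. fourier (of_ell2 (phase_op (dispersion \<alpha>) t x)) k =
        exp (\<i> * complex_of_real ((of_int k)\<^sup>2 * (\<alpha> * of_int (sgn k) - of_int k) * t)) * fourier (of_ell2 x) k"
      unfolding e by (simp add: fourier_of_ell2)
    fix v
    assume "\<forall>k. fourier v k =
        exp (\<i> * complex_of_real ((of_int k)\<^sup>2 * (\<alpha> * of_int (sgn k) - of_int k) * t)) * fourier (of_ell2 x) k"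
    thus "v = of_ell2 (phase_op (dispersion \<alpha>) t x)"
      unfolding e by (intro pdist_eqI) (simp add: fourier_of_ell2)
  qed
qed

lemma has_Hs_integral_continuous:
  fixes F :: "real \<Rightarrow> ell2"
  assumes "continuous_on {a..b} F"
  shows "has_Hs_integral s (lebesgue_on {a..b}) (\<lambda>t. of_ell2 (F t)) J \<longleftrightarrow> J = of_ell2 (integral {a..b} F)"
  by (rule has_Hs_integral_of_ell2[OF finite_measure_lebesgue_on has_bochner_integral_continuous[OF assms]]) simp

lemma C_Hs_of_ell2:
  assumes "continuous_on {0..T} F"
  shows "(\<lambda>t. of_ell2 (F t)) \<in> C_Hs s T"
proof -
  have "((\<lambda>r. norm (F r - F t)) \<longlongrightarrow> 0) (at t within {0..T})" if "t \<in> {0..T}" for t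
    using assms that unfolding continuous_on_def by (intro tendsto_norm_zero LIM_zero) auto
  thus ?thesis by (auto simp: C_Hs_def Hs_norm_of_ell2 simp flip: of_ell2_diff)
qed

lemma L2_Hs_of_ell2:
  assumes F: "continuous_on {0..T} F" and "0 \<le> T" and B: "\<And>t. t \<in> {0..T} \<Longrightarrow> norm (F t) \<le> B"
  shows "(\<lambda>t. of_ell2 (F t)) \<in> L2_Hs s T" "L2_Hs_norm s T (\<lambda>t. of_ell2 (F t)) \<le> sqrt T * B"
proof -
  have fm: "finite_measure (lebesgue_on {0..T})" by (rule finite_measure_lebesgue_on) simp
  have c: "continuous_on {0..T} (\<lambda>t. (norm (F t))\<^sup>2)" by (intro continuous_intros F)
  have i: "integrable (lebesgue_on {0..T}) (\<lambda>t. (norm (F t))\<^sup>2)"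
    using continuous_imp_integrable_real[OF c] .
  have "Hs_measurable s (lebesgue_on {0..T}) (\<lambda>t. of_ell2 (F t))"
    by (intro Hs_measurable_of_ell2 fm continuous_imp_measurable_on_sets_lebesgue F) simp
  thus "(\<lambda>t. of_ell2 (F t)) \<in> L2_Hs s T" using i by (simp add: L2_Hs_def Hs_norm_of_ell2)
  have "norm (F 0) \<le> B" using \<open>0 \<le> T\<close> by (intro B) simp
  hence "0 \<le> B" using norm_ge_zero[of "F 0"] by linarith
  have "(\<integral>t. (norm (F t))\<^sup>2 \<partial>lebesgue_on {0..T}) = integral {0..T} (\<lambda>t. (norm (F t))\<^sup>2)"
    by (rule lebesgue_integral_eq_integral[OF i]) simp
  also have "\<dots> \<le> integral {0..T} (\<lambda>t. B\<^sup>2)"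
    by (intro integral_le integrable_continuous_real c continuous_intros power_mono B) auto
  also have "\<dots> = T * B\<^sup>2" using \<open>0 \<le> T\<close> by simp
  finally have "sqrt (\<integral>t. (norm (F t))\<^sup>2 \<partial>lebesgue_on {0..T}) \<le> sqrt (T * B\<^sup>2)" by (rule real_sqrt_le_mono)
  thus "L2_Hs_norm s T (\<lambda>t. of_ell2 (F t)) \<le> sqrt T * B"
    using \<open>0 \<le> B\<close> by (simp add: L2_Hs_norm_def Hs_norm_of_ell2 real_sqrt_mult)
qed

end

context control_problem
begin

definition control :: "ell2 \<Rightarrow> ell2" where
  "control = matrix_op control_entry"

lemma bounded_linear_control: "bounded_linear control"
proof -
  obtain C where "dominated_matrix control_entry (\<lambda>d. C * inverse (weight d ^ 2))"
    using dominated_entries by blast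
  thus ?thesis unfolding control_def by (rule dominated_matrix.bounded_linear_matrix_op)
qed

lemma coord_control_single: "coord (control (single l z)) k = control_entry k l * z"
proof -
  obtain C where "dominated_matrix control_entry (\<lambda>d. C * inverse (weight d ^ 2))"
    using dominated_entries by blast
  thus ?thesis unfolding control_def by (rule dominated_matrix.coord_matrix_op_single)
qed

lemma control_op_of_ell2: "control_op g (of_ell2 x) = of_ell2 (control x)"
proof (rule pdist_eqI)
  fix k
  obtain C where C: "dominated_matrix control_entry (\<lambda>d. C * inverse (weight d ^ 2))"
    using dominated_entries by blast
  have "((\<lambda>l. of_real (2 * pi / factor k) * (control_entry k l * coord x l)) has_sum
      of_real (2 * pi / factor k) * coord (control x) k) UNIV"
    unfolding control_def by (intro has_sum_cmult_right dominated_matrix.has_sum_matrix_op[OF C])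
  moreover have "of_real (2 * pi / factor k) * (control_entry k l * coord x l) =
      control_matrix g k l * fourier (of_ell2 x) l" for l
    by (simp add: control_entry_def fourier_of_ell2)
  ultimately have "((\<lambda>l. control_matrix g k l * fourier (of_ell2 x) l) has_sum
      of_real (2 * pi / factor k) * coord (control x) k) UNIV"
    by (simp only:)
  from has_sum_unique[OF fourier_control_op[OF smooth] this]
  show "fourier (control_op g (of_ell2 x)) k = fourier (of_ell2 (control x)) k"
    by (simp add: fourier_of_ell2 field_simps)
qed

definition steering :: "nat \<Rightarrow> real \<Rightarrow> ell2 \<Rightarrow> real \<Rightarrow> ell2" where
  "steering n \<alpha> x t = profile T n t *\<^sub>R phase_op (dispersion \<alpha>) t x"

lemma continuous_on_steering: "continuous_on S (steering n \<alpha> x)"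
  unfolding steering_def by (intro continuous_intros continuous_on_phase_op)

lemma norm_steering_le: "norm (steering n \<alpha> x t) \<le> norm x"
  using mult_right_mono[OF profile_le_1[of T n t] norm_ge_zero, of x] profile_nonneg[of T n t]
  by (simp add: steering_def)

text \<open>
  Both sides are bounded linear functions of \<open>x\<close>, so it suffices to compare them on a single mode.
  There the time integral is the Fourier transform of the profile at the difference of two
  frequencies, which is how the Gramian arises.
\<close>

lemma integral_steering:
  "integral {0..T} (\<lambda>t. phase_op (dispersion \<alpha>) (T - t) (control (steering n \<alpha> x t))) =
    phase_op (dispersion \<alpha>) T ((1 / (2 * pi)) *\<^sub>R matrix_op (gramian_entry n \<alpha>) x)"
proof (rule bounded_linear_ell2_eqI[where x = x])
  obtain K where K: "\<And>y. norm (control y) \<le> norm y * K" "0 < K"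
    using bounded_linear.pos_bounded[OF bounded_linear_control] by blast
  have bl: "bounded_linear (\<lambda>x. phase_op (dispersion \<alpha>) (T - t) (control (steering n \<alpha> x t)))" for t
    unfolding steering_def
    by (intro bounded_linear_compose[OF bounded_linear_phase_op] bounded_linear_compose[OF bounded_linear_control]
        bounded_linear_compose[OF bounded_linear_scaleR_right] bounded_linear_phase_op)
  have cont: "continuous_on {0..T} (\<lambda>t. phase_op (dispersion \<alpha>) (T - t) (control (steering n \<alpha> x t)))" for x
    by (intro continuous_on_phase_op continuous_intros continuous_on_steering
        bounded_linear.continuous_on[OF bounded_linear_control])
  have "norm (phase_op (dispersion \<alpha>) (T - t) (control (steering n \<alpha> x t))) \<le> K * norm x" for t x
  proof -
    have "norm (control (steering n \<alpha> x t)) \<le> norm (steering n \<alpha> x t) * K" by (rule K)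
    also have "\<dots> \<le> norm x * K" using K(2) norm_steering_le by (intro mult_right_mono) auto
    finally show ?thesis by (simp add: mult.commute)
  qed
  thus "bounded_linear (\<lambda>x. integral {0..T} (\<lambda>t. phase_op (dispersion \<alpha>) (T - t) (control (steering n \<alpha> x t))))"
    using T_pos by (intro bounded_linear_integral[where K = K] bl cont) auto
  obtain C where C: "dominated_matrix (gramian_entry n \<alpha>) (\<lambda>d. C * inverse (weight d ^ 2))"
    using dominated_entries by blast
  show "bounded_linear (\<lambda>x. phase_op (dispersion \<alpha>) T ((1 / (2 * pi)) *\<^sub>R matrix_op (gramian_entry n \<alpha>) x))"
    by (intro bounded_linear_compose[OF bounded_linear_phase_op] bounded_linear_compose[OF bounded_linear_scaleR_right]
        dominated_matrix.bounded_linear_matrix_op[OF C])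
  fix l z
  show "integral {0..T} (\<lambda>t. phase_op (dispersion \<alpha>) (T - t) (control (steering n \<alpha> (single l z) t))) =
    phase_op (dispersion \<alpha>) T ((1 / (2 * pi)) *\<^sub>R matrix_op (gramian_entry n \<alpha>) (single l z))"
  proof (rule ell2_eqI)
    fix k
    have st: "steering n \<alpha> (single l z) t = single l (profile T n t *\<^sub>R (cis (dispersion \<alpha> l * t) * z))" for t
      unfolding steering_def phase_op_single
      by (rule linear_scale[OF bounded_linear.linear[OF bounded_linear_single], symmetric])
    have ce: "coord (phase_op (dispersion \<alpha>) (T - t) (control (steering n \<alpha> (single l z) t))) k =
        (cis (dispersion \<alpha> k * T) * control_entry k l * z) * (profile T n t * cis ((dispersion \<alpha> l - dispersion \<alpha> k) * t))" for t
    proof -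
      have "cis (dispersion \<alpha> k * (T - t)) * cis (dispersion \<alpha> l * t) =
          cis (dispersion \<alpha> k * T) * cis ((dispersion \<alpha> l - dispersion \<alpha> k) * t)"
        by (simp add: cis_mult algebra_simps)
      hence "cis (dispersion \<alpha> k * (T - t)) * (control_entry k l * (profile T n t * (cis (dispersion \<alpha> l * t) * z))) =
          (cis (dispersion \<alpha> k * T) * control_entry k l * z) * (profile T n t * cis ((dispersion \<alpha> l - dispersion \<alpha> k) * t))"
        by (simp add: mult_ac)
      thus ?thesis by (simp add: st coord_control_single scaleR_conv_of_real)
    qed
    have "coord (integral {0..T} (\<lambda>t. phase_op (dispersion \<alpha>) (T - t) (control (steering n \<alpha> (single l z) t)))) k =
        integral {0..T} (\<lambda>t. coord (phase_op (dispersion \<alpha>) (T - t) (control (steering n \<alpha> (single l z) t))) k)"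
      using integral_linear[OF integrable_continuous_real[OF cont[of "single l z"]] bounded_linear_coord[of k]]
      by (simp add: o_def)
    also have "\<dots> = (cis (dispersion \<alpha> k * T) * control_entry k l * z) * profile_ft T n (dispersion \<alpha> l - dispersion \<alpha> k)"
      unfolding ce profile_ft_def by (rule integral_mult_right)
    also have "\<dots> = coord (phase_op (dispersion \<alpha>) T ((1 / (2 * pi)) *\<^sub>R matrix_op (gramian_entry n \<alpha>) (single l z))) k"
      by (simp add: dominated_matrix.coord_matrix_op_single[OF C] control_entry_def gramian_entry_def
          gramian_def scaleR_conv_of_real)
    finally show "coord (integral {0..T} (\<lambda>t. phase_op (dispersion \<alpha>) (T - t) (control (steering n \<alpha> (single l z) t)))) k =
        coord (phase_op (dispersion \<alpha>) T ((1 / (2 * pi)) *\<^sub>R matrix_op (gramian_entry n \<alpha>) (single l z))) k" .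
  qed
qed

lemma mild_solution_of_ell2:
  "mild_solution s \<alpha> T g (of_ell2 a) (\<lambda>t. of_ell2 (F t)) v \<longleftrightarrow>
    (\<forall>t\<in>{0..T}. v t = of_ell2 (phase_op (dispersion \<alpha>) t a +
      integral {0..t} (\<lambda>t'. phase_op (dispersion \<alpha>) (t - t') (control (F t')))))"
  if F: "continuous_on {0..T} F"
proof -
  have "(\<exists>I. has_Hs_integral s (lebesgue_on {0..t}) (\<lambda>t'. benjamin_group \<alpha> (t - t') (control_op g (of_ell2 (F t')))) I \<and>
      v t = benjamin_group \<alpha> t (of_ell2 a) + I) \<longleftrightarrow>
    v t = of_ell2 (phase_op (dispersion \<alpha>) t a +
      integral {0..t} (\<lambda>t'. phase_op (dispersion \<alpha>) (t - t') (control (F t'))))" if t: "t \<in> {0..T}" for t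
  proof -
    have "continuous_on {0..t} (\<lambda>t'. phase_op (dispersion \<alpha>) (t - t') (control (F t')))"
      using t by (intro continuous_on_phase_op continuous_intros bounded_linear.continuous_on[OF bounded_linear_control]
          continuous_on_subset[OF F]) auto
    thus ?thesis
      by (simp add: control_op_of_ell2 benjamin_group_of_ell2 has_Hs_integral_continuous of_ell2_add)
  qed
  thus ?thesis unfolding mild_solution_def by (rule ball_cong[OF refl])
qed

text \<open>
  The group factors out of the integral, which leaves an indefinite integral.
\<close>

lemma continuous_on_duhamel:
  assumes F: "continuous_on {0..T} F"
  shows "continuous_on {0..T} (\<lambda>t. integral {0..t} (\<lambda>t'. phase_op \<theta> (t - t') (F t')))"
proof -
  define J where "J = (\<lambda>t. integral {0..t} (\<lambda>t'. phase_op \<theta> (- t') (F t')))"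
  have c: "continuous_on {0..T} (\<lambda>t'. phase_op \<theta> (- t') (F t'))"
    by (intro continuous_on_phase_op continuous_intros F)
  have e: "integral {0..t} (\<lambda>t'. phase_op \<theta> (t - t') (F t')) = phase_op \<theta> t (J t)" if "t \<in> {0..T}" for t
  proof -
    have "(\<lambda>t'. phase_op \<theta> (- t') (F t')) integrable_on {0..t}"
      using that by (intro integrable_continuous_real continuous_on_subset[OF c]) auto
    from integral_linear[OF this bounded_linear_phase_op, of \<theta> t]
    show ?thesis by (simp add: o_def J_def phase_op_phase_op)
  qed
  have "continuous_on {0..T} J"
    unfolding J_def by (rule indefinite_integral_continuous_1[OF integrable_continuous_real[OF c]])
  hence "continuous_on {0..T} (\<lambda>t. phase_op \<theta> t (J t))"
    by (intro continuous_on_phase_op continuous_intros)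
  thus ?thesis by (subst continuous_on_cong[OF refl e])
qed

text \<open>
  The control \<open>F\<close> is obtained from the solution \<open>x\<close> of the Gramian system whose right-hand side is
  the defect \<open>b - U(T) a\<close> transported back to time \<open>0\<close>. Uniqueness of the solution is immediate, as
  the mild formulation expresses it through \<open>u\<^sub>0\<close> and \<open>h\<close>.
\<close>

theorem exact_controllability:
  "\<exists>\<nu>>0. \<forall>\<alpha>>0. \<forall>u\<^sub>0\<in>Hs s. \<forall>u\<^sub>1\<in>Hs s. mean_value u\<^sub>0 = mean_value u\<^sub>1 \<longrightarrow>
    (\<exists>h\<in>L2_Hs s T.
       (\<exists>u\<in>C_Hs s T. mild_solution s \<alpha> T g u\<^sub>0 h u \<and> u T = u\<^sub>1 \<and>
          (\<forall>v\<in>C_Hs s T. mild_solution s \<alpha> T g u\<^sub>0 h v \<longrightarrow> (\<forall>t\<in>{0..T}. v t = u t))) \<and>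
       L2_Hs_norm s T h \<le> \<nu> * (Hs_norm s u\<^sub>0 + Hs_norm s u\<^sub>1))"
proof -
  obtain C where C: "0 < C" "\<forall>\<alpha>>0. \<exists>n. \<forall>y. coord y 0 = 0 \<longrightarrow>
      (\<exists>x. matrix_op (gramian_entry n \<alpha>) x = y \<and> norm x \<le> C * norm y)"
    using gramian_solvable by blast
  define \<nu> where "\<nu> = sqrt T * (C * (2 * pi))"
  have "\<exists>h\<in>L2_Hs s T.
       (\<exists>u\<in>C_Hs s T. mild_solution s \<alpha> T g u\<^sub>0 h u \<and> u T = u\<^sub>1 \<and>
          (\<forall>v\<in>C_Hs s T. mild_solution s \<alpha> T g u\<^sub>0 h v \<longrightarrow> (\<forall>t\<in>{0..T}. v t = u t))) \<and>
       L2_Hs_norm s T h \<le> \<nu> * (Hs_norm s u\<^sub>0 + Hs_norm s u\<^sub>1)"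
    if \<alpha>: "0 < \<alpha>" and u: "u\<^sub>0 \<in> Hs s" "u\<^sub>1 \<in> Hs s" and mean: "mean_value u\<^sub>0 = mean_value u\<^sub>1" for \<alpha> u\<^sub>0 u\<^sub>1
  proof -
    obtain n where n: "\<And>y. coord y 0 = 0 \<Longrightarrow> \<exists>x. matrix_op (gramian_entry n \<alpha>) x = y \<and> norm x \<le> C * norm y"
      using C(2) \<alpha> by blast
    obtain a b where a: "u\<^sub>0 = of_ell2 a" and b: "u\<^sub>1 = of_ell2 b"
      using Hs_conv_of_ell2 u by metis
    let ?V = "phase_op (dispersion \<alpha>)"
    \<comment> \<open>\<open>2\<pi>\<close> compensates the normalisation of the control matrix.\<close>
    define y where "y = (2 * pi) *\<^sub>R ?V (- T) (b - ?V T a)"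
    have "coord a 0 = coord b 0"
      using mean by (simp add: mean_value_conv_fourier a b fourier_of_ell2)
    hence "coord y 0 = 0" by (simp add: y_def dispersion_def)
    then obtain x where x: "matrix_op (gramian_entry n \<alpha>) x = y" "norm x \<le> C * norm y"
      using n by blast
    define F where "F = steering n \<alpha> x"
    have F: "continuous_on {0..T} F" unfolding F_def by (rule continuous_on_steering)
    define w where "w = (\<lambda>t. ?V t a + integral {0..t} (\<lambda>t'. ?V (t - t') (control (F t'))))"
    have "continuous_on {0..T} w"
      unfolding w_def
      by (intro continuous_on_add continuous_on_phase_op continuous_on_duhamel continuous_intros
          bounded_linear.continuous_on[OF bounded_linear_control] F)
    hence wC: "(\<lambda>t. of_ell2 (w t)) \<in> C_Hs s T" by (rule C_Hs_of_ell2)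
    have mild: "mild_solution s \<alpha> T g u\<^sub>0 (\<lambda>t. of_ell2 (F t)) v \<longleftrightarrow> (\<forall>t\<in>{0..T}. v t = of_ell2 (w t))" for v
      unfolding a w_def by (rule mild_solution_of_ell2[OF F])
    have "w T = ?V T a + ?V T ((1 / (2 * pi)) *\<^sub>R y)"
      unfolding w_def F_def integral_steering x(1) ..
    also have "(1 / (2 * pi)) *\<^sub>R y = ?V (- T) (b - ?V T a)" by (simp add: y_def)
    also have "?V T \<dots> = b - ?V T a"
      by (rule ell2_eqI) (simp add: phase_op_phase_op)
    finally have wT: "of_ell2 (w T) = u\<^sub>1" by (simp add: b)
    have "norm y \<le> 2 * pi * (norm b + norm a)"
      using norm_triangle_ineq4[of b "?V T a"] by (simp add: y_def)
    hence "C * norm y \<le> C * (2 * pi * (norm b + norm a))" using C(1) by (intro mult_left_mono) auto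
    hence "norm (F t) \<le> C * (2 * pi * (norm b + norm a))" for t
      unfolding F_def using norm_steering_le[of n \<alpha> x t] x(2) by linarith
    from L2_Hs_of_ell2[OF F _ this] T_pos
    have hL: "(\<lambda>t. of_ell2 (F t)) \<in> L2_Hs s T"
      and hn: "L2_Hs_norm s T (\<lambda>t. of_ell2 (F t)) \<le> sqrt T * (C * (2 * pi * (norm b + norm a)))" by auto
    have "sqrt T * (C * (2 * pi * (norm b + norm a))) = \<nu> * (Hs_norm s u\<^sub>0 + Hs_norm s u\<^sub>1)"
      by (simp add: \<nu>_def a b Hs_norm_of_ell2 mult_ac add.commute)
    with hn have "L2_Hs_norm s T (\<lambda>t. of_ell2 (F t)) \<le> \<nu> * (Hs_norm s u\<^sub>0 + Hs_norm s u\<^sub>1)" by simp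
    with hL wC wT mild show ?thesis
      by (intro bexI[of _ "\<lambda>t. of_ell2 (F t)"] conjI bexI[of _ "\<lambda>t. of_ell2 (w t)"]) auto
  qed
  moreover have "0 < \<nu>" using C(1) T_pos by (simp add: \<nu>_def)
  ultimately show ?thesis by blast
qed

end

theorem theorem1p1:
  fixes s T :: real and g :: "real \<Rightarrow> real"
  assumes "s \<ge> 0" and "T > 0"
    and "g \<in> smooth_periodic" and "\<And>x. g x \<ge> 0"
    and "integral {0..2 * pi} g = 1" and "open_arc {x. g x > 0}"
  shows "\<exists>\<nu>>0. \<forall>\<alpha>>0. \<forall>u\<^sub>0\<in>Hs s. \<forall>u\<^sub>1\<in>Hs s. mean_value u\<^sub>0 = mean_value u\<^sub>1 \<longrightarrow>
    (\<exists>h\<in>L2_Hs s T.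
       (\<exists>u\<in>C_Hs s T. mild_solution s \<alpha> T g u\<^sub>0 h u \<and> u T = u\<^sub>1 \<and>
          (\<forall>v\<in>C_Hs s T. mild_solution s \<alpha> T g u\<^sub>0 h v \<longrightarrow> (\<forall>t\<in>{0..T}. v t = u t))) \<and>
       L2_Hs_norm s T h \<le> \<nu> * (Hs_norm s u\<^sub>0 + Hs_norm s u\<^sub>1))"
proof -
  interpret control_problem g s T
    by unfold_locales (fact assms)+
  show ?thesis by (rule exact_controllability)
qed

end
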